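(* Let $n\ge1$, $s>0$, $\lambda>1$ and $1\le p\le\infty$. Then for every $\varepsilon>0$ the following continuous embeddings hold: $$\mathcal{L}^{p}_{2s+\varepsilon}(\mathbb R^n)\hookrightarrow\mathcal{L}^{p}_{s+\ln,\lambda}(\mathbb R^n)\hookrightarrow\mathcal{L}^{p}_{2s}(\mathbb R^n)\hookrightarrow L^p(\mathbb R^n).$$ Moreover, there exists a constant $C=C(n,p,s,\lambda,\varepsilon)\ge1$ such that for all $u\in\mathcal S(\mathbb R^n)$, $$\|u\|_{\mathcal{L}^{p}_{2s}}\le C\,\|u\|_{\mathcal{L}^{p}_{s+\ln,\lambda}}\qquad\text{and}\qquad \|u\|_{\mathcal{L}^{p}_{s+\ln,\lambda}}\le C\,\|u\|_{\mathcal{L}^{p}_{2s+\varepsilon}}.$$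
   Context: The Fourier transform is $\mathcal F u(\xi)=\widehat u(\xi)=\int_{\mathbb{R}^n}u(x)e^{-2\pi i x\cdot\xi}\,dx$, extended to $\mathcal S'(\mathbb R^n)$. For $s>0$, $\lambda>1$, $(\lambda I-\Delta)^{s+\ln}$ is the Fourier multiplier on $\mathcal S'(\mathbb R^n)$ with symbol $(\lambda+4\pi^2|\xi|^2)^s\ln(\lambda+4\pi^2|\xi|^2)$. The logarithmic Bessel space is $\mathcal L^{p}_{s+\ln,\lambda}(\mathbb R^n)=\{u\in\mathcal S'(\mathbb R^n):(\lambda I-\Delta)^{s+\ln}u\in L^p(\mathbb R^n)\}$ with norm $\|u\|_{\mathcal L^{p}_{s+\ln,\lambda}}=\|(\lambda I-\Delta)^{s+\ln}u\|_{L^p}$. For $\sigma>0$, the classical Bessel potential space is $\mathcal L^p_\sigma(\mathbb R^n)=\{u\in\mathcal S'(\mathbb R^n):\mathcal F^{-1}((1+4\pi^2|\xi|^2)^{\sigma/2}\widehat u)\in L^p(\mathbb R^n)\}$ with norm $\|u\|_{\mathcal L^p_\sigma}=\|\mathcal F^{-1}((1+4\pi^2|\xi|^2)^{\sigma/2}\widehat u)\|_{L^p}$. *)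

theory Defs
  imports "HOL-Probability.Essential_Supremum"
begin

section \<open>Schwartz functions and tempered distributions on \<open>\<real>\<^sup>n\<close>\<close>

text \<open>Iterated partial derivatives; a multi-index is given as a list of coordinate directions,
  so that \<open>[i, j, i]\<close> stands for \<open>\<partial>\<^sub>i \<partial>\<^sub>j \<partial>\<^sub>i\<close>.\<close>

primrec partials :: "'n list \<Rightarrow> (real ^ 'n \<Rightarrow> complex) \<Rightarrow> real ^ 'n \<Rightarrow> complex" where
  "partials [] f = f"
| "partials (i # is) f = (\<lambda>x. frechet_derivative (partials is f) (at x) (axis i 1))"

definition schwartz :: "(real ^ 'n \<Rightarrow> complex) set" where
  "schwartz = {f. \<forall>is. (\<forall>x. partials is f differentiable (at x)) \<and>
                       (\<forall>k. bounded (range (\<lambda>x. norm x ^ k * norm (partials is f x))))}"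

definition schwartz_seminorm :: "nat \<Rightarrow> 'n list \<Rightarrow> (real ^ 'n \<Rightarrow> complex) \<Rightarrow> real" where
  "schwartz_seminorm k is f = (SUP x. norm x ^ k * norm (partials is f x))"

text \<open>Functionals on the Schwartz space are made \<^const>\<open>extensional\<close>, i.e. they take a fixed
  dummy value off the Schwartz space, so that equality of distributions is HOL equality.
  Continuity is boundedness by finitely many of the seminorms defining the Schwartz topology.\<close>

type_synonym 'n distr = "(real ^ 'n \<Rightarrow> complex) \<Rightarrow> complex"

definition tempered :: "('n::finite) distr set" where
  "tempered = {u \<in> extensional schwartz.
     (\<forall>\<phi>\<in>schwartz. \<forall>\<psi>\<in>schwartz. \<forall>a b. u (\<lambda>x. a * \<phi> x + b * \<psi> x) = a * u \<phi> + b * u \<psi>) \<and>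
     (\<exists>C N. \<forall>\<phi>\<in>schwartz.
        norm (u \<phi>) \<le> C * (\<Sum>k\<le>N. \<Sum>is | length is \<le> N. schwartz_seminorm k is \<phi>))}"

text \<open>The distribution \<open>\<phi> \<mapsto> \<integral> f \<phi>\<close> given by a function \<open>f\<close>.\<close>

definition distr_of :: "(real ^ 'n \<Rightarrow> complex) \<Rightarrow> ('n::finite) distr" where
  "distr_of f = restrict (\<lambda>\<phi>. LINT x|lborel. f x * \<phi> x) schwartz"


section \<open>Fourier transform and Fourier multipliers\<close>

definition fourier :: "(real ^ 'n \<Rightarrow> complex) \<Rightarrow> real ^ 'n \<Rightarrow> complex" where
  "fourier f \<xi> = (LINT x|lborel. f x * exp (- 2 * of_real pi * \<i> * of_real (x \<bullet> \<xi>)))"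

definition inv_fourier :: "(real ^ 'n \<Rightarrow> complex) \<Rightarrow> real ^ 'n \<Rightarrow> complex" where
  "inv_fourier f x = (LINT \<xi>|lborel. f \<xi> * exp (2 * of_real pi * \<i> * of_real (x \<bullet> \<xi>)))"

text \<open>The extensions to tempered distributions, by transposition.\<close>

definition fourier_distr :: "('n::finite) distr \<Rightarrow> 'n distr" where
  "fourier_distr u = restrict (\<lambda>\<phi>. u (fourier \<phi>)) schwartz"

definition inv_fourier_distr :: "('n::finite) distr \<Rightarrow> 'n distr" where
  "inv_fourier_distr u = restrict (\<lambda>\<phi>. u (inv_fourier \<phi>)) schwartz"

text \<open>Only meaningful for \<open>m\<close> smooth with all derivatives of at most polynomial growth.\<close>

definition mult_distr :: "(real ^ 'n \<Rightarrow> complex) \<Rightarrow> ('n::finite) distr \<Rightarrow> 'n distr" where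
  "mult_distr m u = restrict (\<lambda>\<phi>. u (\<lambda>\<xi>. m \<xi> * \<phi> \<xi>)) schwartz"

definition fourier_multiplier :: "(real ^ 'n \<Rightarrow> complex) \<Rightarrow> ('n::finite) distr \<Rightarrow> 'n distr" where
  "fourier_multiplier m u = inv_fourier_distr (mult_distr m (fourier_distr u))"


section \<open>\<open>L\<^sup>p\<close> as a space of tempered distributions\<close>

definition Lp_fun_norm :: "ennreal \<Rightarrow> (real ^ 'n \<Rightarrow> complex) \<Rightarrow> ennreal" where
  "Lp_fun_norm p f =
     (if p = \<infinity> then esssup lborel (\<lambda>x. ennreal (norm (f x)))
      else let I = (\<integral>\<^sup>+x. ennreal (norm (f x) powr enn2real p) \<partial>lborel)
           in if I = \<infinity> then \<infinity> else ennreal (enn2real I powr (1 / enn2real p)))"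

text \<open>Borel measurability loses nothing, as every Lebesgue measurable function agrees almost
  everywhere with a Borel measurable one.\<close>

definition Lp_fun :: "ennreal \<Rightarrow> (real ^ 'n \<Rightarrow> complex) set" where
  "Lp_fun p = {f \<in> borel_measurable lborel. Lp_fun_norm p f < \<infinity>}"

definition Lp_space :: "ennreal \<Rightarrow> ('n::finite) distr set" where
  "Lp_space p = {u \<in> tempered. \<exists>f\<in>Lp_fun p. u = distr_of f}"

text \<open>The representing function is unique up to null sets, so for \<open>u\<close> in \<open>L\<^sup>p\<close> the infimum
  ranges over a single value; for other \<open>u\<close> it is \<open>\<infinity>\<close>.\<close>

definition Lp_norm :: "ennreal \<Rightarrow> ('n::finite) distr \<Rightarrow> ennreal" where
  "Lp_norm p u = (INF f \<in> {f \<in> Lp_fun p. u = distr_of f}. Lp_fun_norm p f)"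


section \<open>Bessel potential spaces and logarithmic Bessel spaces\<close>

text \<open>The operator \<open>u \<mapsto> \<F>\<^sup>-\<^sup>1 ((1 + 4 \<pi>\<^sup>2 |\<xi>|\<^sup>2)\<^bsup>\<sigma>/2\<^esup> \<F> u)\<close>.\<close>

definition bessel_op :: "real \<Rightarrow> ('n::finite) distr \<Rightarrow> 'n distr" where
  "bessel_op \<sigma> =
     fourier_multiplier (\<lambda>\<xi>. of_real ((1 + 4 * pi\<^sup>2 * (norm \<xi>)\<^sup>2) powr (\<sigma> / 2)))"

definition bessel_space :: "ennreal \<Rightarrow> real \<Rightarrow> ('n::finite) distr set" where
  "bessel_space p \<sigma> = {u \<in> tempered. bessel_op \<sigma> u \<in> Lp_space p}"

definition bessel_norm :: "ennreal \<Rightarrow> real \<Rightarrow> ('n::finite) distr \<Rightarrow> ennreal" where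
  "bessel_norm p \<sigma> u = Lp_norm p (bessel_op \<sigma> u)"

text \<open>The operator \<open>(l I - \<Delta>)\<^bsup>s + ln\<^esup>\<close>.\<close>

definition log_bessel_op :: "real \<Rightarrow> real \<Rightarrow> ('n::finite) distr \<Rightarrow> 'n distr" where
  "log_bessel_op s l =
     fourier_multiplier (\<lambda>\<xi>. of_real ((l + 4 * pi\<^sup>2 * (norm \<xi>)\<^sup>2) powr s
                                     * ln (l + 4 * pi\<^sup>2 * (norm \<xi>)\<^sup>2)))"

definition log_bessel_space :: "ennreal \<Rightarrow> real \<Rightarrow> real \<Rightarrow> ('n::finite) distr set" where
  "log_bessel_space p s l = {u \<in> tempered. log_bessel_op s l u \<in> Lp_space p}"

definition log_bessel_norm :: "ennreal \<Rightarrow> real \<Rightarrow> real \<Rightarrow> ('n::finite) distr \<Rightarrow> ennreal" where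
  "log_bessel_norm p s l u = Lp_norm p (log_bessel_op s l u)"


section \<open>Continuous embeddings\<close>

text \<open>\<open>(X, NX) \<hookrightarrow> (Y, NY)\<close>: the inclusion is a bounded map.\<close>

definition continuously_embedded ::
    "'a set \<Rightarrow> ('a \<Rightarrow> ennreal) \<Rightarrow> 'a set \<Rightarrow> ('a \<Rightarrow> ennreal) \<Rightarrow> bool" where
  "continuously_embedded X NX Y NY \<longleftrightarrow>
     X \<subseteq> Y \<and> (\<exists>C::real. C \<ge> 0 \<and> (\<forall>u\<in>X. NY u \<le> ennreal C * NX u))"

end

theory Submission
  imports Defs "HOL-Probability.Probability"
begin

text \<open>
Write \<open>A = 1 + 4 \<pi>\<^sup>2 |\<xi>|\<^sup>2\<close>, \<open>B = l + 4 \<pi>\<^sup>2 |\<xi>|\<^sup>2\<close> and \<open>\<delta> = \<epsilon> / 2\<close>. The four norms are \<open>L\<^sup>p\<close> norms of Fourier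
multiplier operators applied to \<open>u\<close>, with symbols \<open>A\<^bsup>s + \<delta>\<^esup>\<close>, \<open>B\<^bsup>s\<^esup> ln B\<close>, \<open>A\<^bsup>s\<^esup>\<close> and \<open>1\<close>. Each embedding says
that the quotient of two successive symbols,
\<open>(A/B)\<^bsup>-(s + \<delta>)\<^esup> \<sqdot> B\<^bsup>-\<delta>\<^esup> ln B\<close>,  \<open>(A/B)\<^bsup>s\<^esup> \<sqdot> 1 / ln B\<close>  and  \<open>A\<^bsup>-s\<^esup>\<close>,
is bounded on \<open>L\<^sup>p\<close>. For \<open>p = 1\<close> this amounts to the quotient being the Fourier transform of a finite
measure, a property that suffices for all \<open>p\<close> at once.

The measures come from subordination to the heat kernel. A Gaussian in \<open>\<xi>\<close> is the Fourier transform of a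
normal law, hence every mixture \<open>\<integral> \<kappa>(\<omega>) exp (- T(\<omega>) B) dM(\<omega>)\<close> with \<open>T \<ge> 0\<close> and \<open>\<integral> |\<kappa>| exp (- T l) dM\<close>
finite is the Fourier transform of a finite signed measure (\<open>laplace_mixture_Lp_multiplier\<close>), and
convolution with such a measure is bounded on \<open>L\<^sup>p\<close> by Jensen's inequality and translation invariance
(\<open>Lp_fun_norm_avg\<close>). Each factor is such a mixture:
\<^item> \<open>B\<^bsup>-a\<^esup> = (1 / \<Gamma>(a)) \<integral>\<^sub>0\<^sup>\<infinity> \<tau>\<^bsup>a - 1\<^esup> e\<^bsup>- \<tau> B\<^esup> d\<tau>\<close>;
\<^item> \<open>B\<^bsup>-a\<^esup> ln B\<close> appears when \<open>\<tau>\<^bsup>a - 1\<^esup> ln \<tau>\<close> is rescaled in that integral;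
\<^item> \<open>1 / ln B = \<integral>\<^sub>0\<^sup>\<infinity> B\<^bsup>-t\<^esup> dt\<close>, which converges because \<open>B \<ge> l > 1\<close>;
\<^item> \<open>(A/B)\<^bsup>a\<^esup> = (1 - (l - 1) / B)\<^bsup>a\<^esup>\<close> is a binomial series in powers of \<open>1 / B\<close>, absolutely convergent because
  \<open>(l - 1) / B \<le> (l - 1) / l < 1\<close>. Expanding in \<open>1 / B\<close> rather than \<open>1 / A\<close> is what makes every \<open>l > 1\<close>
  and every real exponent accessible.

Products need no new measure: by Fourier inversion the operators compose (\<open>Lp_multiplier_mult\<close>). For the
same reason, if \<open>m\<^sub>2 = m\<^sub>1 m\<close>, the second operator tested on \<open>\<phi>\<close> is the first one tested on
\<open>\<F> (m \<F>\<^sup>-\<^sup>1 \<phi>)\<close>, so the estimate is purely one about test functions and holds for an arbitrary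
functional \<open>u\<close> (\<open>Lp_multiplier_compare\<close>); the inequalities for Schwartz functions are special cases.

This rests on the Schwartz space being invariant under the Fourier transform and under multiplication by the
symbols, and on Fourier inversion in \<open>\<real>\<^sup>n\<close>.
\<close>

section \<open>Derivatives with growth conditions\<close>

abbreviation partial_deriv :: "'n::finite \<Rightarrow> (real ^ 'n \<Rightarrow> complex) \<Rightarrow> real ^ 'n \<Rightarrow> complex" where
  "partial_deriv i f \<equiv> (\<lambda>x. frechet_derivative f (at x) (axis i 1))"

lemma partial_deriv_eqI:
  assumes "\<And>x. (f has_derivative f' x) (at x)"
  shows "partial_deriv i f = (\<lambda>x. f' x (axis i 1))"
  using frechet_derivative_at[OF assms] by auto

lemma partial_deriv_add:
  assumes "\<And>x. f differentiable at x" "\<And>x. g differentiable at x"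
  shows "partial_deriv i (\<lambda>x. f x + g x) = (\<lambda>x. partial_deriv i f x + partial_deriv i g x)"
  by (subst partial_deriv_eqI[OF has_derivative_add[OF assms(1)[unfolded frechet_derivative_works]
        assms(2)[unfolded frechet_derivative_works]]]) simp

lemma partial_deriv_mult:
  assumes "\<And>x. f differentiable at x" "\<And>x. g differentiable at x"
  shows "partial_deriv i (\<lambda>x. f x * g x) = (\<lambda>x. f x * partial_deriv i g x + partial_deriv i f x * g x)"
  by (subst partial_deriv_eqI[OF has_derivative_mult[OF assms(1)[unfolded frechet_derivative_works]
        assms(2)[unfolded frechet_derivative_works]]]) simp

lemma partial_deriv_const: "partial_deriv i (\<lambda>x. c) = (\<lambda>x. 0)"
  by (subst partial_deriv_eqI[OF has_derivative_const]) simp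

lemma partials_append: "partials (is @ js) f = partials is (partials js f)"
  by (induction "is") auto

text \<open>Schwartz functions and their multipliers both satisfy one growth condition \<open>P\<close> on all derivatives.
Counting the derivatives up to an order \<open>k\<close> turns arguments with the Leibniz and chain rules into inductions
on \<open>k\<close>, even where a derivative leads to functions outside the family one started from.\<close>

definition smooth_upto ::
    "((real ^ 'n \<Rightarrow> complex) \<Rightarrow> bool) \<Rightarrow> nat \<Rightarrow> (real ^ ('n::finite) \<Rightarrow> complex) \<Rightarrow> bool" where
  "smooth_upto P k f \<longleftrightarrow>
     (\<forall>is. length is \<le> k \<longrightarrow> (\<forall>x. partials is f differentiable at x) \<and> P (partials is f))"

lemma smooth_upto_0: "smooth_upto P 0 f \<longleftrightarrow> (\<forall>x. f differentiable at x) \<and> P f"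
  by (auto simp: smooth_upto_def)

lemma smooth_upto_Suc:
  "smooth_upto P (Suc k) f \<longleftrightarrow>
     (\<forall>x. f differentiable at x) \<and> P f \<and> (\<forall>i. smooth_upto P k (partial_deriv i f))" (is "?L \<longleftrightarrow> ?R")
proof
  assume L: ?L
  \<comment> \<open>The definition differentiates from the outside, the recursion from the inside: split off the last index.\<close>
  have "(\<forall>x. partials is (partial_deriv i f) differentiable at x) \<and> P (partials is (partial_deriv i f))"
    if "length is \<le> k" for "is" i
    using L[unfolded smooth_upto_def, rule_format, of "is @ [i]"] that by (auto simp: partials_append)
  with L[unfolded smooth_upto_def, rule_format, of "[]"] show ?R
    by (auto simp: smooth_upto_def)
next
  assume R: ?R
  show ?L unfolding smooth_upto_def
  proof (intro allI impI)
    fix "is" :: "'a list" assume len: "length is \<le> Suc k"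
    show "(\<forall>x. partials is f differentiable at x) \<and> P (partials is f)"
    proof (cases "is" rule: rev_cases)
      case Nil
      then show ?thesis using R by auto
    next
      case (snoc js i)
      then show ?thesis using R len by (auto simp: partials_append smooth_upto_def)
    qed
  qed
qed

lemma smooth_upto_mono: "smooth_upto P k f \<Longrightarrow> j \<le> k \<Longrightarrow> smooth_upto P j f"
  by (auto simp: smooth_upto_def)

lemma smooth_uptoD:
  assumes "smooth_upto P k f" shows "f differentiable at x" "P f"
  using assms[unfolded smooth_upto_def, rule_format, of "[]"] by auto

lemma smooth_upto_add:
  assumes P: "\<And>f g. P f \<Longrightarrow> P g \<Longrightarrow> P (\<lambda>x. f x + g x)"
  shows "smooth_upto P k f \<Longrightarrow> smooth_upto P k g \<Longrightarrow> smooth_upto P k (\<lambda>x. f x + g x)"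
proof (induction k arbitrary: f g)
  case 0
  then show ?case using P by (auto simp: smooth_upto_0)
next
  case (Suc k)
  then show ?case using P by (simp add: smooth_upto_Suc partial_deriv_add)
qed

text \<open>Leibniz rule: \<open>R\<close> is the growth inherited by products of functions of growth \<open>P\<close> and \<open>Q\<close>. It serves for
slow times slow and for slow times rapid.\<close>

lemma smooth_upto_mult:
  assumes R: "\<And>f g. R f \<Longrightarrow> R g \<Longrightarrow> R (\<lambda>x. f x + g x)"
    and PQ: "\<And>f g. P f \<Longrightarrow> Q g \<Longrightarrow> R (\<lambda>x. f x * g x)"
  shows "smooth_upto P k f \<Longrightarrow> smooth_upto Q k g \<Longrightarrow> smooth_upto R k (\<lambda>x. f x * g x)"
proof (induction k arbitrary: f g)
  case 0
  then show ?case using PQ by (auto simp: smooth_upto_0)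
next
  case (Suc k)
  have "smooth_upto P k f" "smooth_upto Q k g"
    using Suc.prems by (auto intro: smooth_upto_mono)
  then show ?case
    using Suc.prems PQ by (simp add: smooth_upto_Suc partial_deriv_mult) (intro allI smooth_upto_add R Suc.IH; simp)
qed

definition slow :: "(real ^ ('n::finite) \<Rightarrow> complex) \<Rightarrow> bool" where
  "slow f \<longleftrightarrow> (\<exists>C N. \<forall>x. norm (f x) \<le> C * (1 + norm x) ^ N)"

definition rapid :: "(real ^ ('n::finite) \<Rightarrow> complex) \<Rightarrow> bool" where
  "rapid f \<longleftrightarrow> (\<forall>k. \<exists>C. \<forall>x. (1 + norm x) ^ k * norm (f x) \<le> C)"

lemma slowI: "(\<And>x. norm (f x) \<le> C * (1 + norm x) ^ N) \<Longrightarrow> slow f"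
  by (auto simp: slow_def)

lemma slowE:
  assumes "slow f"
  obtains C N where "C \<ge> 0" "\<And>x. norm (f x) \<le> C * (1 + norm x) ^ N"
proof -
  obtain C N where *: "\<And>x. norm (f x) \<le> C * (1 + norm x) ^ N" using assms by (auto simp: slow_def)
  have "0 \<le> C" using order_trans[OF norm_ge_zero *[of 0]] by simp
  with * show ?thesis using that by blast
qed

lemma slow_add: assumes "slow f" "slow g" shows "slow (\<lambda>x. f x + g x)"
proof -
  obtain C N where C: "C \<ge> 0" "\<And>x. norm (f x) \<le> C * (1 + norm x) ^ N" using slowE[OF assms(1)] by metis
  obtain D M where D: "D \<ge> 0" "\<And>x. norm (g x) \<le> D * (1 + norm x) ^ M" using slowE[OF assms(2)] by metis
  show ?thesis
  proof (rule slowI)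
    fix x :: "real ^ 'a"
    have "norm (f x + g x) \<le> C * (1 + norm x) ^ N + D * (1 + norm x) ^ M"
      using C(2)[of x] D(2)[of x] norm_triangle_ineq[of "f x" "g x"] by linarith
    also have "\<dots> \<le> C * (1 + norm x) ^ (N + M) + D * (1 + norm x) ^ (N + M)"
      using C D by (intro add_mono mult_left_mono power_increasing) auto
    finally show "norm (f x + g x) \<le> (C + D) * (1 + norm x) ^ (N + M)" by (simp add: algebra_simps)
  qed
qed

lemma slow_mult: assumes "slow f" "slow g" shows "slow (\<lambda>x. f x * g x)"
proof -
  obtain C N where C: "C \<ge> 0" "\<And>x. norm (f x) \<le> C * (1 + norm x) ^ N" using slowE[OF assms(1)] by metis
  obtain D M where D: "D \<ge> 0" "\<And>x. norm (g x) \<le> D * (1 + norm x) ^ M" using slowE[OF assms(2)] by metis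
  show ?thesis
  proof (rule slowI)
    fix x :: "real ^ 'a"
    have "norm (f x * g x) \<le> (C * (1 + norm x) ^ N) * (D * (1 + norm x) ^ M)"
      unfolding norm_mult using C D by (intro mult_mono) auto
    then show "norm (f x * g x) \<le> (C * D) * (1 + norm x) ^ (N + M)"
      by (simp add: power_add mult_ac)
  qed
qed

lemma rapid_add: assumes "rapid f" "rapid g" shows "rapid (\<lambda>x. f x + g x)"
  unfolding rapid_def
proof
  fix k
  obtain C where C: "\<And>x. (1 + norm x) ^ k * norm (f x) \<le> C" using assms(1) by (auto simp: rapid_def)
  obtain D where D: "\<And>x. (1 + norm x) ^ k * norm (g x) \<le> D" using assms(2) by (auto simp: rapid_def)
  have "(1 + norm x) ^ k * norm (f x + g x) \<le> C + D" for x
  proof -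
    have "(1 + norm x) ^ k * norm (f x + g x) \<le> (1 + norm x) ^ k * (norm (f x) + norm (g x))"
      by (intro mult_left_mono norm_triangle_ineq) simp
    also have "\<dots> \<le> C + D" using C[of x] D[of x] by (simp add: distrib_left)
    finally show ?thesis .
  qed
  then show "\<exists>C. \<forall>x. (1 + norm x) ^ k * norm (f x + g x) \<le> C" by blast
qed

lemma slow_rapid_mult: assumes "slow f" "rapid g" shows "rapid (\<lambda>x. f x * g x)"
  unfolding rapid_def
proof
  fix k
  obtain C N where C: "C \<ge> 0" "\<And>x. norm (f x) \<le> C * (1 + norm x) ^ N" using slowE[OF assms(1)] by metis
  obtain D where D: "\<And>x. (1 + norm x) ^ (k + N) * norm (g x) \<le> D" using assms(2) by (auto simp: rapid_def)
  have "(1 + norm x) ^ k * norm (f x * g x) \<le> C * D" for x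
  proof -
    have "(1 + norm x) ^ k * norm (f x * g x) \<le> (1 + norm x) ^ k * ((C * (1 + norm x) ^ N) * norm (g x))"
      unfolding norm_mult using C by (intro mult_left_mono mult_right_mono) auto
    also have "\<dots> = C * ((1 + norm x) ^ (k + N) * norm (g x))" by (simp add: power_add)
    also have "\<dots> \<le> C * D" using C D by (intro mult_left_mono) auto
    finally show ?thesis .
  qed
  then show "\<exists>C. \<forall>x. (1 + norm x) ^ k * norm (f x * g x) \<le> C" by blast
qed

text \<open>Weights \<open>1 + |x|\<close> behave well under products and shifts; this links them to the weights \<open>|x|\<close> of the
seminorms, using \<open>(1 + t)\<^sup>k \<le> 2\<^sup>k (1 + t\<^sup>k)\<close>.\<close>

lemma rapid_iff: "rapid f \<longleftrightarrow> (\<forall>k. bounded (range (\<lambda>x. norm x ^ k * norm (f x))))"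
proof
  assume f: "rapid f"
  show "\<forall>k. bounded (range (\<lambda>x. norm x ^ k * norm (f x)))"
  proof
    fix k
    obtain C where C: "\<And>x. (1 + norm x) ^ k * norm (f x) \<le> C" using f by (auto simp: rapid_def)
    show "bounded (range (\<lambda>x. norm x ^ k * norm (f x)))"
    proof (rule boundedI)
      fix y assume "y \<in> range (\<lambda>x. norm x ^ k * norm (f x))"
      then obtain x where y: "y = norm x ^ k * norm (f x)" by auto
      have "norm x ^ k * norm (f x) \<le> (1 + norm x) ^ k * norm (f x)"
        by (intro mult_right_mono power_mono) auto
      then show "norm y \<le> C" using C[of x] by (simp add: y)
    qed
  qed
next
  assume f: "\<forall>k. bounded (range (\<lambda>x. norm x ^ k * norm (f x)))"
  show "rapid f" unfolding rapid_def
  proof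
    fix k
    obtain C where C: "\<And>x. norm x ^ k * norm (f x) \<le> C"
      using f[rule_format, of k] by (auto simp: bounded_iff)
    obtain D where D: "\<And>x. norm (f x) \<le> D"
      using f[rule_format, of 0] by (auto simp: bounded_iff)
    have "(1 + norm x) ^ k * norm (f x) \<le> 2 ^ k * (C + D)" for x
    proof -
      have "(1 + norm x) ^ k \<le> (2 * max 1 (norm x)) ^ k" by (intro power_mono) auto
      also have "\<dots> \<le> 2 ^ k * (1 + norm x ^ k)"
        by (auto simp: power_mult_distrib max_def)
      finally have "(1 + norm x) ^ k * norm (f x) \<le> 2 ^ k * (1 + norm x ^ k) * norm (f x)"
        by (intro mult_right_mono) auto
      also have "\<dots> = 2 ^ k * (norm x ^ k * norm (f x) + norm (f x))" by (simp add: algebra_simps)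
      also have "\<dots> \<le> 2 ^ k * (C + D)" using C[of x] D[of x] by (intro mult_left_mono add_mono) auto
      finally show ?thesis .
    qed
    then show "\<exists>C. \<forall>x. (1 + norm x) ^ k * norm (f x) \<le> C" by blast
  qed
qed

lemma schwartz_iff: "f \<in> schwartz \<longleftrightarrow> (\<forall>k. smooth_upto rapid k f)"
proof
  assume "f \<in> schwartz"
  then show "\<forall>k. smooth_upto rapid k f" unfolding schwartz_def smooth_upto_def rapid_iff by blast
next
  assume *: "\<forall>k. smooth_upto rapid k f"
  show "f \<in> schwartz" unfolding schwartz_def mem_Collect_eq
  proof
    fix "is" :: "'a list"
    show "(\<forall>x. partials is f differentiable at x) \<and>
        (\<forall>k. bounded (range (\<lambda>x. norm x ^ k * norm (partials is f x))))"
      using *[rule_format, of "length is", unfolded smooth_upto_def, rule_format, of "is"]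
      by (auto simp: rapid_iff)
  qed
qed

text \<open>The multipliers of the Schwartz space.\<close>

definition slowly_increasing :: "(real ^ ('n::finite) \<Rightarrow> complex) set" where
  "slowly_increasing = {m. \<forall>k. smooth_upto slow k m}"

lemma slowly_increasing_mult_schwartz:
  "m \<in> slowly_increasing \<Longrightarrow> f \<in> schwartz \<Longrightarrow> (\<lambda>x. m x * f x) \<in> schwartz"
  unfolding schwartz_iff slowly_increasing_def mem_Collect_eq
  by (auto intro!: smooth_upto_mult[where P = slow and Q = rapid, OF rapid_add slow_rapid_mult])

lemma smooth_upto_slow_mult:
  "smooth_upto slow k f \<Longrightarrow> smooth_upto slow k g \<Longrightarrow> smooth_upto slow k (\<lambda>x. f x * g x)"
  by (rule smooth_upto_mult[where P = slow and Q = slow, OF slow_add slow_mult])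

lemma slowly_increasing_mult:
  "f \<in> slowly_increasing \<Longrightarrow> g \<in> slowly_increasing \<Longrightarrow> (\<lambda>x. f x * g x) \<in> slowly_increasing"
  unfolding slowly_increasing_def mem_Collect_eq by (simp add: smooth_upto_slow_mult)

lemma smooth_upto_const: "smooth_upto slow k (\<lambda>x. c)"
proof (induction k arbitrary: c)
  case 0
  then show ?case by (auto simp: smooth_upto_0 intro!: slowI[where N = 0])
next
  case (Suc k)
  then show ?case by (auto simp: smooth_upto_Suc partial_deriv_const intro!: slowI[where N = 0])
qed

lemma smooth_upto_coord: "smooth_upto slow k (\<lambda>x. of_real (x $ j))"
proof -
  have der: "((\<lambda>x. of_real (x $ j)) has_derivative (\<lambda>h. of_real (h $ j))) (at x)" for x :: "real ^ 'a"
    by (intro derivative_intros bounded_linear_imp_has_derivative) (simp add: bounded_linear_vec_nth)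
  have partial_deriv: "partial_deriv i (\<lambda>x. of_real (x $ j)) = (\<lambda>x. of_real (axis i 1 $ j))" for i
    by (rule partial_deriv_eqI[OF der])
  have diff: "(\<lambda>x. of_real (x $ j)) differentiable at x" for x :: "real ^ 'a"
    using der[of x] differentiableI by blast
  have slow: "slow (\<lambda>x :: real ^ 'a. of_real (x $ j))"
  proof (rule slowI)
    fix x :: "real ^ 'a"
    show "norm (of_real (x $ j) :: complex) \<le> 1 * (1 + norm x) ^ 1"
      using component_le_norm_cart[of x j] by simp
  qed
  show ?thesis
    by (cases k) (auto simp: smooth_upto_0 smooth_upto_Suc diff slow partial_deriv intro: smooth_upto_const)
qed

lemma slowly_increasing_const: "(\<lambda>x. c) \<in> slowly_increasing"
  and slowly_increasing_coord: "(\<lambda>x. of_real (x $ j)) \<in> slowly_increasing"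
  by (auto simp: slowly_increasing_def intro: smooth_upto_const smooth_upto_coord)

lemma schwartz_add: "f \<in> schwartz \<Longrightarrow> g \<in> schwartz \<Longrightarrow> (\<lambda>x. f x + g x) \<in> schwartz"
  unfolding schwartz_iff by (simp add: smooth_upto_add[where P = rapid, OF rapid_add])

lemma schwartz_cmult: "f \<in> schwartz \<Longrightarrow> (\<lambda>x. c * f x) \<in> schwartz"
  by (rule slowly_increasing_mult_schwartz[OF slowly_increasing_const])

lemma schwartz_coord_mult: "f \<in> schwartz \<Longrightarrow> (\<lambda>x. of_real (x $ j) * f x) \<in> schwartz"
  by (rule slowly_increasing_mult_schwartz[OF slowly_increasing_coord])

lemma schwartz_partial_deriv: "f \<in> schwartz \<Longrightarrow> partial_deriv i f \<in> schwartz"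
  unfolding schwartz_iff using smooth_upto_Suc by blast

lemma schwartz_differentiable: "f \<in> schwartz \<Longrightarrow> f differentiable at x"
  and schwartz_rapid: "f \<in> schwartz \<Longrightarrow> rapid f"
  unfolding schwartz_iff using smooth_uptoD by blast+

section \<open>The symbols are slowly increasing\<close>

abbreviation symbol :: "real \<Rightarrow> real ^ ('n::finite) \<Rightarrow> real" where
  "symbol b x \<equiv> b + 4 * pi\<^sup>2 * (norm x)\<^sup>2"

lemma symbol_ge: "symbol b x \<ge> b"
  by simp

lemma symbol_pos: "b > 0 \<Longrightarrow> symbol b x > 0"
  using symbol_ge[of b x] by linarith

lemma has_derivative_symbol_comp:
  assumes "(h has_real_derivative h') (at (symbol b x))"
  shows "((\<lambda>x. of_real (h (symbol b x)) :: complex) has_derivative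
           (\<lambda>v. of_real (h' * (8 * pi\<^sup>2 * (x \<bullet> v))))) (at x)"
proof -
  have "((\<lambda>x. symbol b x) has_derivative (\<lambda>v. 8 * pi\<^sup>2 * (x \<bullet> v))) (at x)"
    unfolding power2_norm_eq_inner
    by (auto intro!: derivative_eq_intros simp: inner_commute algebra_simps)
  from has_derivative_compose[OF this assms[unfolded has_field_derivative_def]]
  show ?thesis by (intro derivative_intros) (simp add: mult_ac)
qed

text \<open>A partial derivative of \<open>h(b + 4 \<pi>\<^sup>2 |x|\<^sup>2)\<close> is a coordinate times the same expression with \<open>h'\<close>, so growth
bounds up to order \<open>k\<close> for \<open>h\<close> follow from those up to order \<open>k - 1\<close> for \<open>h'\<close>.\<close>

lemma smooth_upto_symbol_comp:
  fixes h :: "real \<Rightarrow> real"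
  assumes b: "b > 0"
    and h: "\<And>t. t \<ge> b \<Longrightarrow> (h has_real_derivative h' t) (at t)"
    and slow: "slow (\<lambda>x :: real ^ 'n :: finite. of_real (h (symbol b x)))"
    and h': "\<And>j. k = Suc j \<Longrightarrow> smooth_upto slow j (\<lambda>x :: real ^ 'n. of_real (h' (symbol b x)))"
  shows "smooth_upto slow k (\<lambda>x :: real ^ 'n. of_real (h (symbol b x)))"
proof -
  note der = has_derivative_symbol_comp[OF h[OF symbol_ge]]
  have diff: "(\<lambda>x. of_real (h (symbol b x)) :: complex) differentiable at x" for x :: "real ^ 'n"
    using der differentiableI by blast
  have partial_deriv: "partial_deriv i (\<lambda>x. of_real (h (symbol b x))) =
      (\<lambda>x. of_real (h' (symbol b x)) * (of_real (8 * pi\<^sup>2) * of_real (x $ i)))" for i :: 'n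
    by (subst partial_deriv_eqI[OF der]) (simp add: inner_axis)
  show ?thesis
  proof (cases k)
    case 0
    then show ?thesis using diff slow by (simp add: smooth_upto_0)
  next
    case (Suc j)
    then show ?thesis using diff slow h'[OF Suc]
      by (auto simp: smooth_upto_Suc partial_deriv
          intro!: smooth_upto_slow_mult smooth_upto_const smooth_upto_coord simp del: of_real_mult)
  qed
qed

lemma slow_symbol: "slow (\<lambda>x :: real ^ 'n :: finite. of_real (symbol b x))"
proof (rule slowI)
  fix x :: "real ^ 'n"
  have "\<bar>symbol b x\<bar> \<le> \<bar>b\<bar> * (1 + norm x)^2 + 4 * pi\<^sup>2 * (1 + norm x)^2"
  proof -
    have "(norm x)\<^sup>2 \<le> (1 + norm x)\<^sup>2" "1 \<le> (1 + norm x)\<^sup>2" by (auto intro!: power_mono one_le_power)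
    then have "4 * pi\<^sup>2 * (norm x)\<^sup>2 \<le> 4 * pi\<^sup>2 * (1 + norm x)\<^sup>2" "\<bar>b\<bar> * 1 \<le> \<bar>b\<bar> * (1 + norm x)\<^sup>2"
      by (intro mult_left_mono; simp)+
    moreover have "0 \<le> 4 * pi\<^sup>2 * (norm x)\<^sup>2" by simp
    ultimately show ?thesis by linarith
  qed
  then show "norm (of_real (symbol b x) :: complex) \<le> (\<bar>b\<bar> + 4 * pi\<^sup>2) * (1 + norm x) ^ 2"
    unfolding norm_of_real by (simp add: algebra_simps)
qed

lemma slow_of_real_le:
  assumes "slow (\<lambda>x. of_real (g x))" "\<And>x. \<bar>f x\<bar> \<le> \<bar>g x\<bar>"
  shows "slow (\<lambda>x. of_real (f x))"
proof -
  obtain C N where "\<And>x. norm (of_real (g x) :: complex) \<le> C * (1 + norm x) ^ N" using assms(1) by (auto simp: slow_def)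
  then show ?thesis using assms(2) by (intro slowI[of _ C N]) (metis norm_of_real order_trans real_norm_def)
qed

lemma slow_const: "slow (\<lambda>x. c)"
  by (rule slowI[of _ "norm c" 0]) simp

text \<open>For an exponent \<open>a \<le> N\<close>, the power is at most \<open>b\<^bsup>a - N\<^esup>\<close> times the \<open>N\<close>-th power, a polynomial.\<close>

lemma slow_powr: assumes b: "b > 0"
  shows "slow (\<lambda>x :: real ^ 'n :: finite. of_real (symbol b x powr a))"
proof -
  obtain N :: nat where N: "a \<le> real N" using real_arch_simple by blast
  have pow: "slow (\<lambda>x :: real ^ 'n. of_real (symbol b x ^ N))"
  proof (induction N)
    case (Suc N)
    from slow_mult[OF slow_symbol Suc] show ?case by simp
  qed (simp add: slow_const)
  have pow': "slow (\<lambda>x :: real ^ 'n. of_real (b powr (a - real N)) * of_real (symbol b x ^ N))"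
    by (rule slow_mult[OF slow_const pow])
  show ?thesis
  proof (rule slow_of_real_le)
    show "slow (\<lambda>x :: real ^ 'n. of_real (b powr (a - real N) * symbol b x ^ N))" using pow' by simp
    fix x :: "real ^ 'n"
    have p: "symbol b x > 0" using b by (rule symbol_pos)
    have "symbol b x powr a = symbol b x powr (a - real N) * symbol b x ^ N"
      using powr_add[of "symbol b x" "a - real N" "real N"] powr_realpow[OF p, of N] by simp
    also have "\<dots> \<le> b powr (a - real N) * symbol b x ^ N"
      using p b N by (intro mult_right_mono powr_mono2') auto
    finally show "\<bar>symbol b x powr a\<bar> \<le> \<bar>b powr (a - real N) * symbol b x ^ N\<bar>" using p by simp
  qed
qed

lemma smooth_upto_powr:
  assumes b: "b > 0"
  shows "smooth_upto slow k (\<lambda>x :: real ^ 'n :: finite. of_real (symbol b x powr a))"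
proof (induction k arbitrary: a)
  case 0
  show ?case
    by (rule smooth_upto_symbol_comp[where h' = "\<lambda>t. a * t powr (a - 1)"])
       (use b in \<open>auto intro!: has_real_derivative_powr slow_powr\<close>)
next
  case (Suc k)
  show ?case
  proof (rule smooth_upto_symbol_comp[where h' = "\<lambda>t. a * t powr (a - 1)"])
    fix j assume "Suc k = Suc j"
    then show "smooth_upto slow j (\<lambda>x :: real ^ 'n. of_real (a * symbol b x powr (a - 1)))"
      using smooth_upto_slow_mult[OF smooth_upto_const[of k "of_real a"] Suc.IH[of "a - 1"]] by simp
  qed (use b in \<open>auto intro!: has_real_derivative_powr slow_powr\<close>)
qed

lemma slowly_increasing_powr:
  assumes "b > 0" shows "(\<lambda>x. of_real (symbol b x powr a)) \<in> slowly_increasing"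
  using smooth_upto_powr[OF assms] by (auto simp: slowly_increasing_def)

lemma slowly_increasing_ln:
  assumes b: "b > 1" shows "(\<lambda>x :: real ^ 'n :: finite. of_real (ln (symbol b x))) \<in> slowly_increasing"
proof -
  have "smooth_upto slow k (\<lambda>x :: real ^ 'n :: finite. of_real (ln (symbol b x)))" for k
  proof (rule smooth_upto_symbol_comp[where h' = "\<lambda>t. t powr (- 1)"])
    show "slow (\<lambda>x :: real ^ 'n. of_real (ln (symbol b x)))"
    proof (rule slow_of_real_le[OF slow_symbol])
      fix x :: "real ^ 'n"
      have "symbol b x > 1" using symbol_ge[of b x] b by linarith
      then show "\<bar>ln (symbol b x)\<bar> \<le> \<bar>symbol b x\<bar>" using ln_le_minus_one[of "symbol b x"] by simp
    qed
    show "(ln has_real_derivative t powr (- 1)) (at t)" if "t \<ge> b" for t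
      using that b by (auto intro!: derivative_eq_intros simp: powr_minus field_simps)
    show "smooth_upto slow j (\<lambda>x :: real ^ 'n. of_real (symbol b x powr (- 1)))" for j
      using b by (intro smooth_upto_powr) simp
  qed (use b in auto)
  then show ?thesis by (simp add: slowly_increasing_def)
qed

text \<open>The derivative of \<open>1 / ln t\<close> is \<open>- (1 / ln t)\<^sup>2 t\<^sup>-\<^sup>1\<close>, so the function itself comes back and the induction on
the order of differentiation closes through the Leibniz rule.\<close>

lemma slowly_increasing_inverse_ln:
  assumes b: "b > 1" shows "(\<lambda>x :: real ^ 'n :: finite. of_real (1 / ln (symbol b x))) \<in> slowly_increasing"
proof -
  have slow: "slow (\<lambda>x :: real ^ 'n :: finite. of_real (1 / ln (symbol b x)))"
  proof (rule slow_of_real_le[OF slow_const[of "of_real (1 / ln b)"]])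
    fix x :: "real ^ 'n"
    have "ln b > 0" "ln (symbol b x) \<ge> ln b"
      using symbol_ge[of b x] b symbol_pos[of b x] by (auto intro!: ln_mono)
    then show "\<bar>1 / ln (symbol b x)\<bar> \<le> \<bar>1 / ln b\<bar>" by (simp add: frac_le)
  qed
  have der: "((\<lambda>t. 1 / ln t) has_real_derivative (- ((1 / ln t) * (1 / ln t) * t powr (- 1)))) (at t)"
    if "t \<ge> b" for t
    using that b by (auto intro!: derivative_eq_intros simp: powr_minus field_simps)
  have "smooth_upto slow k (\<lambda>x :: real ^ 'n. of_real (1 / ln (symbol b x)))" for k
  proof (induction k)
    case 0
    show ?case by (rule smooth_upto_symbol_comp[OF _ der slow]) (use b in auto)
  next
    case (Suc k)
    have 1: "smooth_upto slow k (\<lambda>x :: real ^ 'n.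
        of_real (-1) * (of_real (1 / ln (symbol b x)) * of_real (1 / ln (symbol b x)) * of_real (symbol b x powr (- 1))))"
      using b by (intro smooth_upto_slow_mult Suc.IH smooth_upto_powr smooth_upto_const) auto
    have 2: "smooth_upto slow k (\<lambda>x :: real ^ 'n.
        of_real (- ((1 / ln (symbol b x)) * (1 / ln (symbol b x)) * symbol b x powr (- 1))))"
      using 1 by (simp only: flip: of_real_mult) simp
    show ?case by (rule smooth_upto_symbol_comp[OF _ der slow]) (use b 2 in auto)
  qed
  then show ?thesis by (simp add: slowly_increasing_def)
qed

section \<open>Integration of Schwartz functions\<close>

lemma integral_lborel_translate:
  fixes f :: "'a::euclidean_space \<Rightarrow> 'b::{banach, second_countable_topology}"
  assumes [measurable]: "f \<in> borel_measurable borel"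
  shows "(LINT x|lborel. f (a + x)) = (LINT x|lborel. f x)"
  by (subst (2) lborel_distr_plus[of a, symmetric]) (simp add: integral_distr)

lemma integrable_lborel_translate:
  fixes f :: "'a::euclidean_space \<Rightarrow> 'b::{banach, second_countable_topology}"
  assumes "integrable lborel f"
  shows "integrable lborel (\<lambda>x. f (a + x))"
  using integrable_distr[of "(+) a" lborel lborel f] assms lborel_distr_plus[of a]
  by (simp cong: distr_cong)

lemma nn_integral_lborel_translate:
  fixes f :: "'a::euclidean_space \<Rightarrow> ennreal"
  assumes [measurable]: "f \<in> borel_measurable borel"
  shows "(\<integral>\<^sup>+x. f (a + x) \<partial>lborel) = (\<integral>\<^sup>+x. f x \<partial>lborel)"
  by (subst (2) lborel_distr_plus[of a, symmetric]) (simp add: nn_integral_distr)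

lemma integral_lborel_scale:
  fixes f :: "'a::euclidean_space \<Rightarrow> 'b::{banach, second_countable_topology}"
  assumes [measurable]: "f \<in> borel_measurable borel" and c: "c > 0"
  shows "(LINT x|lborel. f (c *\<^sub>R x)) = (1 / c ^ DIM('a)) *\<^sub>R (LINT x|lborel. f x)"
proof -
  have "(LINT x|lborel. f x) = c ^ DIM('a) *\<^sub>R (LINT x|lborel. f (c *\<^sub>R x))"
    using c by (subst lborel_affine[of c 0]) (simp_all add: integral_density integral_distr)
  then show ?thesis using c by simp
qed

interpretation basis_product: product_sigma_finite "\<lambda>_. lborel :: real measure" ..

lemma
  fixes f :: "real ^ ('n::finite) \<Rightarrow> real \<Rightarrow> 'b::{real_normed_field, banach, second_countable_topology}"
  assumes int: "\<And>b. b \<in> Basis \<Longrightarrow> integrable lborel (f b)"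
  shows integrable_lborel_prod: "integrable lborel (\<lambda>x. \<Prod>b\<in>Basis. f b (x \<bullet> b))"
    and integral_lborel_prod:
      "(LINT x|lborel. (\<Prod>b\<in>Basis. f b (x \<bullet> b))) = (\<Prod>b\<in>Basis. LINT t|lborel. f b t)"
proof -
  have m: "(\<lambda>x. \<Prod>b\<in>Basis. f b (x \<bullet> b)) \<in> borel_measurable borel"
  proof (rule borel_measurable_prod)
    fix b :: "real ^ 'n" assume "b \<in> Basis"
    then have [measurable]: "f b \<in> borel_measurable borel" using int[of b] by auto
    show "(\<lambda>x. f b (x \<bullet> b)) \<in> borel_measurable borel" by measurable
  qed
  have m2: "(\<lambda>g. \<Sum>b\<in>Basis. g b *\<^sub>R b) \<in> measurable (\<Pi>\<^sub>M b\<in>Basis. lborel) (borel :: (real ^ 'n) measure)"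
    by measurable
  have eq: "(\<Prod>b\<in>Basis. f b ((\<Sum>b'\<in>Basis. g b' *\<^sub>R b') \<bullet> b)) = (\<Prod>b\<in>Basis. f b (g b))" for g
    by (intro prod.cong refl) simp
  show "integrable lborel (\<lambda>x. \<Prod>b\<in>Basis. f b (x \<bullet> b))"
    unfolding lborel_eq[where 'a = "real ^ 'n"] integrable_distr_eq[OF m2 m] eq
    using int by (intro basis_product.product_integrable_prod) auto
  show "(LINT x|lborel. (\<Prod>b\<in>Basis. f b (x \<bullet> b))) = (\<Prod>b\<in>Basis. LINT t|lborel. f b t)"
    unfolding lborel_eq[where 'a = "real ^ 'n"] integral_distr[OF m2 m] eq
    using int by (intro basis_product.product_integral_prod) auto
qed

text \<open>An integrable weight: \<open>(1 + |x|)\<^sup>2 \<ge> 1 + x\<^sub>i\<^sup>2\<close> for each of the \<open>n\<close> coordinates bounds it by a product of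
one-dimensional integrable functions.\<close>

definition decay :: "real ^ ('n::finite) \<Rightarrow> real" where
  "decay x = 1 / (1 + norm x) ^ (2 * CARD('n))"

lemma decay_nonneg: "decay x \<ge> 0"
  by (simp add: decay_def)

lemma measurable_decay [measurable]: "decay \<in> borel_measurable borel"
  unfolding decay_def by measurable

lemma integrable_decay: "integrable lborel (decay :: real ^ 'n::finite \<Rightarrow> real)"
proof -
  have "integrable lborel (\<lambda>t::real. inverse (1 + t\<^sup>2))"
    using integrable_inverse_1_plus_square by (simp add: set_integrable_def)
  then have int: "integrable lborel (\<lambda>x :: real ^ 'n. \<Prod>b\<in>Basis. inverse (1 + (x \<bullet> b)\<^sup>2))"
    by (rule integrable_lborel_prod)
  show ?thesis
  proof (rule Bochner_Integration.integrable_bound[OF int])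
    show "AE x :: real ^ 'n in lborel. norm (decay x) \<le> norm (\<Prod>b\<in>Basis. inverse (1 + (x \<bullet> b)\<^sup>2))"
    proof (rule AE_I2)
      fix x :: "real ^ 'n"
      have "(\<Prod>b\<in>(Basis :: (real ^ 'n) set). 1 + (x \<bullet> b)\<^sup>2) \<le> (\<Prod>b\<in>(Basis :: (real ^ 'n) set). (1 + norm x)\<^sup>2)"
      proof (intro prod_mono conjI)
        fix b :: "real ^ 'n" assume "b \<in> Basis"
        then have "(x \<bullet> b)\<^sup>2 \<le> (norm x)\<^sup>2" by (intro abs_le_square_iff[THEN iffD1]) (simp add: Basis_le_norm)
        then show "1 + (x \<bullet> b)\<^sup>2 \<le> (1 + norm x)\<^sup>2"
          using norm_ge_zero[of x] by (simp add: power2_eq_square algebra_simps del: norm_ge_zero)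
      qed simp
      also have "\<dots> = (1 + norm x) ^ (2 * CARD('n))" by (simp add: power_mult)
      finally have "(\<Prod>b\<in>(Basis :: (real ^ 'n) set). 1 + (x \<bullet> b)\<^sup>2) \<le> (1 + norm x) ^ (2 * CARD('n))" .
      moreover have "(\<Prod>b\<in>(Basis :: (real ^ 'n) set). 1 + (x \<bullet> b)\<^sup>2) > 0"
        by (intro prod_pos) (simp add: add_pos_nonneg)
      ultimately have "1 / (1 + norm x) ^ (2 * CARD('n)) \<le> 1 / (\<Prod>b\<in>(Basis :: (real ^ 'n) set). 1 + (x \<bullet> b)\<^sup>2)"
        by (intro divide_left_mono mult_pos_pos) auto
      also have "\<dots> = (\<Prod>b\<in>(Basis :: (real ^ 'n) set). inverse (1 + (x \<bullet> b)\<^sup>2))"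
        using prod_inversef[of "\<lambda>b. 1 + (x \<bullet> b)\<^sup>2" "Basis :: (real ^ 'n) set"] by (simp add: divide_inverse comp_def)
      finally show "norm (decay x) \<le> norm (\<Prod>b\<in>Basis. inverse (1 + (x \<bullet> b)\<^sup>2))"
        by (simp add: decay_def)
    qed
  qed simp
qed

lemma rapid_decay:
  assumes "rapid f"
  obtains C where "C \<ge> 0" "\<And>x :: real ^ 'n :: finite. norm (f x) \<le> C * decay x"
proof -
  obtain C where C: "\<And>x. (1 + norm x) ^ (2 * CARD('n)) * norm (f x) \<le> C"
    using assms unfolding rapid_def by blast
  have pos: "(1 + norm x) ^ (2 * CARD('n)) > 0" for x :: "real ^ 'n"
    by (intro zero_less_power) (simp add: add_pos_nonneg)
  have "0 \<le> C" using order_trans[OF _ C[of 0]] by simp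
  moreover have "norm (f x) \<le> C * decay x" for x
    using C[of x] pos[of x] by (simp add: decay_def field_simps)
  ultimately show thesis using that by blast
qed

lemma rapid_integrable:
  assumes "rapid f" and [measurable]: "f \<in> borel_measurable borel"
  shows "integrable lborel f"
proof -
  obtain C where C: "C \<ge> 0" "\<And>x. norm (f x) \<le> C * decay x" using rapid_decay[OF assms(1)] by metis
  have "integrable lborel (\<lambda>x :: real ^ 'a. C * decay x)" by (intro integrable_mult_right integrable_decay)
  then show ?thesis
    by (rule Bochner_Integration.integrable_bound) (auto intro!: AE_I2 order_trans[OF C(2) abs_ge_self])
qed

lemma schwartz_continuous: "f \<in> schwartz \<Longrightarrow> continuous_on UNIV f"
  by (meson schwartz_differentiable differentiable_imp_continuous_within continuous_at_imp_continuous_on)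

lemma schwartz_measurable: "f \<in> schwartz \<Longrightarrow> f \<in> borel_measurable borel"
  by (intro borel_measurable_continuous_onI schwartz_continuous)

lemma schwartz_integrable: "f \<in> schwartz \<Longrightarrow> integrable lborel f"
  by (intro rapid_integrable schwartz_rapid schwartz_measurable)

lemma schwartz_bounded:
  assumes "f \<in> schwartz" obtains C where "C \<ge> 0" "\<And>x. norm (f x) \<le> C"
proof -
  obtain C where C: "\<And>x. (1 + norm x) ^ 0 * norm (f x) \<le> C"
    using schwartz_rapid[OF assms] unfolding rapid_def by blast
  have "0 \<le> C" using order_trans[OF _ C[of 0]] by simp
  then show thesis using that C by auto
qed

section \<open>The Fourier transform on the Schwartz space\<close>

text \<open>The Fourier integral with phase \<open>c x \<bullet> \<xi>\<close>; \<open>c = - 2 \<pi>\<close> gives the Fourier transform and \<open>c = 2 \<pi>\<close> its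
inverse, so that both are treated at once.\<close>

definition osc :: "real \<Rightarrow> (real ^ ('n::finite) \<Rightarrow> complex) \<Rightarrow> real ^ 'n \<Rightarrow> complex" where
  "osc c f \<xi> = (LINT x|lborel. f x * iexp (c * (x \<bullet> \<xi>)))"

lemma fourier_eq_osc: "fourier = osc (- (2 * pi))"
  by (intro ext) (simp add: fourier_def osc_def mult_ac)

lemma inv_fourier_eq_osc: "inv_fourier = osc (2 * pi)"
  by (intro ext) (simp add: inv_fourier_def osc_def mult_ac inner_commute)

lemma norm_osc_le: "norm (osc c f \<xi>) \<le> (LINT x|lborel. norm (f x))"
proof -
  have "norm (osc c f \<xi>) \<le> (LINT x|lborel. norm (f x * iexp (c * (x \<bullet> \<xi>))))"
    unfolding osc_def by (rule integral_norm_bound)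
  then show ?thesis by (simp add: norm_mult del: of_real_mult)
qed

lemma integrable_mult_iexp:
  assumes f: "integrable M f" and [measurable]: "g \<in> borel_measurable M"
  shows "integrable M (\<lambda>x. f x * iexp (g x))"
proof (rule Bochner_Integration.integrable_bound[OF f])
  have [measurable]: "f \<in> borel_measurable M" using f by auto
  show "(\<lambda>x. f x * iexp (g x)) \<in> borel_measurable M" by measurable
qed (simp add: norm_mult)

lemma slow_inner: "slow (\<lambda>x. of_real (x \<bullet> h))"
proof (rule slowI)
  fix x
  have "\<bar>x \<bullet> h\<bar> \<le> norm x * norm h" by (rule Cauchy_Schwarz_ineq2)
  also have "\<dots> \<le> (1 + norm x) * norm h" by (intro mult_right_mono) auto
  finally show "norm (of_real (x \<bullet> h) :: complex) \<le> norm h * (1 + norm x) ^ 1" by (simp add: mult.commute)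
qed

lemma slow_norm: "slow (\<lambda>x. of_real (norm x))"
  by (rule slowI[of _ 1 1]) simp

text \<open>Differentiation under the integral sign. The error of the first order expansion of the exponential is at most
\<open>(c x \<bullet> h)\<^sup>2 / 2\<close>, and the second moment of \<open>f\<close> is finite.\<close>

lemma has_derivative_osc:
  fixes f :: "real ^ 'n::finite \<Rightarrow> complex"
  assumes f: "f \<in> schwartz"
  shows "(osc c f has_derivative
           (\<lambda>h. LINT x|lborel. f x * (\<i> * of_real (c * (x \<bullet> h))) * iexp (c * (x \<bullet> \<xi>)))) (at \<xi>)"
    (is "(_ has_derivative ?D) _")
proof -
  have [measurable]: "f \<in> borel_measurable borel" using f by (rule schwartz_measurable)
  have int_inner: "integrable lborel (\<lambda>x. f x * (\<i> * of_real (c * (x \<bullet> h))) * iexp (c * (x \<bullet> \<xi>)))" for h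
  proof (intro integrable_mult_iexp)
    have "integrable lborel (\<lambda>x. (\<i> * of_real c) * (of_real (x \<bullet> h) * f x))"
      by (intro integrable_mult_right rapid_integrable slow_rapid_mult slow_inner schwartz_rapid f) measurable
    then show "integrable lborel (\<lambda>x. f x * (\<i> * of_real (c * (x \<bullet> h))))"
      by (simp add: mult_ac)
  qed measurable
  have int2: "integrable lborel (\<lambda>x. of_real (norm x) * (of_real (norm x) * f x))"
    by (intro rapid_integrable slow_rapid_mult slow_norm schwartz_rapid f) measurable
  define K where "K = (LINT x|lborel. (norm x)\<^sup>2 * norm (f x))"
  have int2': "integrable lborel (\<lambda>x. (norm x)\<^sup>2 * norm (f x))"
    using integrable_norm[OF int2] by (simp add: norm_mult power2_eq_square mult.assoc)
  have lin: "linear ?D"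
  proof (rule linearI)
    show "?D (a + b) = ?D a + ?D b" for a b
      using int_inner[of a] int_inner[of b]
      by (subst Bochner_Integration.integral_add[symmetric]) (auto simp: inner_simps algebra_simps)
    show "?D (r *\<^sub>R b) = r *\<^sub>R ?D b" for r b
      by (subst integral_scaleR_right[symmetric]) (auto simp: scaleR_conv_of_real[where 'a = complex] mult_ac)
  qed
  show ?thesis
  proof (rule has_derivativeI_sandwich[where e = 1 and H = "\<lambda>y. norm (y - \<xi>) * (c\<^sup>2 / 2 * K)"])
    show "bounded_linear ?D" using lin by (simp add: linear_conv_bounded_linear)
    show "((\<lambda>y. norm (y - \<xi>) * (c\<^sup>2 / 2 * K)) \<longlongrightarrow> 0) (at \<xi> within UNIV)"
      by (rule tendsto_eq_intros refl | simp)+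
    fix y assume "y \<noteq> \<xi>"
    define h where "h = y - \<xi>"
    have y: "y = \<xi> + h" by (simp add: h_def)
    have int_y: "integrable lborel (\<lambda>x. f x * iexp (c * (x \<bullet> v)))" for v
      by (intro integrable_mult_iexp schwartz_integrable f) measurable
    have "osc c f y - osc c f \<xi> - ?D h =
        (LINT x|lborel. f x * iexp (c * (x \<bullet> y)) - f x * iexp (c * (x \<bullet> \<xi>))
            - f x * (\<i> * of_real (c * (x \<bullet> h))) * iexp (c * (x \<bullet> \<xi>)))"
      unfolding osc_def using int_y int_inner by (simp del: of_real_mult)
    also have "\<dots> = (LINT x|lborel. f x * iexp (c * (x \<bullet> \<xi>)) *
        (iexp (c * (x \<bullet> h)) - (\<Sum>k\<le>1. (\<i> * of_real (c * (x \<bullet> h))) ^ k / fact k)))"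
      by (intro Bochner_Integration.integral_cong refl)
         (simp add: y inner_simps algebra_simps exp_add)
    finally have eq: "osc c f y - osc c f \<xi> - ?D h = \<dots>" .
    have "norm (osc c f y - osc c f \<xi> - ?D h) \<le> (LINT x|lborel. ((norm h)\<^sup>2 * (c\<^sup>2 / 2)) * ((norm x)\<^sup>2 * norm (f x)))"
      unfolding eq
    proof (rule Bochner_Integration.integral_norm_bound_integral)
      show "integrable lborel (\<lambda>x. f x * iexp (c * (x \<bullet> \<xi>)) *
          (iexp (c * (x \<bullet> h)) - (\<Sum>k\<le>1. (\<i> * of_real (c * (x \<bullet> h))) ^ k / fact k)))"
      proof (rule Bochner_Integration.integrable_cong[THEN iffD1, rotated 2])
        show "integrable lborel (\<lambda>x. f x * iexp (c * (x \<bullet> y)) - f x * iexp (c * (x \<bullet> \<xi>))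
            - f x * (\<i> * of_real (c * (x \<bullet> h))) * iexp (c * (x \<bullet> \<xi>)))"
          using int_y int_inner by simp
      qed (simp_all add: y inner_simps algebra_simps exp_add)
      show "integrable lborel (\<lambda>x. ((norm h)\<^sup>2 * (c\<^sup>2 / 2)) * ((norm x)\<^sup>2 * norm (f x)))"
        using int2' by (rule integrable_mult_right)
      fix x :: "real ^ 'n"
      have "norm (iexp (c * (x \<bullet> h)) - (\<Sum>k\<le>1. (\<i> * of_real (c * (x \<bullet> h))) ^ k / fact k))
          \<le> \<bar>c * (x \<bullet> h)\<bar> ^ Suc 1 / fact (Suc 1)"
        by (rule iexp_approx1)
      also have "\<dots> = c\<^sup>2 / 2 * \<bar>x \<bullet> h\<bar>\<^sup>2"
        by (simp add: power_mult_distrib numeral_2_eq_2[symmetric])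
      also have "\<dots> \<le> c\<^sup>2 / 2 * (norm x * norm h)\<^sup>2"
        by (intro mult_left_mono power_mono Cauchy_Schwarz_ineq2) auto
      finally have "norm (f x) * norm (iexp (c * (x \<bullet> h)) - (\<Sum>k\<le>1. (\<i> * of_real (c * (x \<bullet> h))) ^ k / fact k))
          \<le> norm (f x) * (c\<^sup>2 / 2 * (norm x * norm h)\<^sup>2)"
        by (intro mult_left_mono) auto
      then show "norm (f x * iexp (c * (x \<bullet> \<xi>)) *
          (iexp (c * (x \<bullet> h)) - (\<Sum>k\<le>1. (\<i> * of_real (c * (x \<bullet> h))) ^ k / fact k)))
          \<le> ((norm h)\<^sup>2 * (c\<^sup>2 / 2)) * ((norm x)\<^sup>2 * norm (f x))"
        by (simp add: norm_mult power_mult_distrib mult_ac del: of_real_mult sum.atMost_Suc One_nat_def)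
    qed
    also have "\<dots> = (norm h)\<^sup>2 * (c\<^sup>2 / 2) * K" unfolding K_def by (rule integral_mult_right_zero)
    finally show "norm (osc c f y - osc c f \<xi> - ?D (y - \<xi>)) / norm (y - \<xi>) \<le> norm (y - \<xi>) * (c\<^sup>2 / 2 * K)"
      using \<open>y \<noteq> \<xi>\<close> unfolding h_def by (simp add: field_simps power2_eq_square)
  qed simp
qed

lemma osc_differentiable: "f \<in> schwartz \<Longrightarrow> osc c f differentiable at \<xi>"
  using has_derivative_osc differentiableI by blast

lemma partial_deriv_osc:
  assumes f: "f \<in> schwartz"
  shows "partial_deriv i (osc c f) = osc c (\<lambda>x. \<i> * of_real c * (of_real (x $ i) * f x))"
  by (subst partial_deriv_eqI[OF has_derivative_osc[OF f]]) (auto simp: osc_def inner_axis fun_eq_iff mult_ac)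

text \<open>The difference quotients of \<open>f\<close> have integral zero by translation invariance. By the mean value theorem they are
dominated by a multiple of \<open>decay\<close>, since shifting by at most \<open>1\<close> changes \<open>1 + |x|\<close> by at most a factor
\<open>2\<close>; hence the integral of their limit is zero as well.\<close>

lemma integral_partial_deriv_eq_0:
  fixes f :: "real ^ 'n::finite \<Rightarrow> complex"
  assumes f: "f \<in> schwartz"
  shows "(LINT x|lborel. partial_deriv i f x) = 0"
proof -
  have [measurable]: "f \<in> borel_measurable borel" "partial_deriv i f \<in> borel_measurable borel"
    using f by (auto intro!: schwartz_measurable schwartz_partial_deriv)
  define a :: "real ^ 'n" where "a = axis i 1"
  have na: "norm a = 1" by (simp add: a_def)
  define t where "t m = 1 / real (Suc m)" for m
  have t: "t m > 0" "t m \<le> 1" for m by (auto simp: t_def)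
  have t0: "t \<longlonglongrightarrow> 0" unfolding t_def by (rule LIMSEQ_Suc[OF lim_1_over_n])
  have der: "((\<lambda>s. f (x + s *\<^sub>R a)) has_vector_derivative partial_deriv i f (x + s *\<^sub>R a)) (at s)" for x s
  proof -
    have "(f has_derivative frechet_derivative f (at (x + s *\<^sub>R a))) (at (x + s *\<^sub>R a))"
      using schwartz_differentiable[OF f] by (simp add: frechet_derivative_works)
    moreover have "((\<lambda>s. x + s *\<^sub>R a) has_vector_derivative a) (at s)"
      by (auto intro!: derivative_eq_intros)
    ultimately show ?thesis
      using vector_derivative_diff_chain_within[of "\<lambda>s. x + s *\<^sub>R a" a s UNIV f]
      by (simp add: o_def a_def has_derivative_at_withinI)
  qed
  obtain C where C: "C \<ge> 0" "\<And>x. norm (partial_deriv i f x) \<le> C * decay x"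
    using rapid_decay[OF schwartz_rapid[OF schwartz_partial_deriv[OF f]]] by metis
  have shift: "decay (x + s *\<^sub>R a) \<le> 2 ^ (2 * CARD('n)) * decay x" if "\<bar>s\<bar> \<le> 1" for x s
  proof -
    have "norm x \<le> norm (x + s *\<^sub>R a) + norm (s *\<^sub>R a)"
      using norm_triangle_ineq4[of "x + s *\<^sub>R a" "s *\<^sub>R a"] by simp
    moreover have "norm (s *\<^sub>R a) \<le> 1" using that na by simp
    moreover have "1 + p \<le> 2 * (1 + q)" if "p \<le> q + r" "r \<le> 1" "0 \<le> q" for p q r :: real
      using that by (simp add: algebra_simps)
    ultimately have "1 + norm x \<le> 2 * (1 + norm (x + s *\<^sub>R a))" using norm_ge_zero by blast
    then have "(1 + norm x) ^ (2 * CARD('n)) \<le> (2 * (1 + norm (x + s *\<^sub>R a))) ^ (2 * CARD('n))"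
      by (intro power_mono) auto
    moreover have "(1 + norm x) ^ (2 * CARD('n)) > 0" "(1 + norm (x + s *\<^sub>R a)) ^ (2 * CARD('n)) > 0"
      by (intro zero_less_power; simp add: add_pos_nonneg)+
    ultimately show ?thesis unfolding decay_def power_mult_distrib
      by (simp add: field_simps)
  qed
  define u where "u m x = (1 / t m) *\<^sub>R (f (x + t m *\<^sub>R a) - f x)" for m x
  have "(\<lambda>m. LINT x|lborel. u m x) \<longlonglongrightarrow> (LINT x|lborel. partial_deriv i f x)"
  proof (rule integral_dominated_convergence)
    show "integrable lborel (\<lambda>x :: real ^ 'n. C * (2 ^ (2 * CARD('n)) * decay x))"
      by (intro integrable_mult_right integrable_decay)
    show "AE x in lborel. (\<lambda>m. u m x) \<longlonglongrightarrow> partial_deriv i f x"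
    proof (rule AE_I2)
      fix x
      have "((\<lambda>s. f (x + s *\<^sub>R a)) has_vector_derivative partial_deriv i f x) (at 0)" using der[of x 0] by simp
      then have lim: "((\<lambda>s. norm (f (x + s *\<^sub>R a) - f x - s *\<^sub>R partial_deriv i f x) / \<bar>s\<bar>) \<longlongrightarrow> 0) (at 0)"
        by (simp add: has_vector_derivative_def has_derivative_at)
      have eq: "norm (f (x + s *\<^sub>R a) - f x - s *\<^sub>R partial_deriv i f x) / \<bar>s\<bar> =
          norm ((1 / s) *\<^sub>R (f (x + s *\<^sub>R a) - f x) - partial_deriv i f x)" if "s \<noteq> 0" for s
      proof -
        have "(1 / s) *\<^sub>R (f (x + s *\<^sub>R a) - f x) - partial_deriv i f x =
            (1 / s) *\<^sub>R (f (x + s *\<^sub>R a) - f x - s *\<^sub>R partial_deriv i f x)"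
          using that by (simp add: scaleR_diff_right)
        then show ?thesis by simp
      qed
      have "((\<lambda>s. norm ((1 / s) *\<^sub>R (f (x + s *\<^sub>R a) - f x) - partial_deriv i f x)) \<longlongrightarrow> 0) (at 0)"
        by (rule Lim_transform_eventually[OF lim]) (auto simp: eventually_at_filter eq)
      then have "((\<lambda>s. (1 / s) *\<^sub>R (f (x + s *\<^sub>R a) - f x)) \<longlongrightarrow> partial_deriv i f x) (at 0)"
        by (simp add: tendsto_norm_zero_iff LIM_zero_iff)
      moreover have "filterlim t (at 0) sequentially"
        unfolding filterlim_at using t0 t(1) by (simp add: less_imp_neq[symmetric])
      ultimately show "(\<lambda>m. u m x) \<longlonglongrightarrow> partial_deriv i f x"
        unfolding u_def by (rule filterlim_compose)
    qed
    fix m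
    show "AE x in lborel. norm (u m x) \<le> C * (2 ^ (2 * CARD('n)) * decay x)"
    proof (rule AE_I2)
      fix x :: "real ^ 'n"
      let ?B = "C * (2 ^ (2 * CARD('n)) * decay x)"
      have "norm (f (x + t m *\<^sub>R a) - f (x + 0 *\<^sub>R a)) \<le> ?B * norm (t m - 0)"
      proof (rule differentiable_bound[of "{0..t m}" "\<lambda>s. f (x + s *\<^sub>R a)" "\<lambda>s h. h *\<^sub>R partial_deriv i f (x + s *\<^sub>R a)"])
        fix s assume s: "s \<in> {0..t m}"
        show "((\<lambda>s. f (x + s *\<^sub>R a)) has_derivative (\<lambda>h. h *\<^sub>R partial_deriv i f (x + s *\<^sub>R a))) (at s within {0..t m})"
          using der[of x s] by (auto simp: has_vector_derivative_def intro: has_derivative_at_withinI)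
        have "norm (partial_deriv i f (x + s *\<^sub>R a)) \<le> C * decay (x + s *\<^sub>R a)" by (rule C)
        also have "\<dots> \<le> ?B" using s t[of m] C(1) by (intro mult_left_mono shift) auto
        finally show "onorm (\<lambda>h. h *\<^sub>R partial_deriv i f (x + s *\<^sub>R a)) \<le> ?B"
          by (intro onorm_le) (simp add: mult.commute mult_left_mono)
      qed (use t[of m] in auto)
      then have "norm (f (x + t m *\<^sub>R a) - f x) / t m \<le> ?B" using t[of m] by (simp add: pos_divide_le_eq)
      then show "norm (u m x) \<le> ?B" using t[of m] by (simp add: u_def)
    qed
    show "u m \<in> borel_measurable lborel" unfolding u_def by measurable
  qed measurable
  moreover have "(LINT x|lborel. u m x) = 0" for m
  proof -
    have "integrable lborel (\<lambda>x. f (x + t m *\<^sub>R a))"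
      using integrable_lborel_translate[OF schwartz_integrable[OF f], of "t m *\<^sub>R a"] by (simp add: add.commute)
    then have "(LINT x|lborel. u m x) = (1 / t m) *\<^sub>R ((LINT x|lborel. f (x + t m *\<^sub>R a)) - (LINT x|lborel. f x))"
      unfolding u_def using schwartz_integrable[OF f] by simp
    also have "(LINT x|lborel. f (x + t m *\<^sub>R a)) = (LINT x|lborel. f x)"
      using integral_lborel_translate[of f "t m *\<^sub>R a"] by (simp add: add.commute)
    finally show ?thesis by simp
  qed
  ultimately show ?thesis by (simp add: LIMSEQ_const_iff)
qed

lemma slowly_increasing_iexp: "(\<lambda>x. iexp (c * (x \<bullet> \<xi>))) \<in> slowly_increasing"
  and partial_deriv_iexp: "partial_deriv i (\<lambda>x. iexp (c * (x \<bullet> \<xi>))) = (\<lambda>x. \<i> * of_real (c * \<xi> $ i) * iexp (c * (x \<bullet> \<xi>)))"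
proof -
  have der: "((\<lambda>x. iexp (c * (x \<bullet> \<xi>))) has_derivative
      (\<lambda>h. \<i> * of_real (c * (h \<bullet> \<xi>)) * iexp (c * (x \<bullet> \<xi>)))) (at x)" for x
  proof -
    have "((\<lambda>x. \<i> * of_real (c * (x \<bullet> \<xi>)) :: complex) has_derivative (\<lambda>h. \<i> * of_real (c * (h \<bullet> \<xi>)))) (at x)"
      by (auto intro!: derivative_eq_intros)
    from has_derivative_compose[OF this DERIV_exp[unfolded has_field_derivative_def]]
    show ?thesis by (simp add: mult_ac)
  qed
  show partial_deriv: "partial_deriv i (\<lambda>x. iexp (c * (x \<bullet> \<xi>))) = (\<lambda>x. \<i> * of_real (c * \<xi> $ i) * iexp (c * (x \<bullet> \<xi>)))" for i
    by (subst partial_deriv_eqI[OF der]) (simp add: inner_axis')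
  have diff: "(\<lambda>x. iexp (c * (x \<bullet> \<xi>))) differentiable at x" for x
    using der differentiableI by blast
  have slow: "slow (\<lambda>x. iexp (c * (x \<bullet> \<xi>)))" by (rule slowI[of _ 1 0]) simp
  have "smooth_upto slow k (\<lambda>x. iexp (c * (x \<bullet> \<xi>)))" for k
  proof (induction k)
    case (Suc k)
    then show ?case using diff slow
      by (auto simp only: smooth_upto_Suc partial_deriv intro!: smooth_upto_slow_mult smooth_upto_const)
  qed (use diff slow in \<open>auto simp: smooth_upto_0\<close>)
  then show "(\<lambda>x. iexp (c * (x \<bullet> \<xi>))) \<in> slowly_increasing" by (simp add: slowly_increasing_def)
qed

text \<open>Integration by parts, applied to the product of \<open>f\<close> with the exponential.\<close>

lemma osc_partial_deriv:
  assumes f: "f \<in> schwartz"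
  shows "osc c (partial_deriv i f) \<xi> = - \<i> * of_real (c * \<xi> $ i) * osc c f \<xi>"
proof -
  let ?e = "\<lambda>x. iexp (c * (x \<bullet> \<xi>))"
  have fe: "(\<lambda>x. ?e x * f x) \<in> schwartz"
    using slowly_increasing_iexp f by (rule slowly_increasing_mult_schwartz)
  have diff: "?e differentiable at x" for x
    by (rule smooth_uptoD(1)[where P = slow and k = 0])
       (use slowly_increasing_iexp[of c \<xi>] in \<open>simp add: slowly_increasing_def\<close>)
  have "partial_deriv i (\<lambda>x. ?e x * f x) = (\<lambda>x. ?e x * partial_deriv i f x + partial_deriv i ?e x * f x)"
    using diff schwartz_differentiable[OF f] by (rule partial_deriv_mult)
  then have partial_deriv: "partial_deriv i (\<lambda>x. ?e x * f x) = (\<lambda>x. partial_deriv i f x * ?e x + \<i> * of_real (c * \<xi> $ i) * (f x * ?e x))"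
    by (simp add: fun_cong[OF partial_deriv_iexp] mult_ac del: of_real_mult)
  have "0 = (LINT x|lborel. partial_deriv i f x * ?e x + \<i> * of_real (c * \<xi> $ i) * (f x * ?e x))"
    using integral_partial_deriv_eq_0[OF fe, of i] unfolding partial_deriv by simp
  also have "\<dots> = osc c (partial_deriv i f) \<xi> + \<i> * of_real (c * \<xi> $ i) * osc c f \<xi>"
  proof -
    have "integrable lborel (\<lambda>x. f x * ?e x)" "integrable lborel (\<lambda>x. partial_deriv i f x * ?e x)"
      by (rule integrable_mult_iexp; auto intro!: schwartz_integrable schwartz_partial_deriv f)+
    then show ?thesis unfolding osc_def by (simp del: of_real_mult)
  qed
  finally show ?thesis by (simp add: eq_neg_iff_add_eq_0)
qed

text \<open>Each factor \<open>|\<xi>|\<close> is at most the sum of the \<open>|\<xi>\<^sub>i|\<close>, and a factor \<open>\<xi>\<^sub>i\<close> is traded for a derivative of \<open>f\<close>.\<close>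

lemma rapid_osc:
  fixes f :: "real ^ 'n::finite \<Rightarrow> complex"
  assumes f: "f \<in> schwartz" and c: "c \<noteq> 0"
  shows "rapid (osc c f)"
proof -
  have "\<exists>C. \<forall>\<xi>. norm \<xi> ^ k * norm (osc c f \<xi>) \<le> C" for k
    using f
  proof (induction k arbitrary: f)
    case 0
    then show ?case using norm_osc_le by auto
  next
    case (Suc k)
    have "\<forall>i. \<exists>C. \<forall>\<xi>. norm \<xi> ^ k * norm (osc c (partial_deriv i f) \<xi>) \<le> C"
      using Suc.IH[OF schwartz_partial_deriv[OF Suc.prems]] by blast
    then obtain C where C: "\<And>i \<xi>. norm \<xi> ^ k * norm (osc c (partial_deriv i f) \<xi>) \<le> C i" by metis
    have "norm \<xi> ^ Suc k * norm (osc c f \<xi>) \<le> (\<Sum>i\<in>UNIV. C i) / \<bar>c\<bar>" for \<xi>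
    proof -
      have "norm \<xi> ^ Suc k * norm (osc c f \<xi>) \<le> norm \<xi> ^ k * ((\<Sum>i\<in>UNIV. \<bar>\<xi> $ i\<bar>) * norm (osc c f \<xi>))"
        by (simp add: mult.assoc[symmetric] mult_right_mono mult_left_mono norm_le_l1_cart)
           (simp add: mult.commute[of "norm \<xi>"] mult_right_mono mult_left_mono norm_le_l1_cart)
      also have "\<dots> = (\<Sum>i\<in>UNIV. norm \<xi> ^ k * norm (osc c (partial_deriv i f) \<xi>)) / \<bar>c\<bar>"
        using c by (simp add: osc_partial_deriv[OF Suc.prems] norm_mult abs_mult sum_distrib_left sum_distrib_right sum_divide_distrib)
      also have "\<dots> \<le> (\<Sum>i\<in>UNIV. C i) / \<bar>c\<bar>"
        using c by (intro divide_right_mono sum_mono C) auto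
      finally show ?thesis .
    qed
    then show ?case by blast
  qed
  then show ?thesis unfolding rapid_iff by (auto simp: bounded_iff)
qed

lemma osc_schwartz:
  assumes f: "f \<in> schwartz" and c: "c \<noteq> 0"
  shows "osc c f \<in> schwartz"
proof -
  have "smooth_upto rapid k (osc c f)" for k
    using f
  proof (induction k arbitrary: f)
    case 0
    then show ?case by (simp add: smooth_upto_0 osc_differentiable rapid_osc c)
  next
    case (Suc k)
    then show ?case
      by (simp add: smooth_upto_Suc osc_differentiable rapid_osc c partial_deriv_osc schwartz_cmult schwartz_coord_mult)
  qed
  then show ?thesis by (simp add: schwartz_iff)
qed

section \<open>Gaussians and Fourier inversion\<close>

definition gauss :: "real ^ 'n::finite \<Rightarrow> real" where
  "gauss x = exp (- (norm x)\<^sup>2 / 2) / sqrt (2 * pi) ^ CARD('n)"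

lemma gauss_eq_prod: "gauss (x :: real ^ 'n::finite) = (\<Prod>b\<in>Basis. std_normal_density (x \<bullet> b))"
proof -
  have "(\<Sum>b\<in>(Basis :: (real ^ 'n) set). - (x \<bullet> b)\<^sup>2 / 2) = - (norm x)\<^sup>2 / 2"
    unfolding power2_norm_eq_inner[of x] by (subst euclidean_inner[of x x])
      (simp add: sum_negf sum_divide_distrib[symmetric] power2_eq_square)
  then have "exp (- (norm x)\<^sup>2 / 2) = (\<Prod>b\<in>(Basis :: (real ^ 'n) set). exp (- (x \<bullet> b)\<^sup>2 / 2))"
    by (simp only: exp_sum[symmetric] finite_Basis)
  then show ?thesis
    by (simp add: gauss_def std_normal_density_def prod_dividef)
qed

lemma gauss_nonneg: "gauss x \<ge> 0"
  by (simp add: gauss_def)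

lemma continuous_gauss: "continuous_on UNIV gauss"
  unfolding gauss_def by (intro continuous_intros) auto

lemma measurable_gauss [measurable]: "gauss \<in> borel_measurable borel"
  by (intro borel_measurable_continuous_onI continuous_gauss)

lemma integrable_gauss: "integrable lborel (gauss :: real ^ 'n::finite \<Rightarrow> real)"
proof -
  have "integrable lborel (\<lambda>x :: real ^ 'n. \<Prod>b\<in>Basis. std_normal_density (x \<bullet> b))"
    by (rule integrable_lborel_prod) simp
  then show ?thesis by (simp add: gauss_eq_prod[abs_def])
qed

lemma integrable_std_normal_iexp:
  "integrable lborel (\<lambda>t. of_real (std_normal_density t) * iexp (v * t))"
  by (intro integrable_mult_iexp) auto

lemma integral_std_normal_iexp:
  "(LINT t|lborel. of_real (std_normal_density t) * iexp (v * t)) = of_real (exp (- v\<^sup>2 / 2))"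
proof -
  have "of_real (exp (- v\<^sup>2 / 2)) = (LINT x|std_normal_distribution. iexp (v * x))"
    using fun_cong[OF char_std_normal_distribution, of v] by (simp add: char_def)
  also have "\<dots> = (LINT t|lborel. std_normal_density t *\<^sub>R iexp (v * t))"
    by (subst integral_density) (auto simp: normal_density_nonneg)
  finally show ?thesis by (simp add: scaleR_conv_of_real)
qed

text \<open>The characteristic function of the standard normal law, as a product over the coordinates.\<close>

lemma integral_gauss_iexp:
  "(LINT x|lborel. of_real (gauss x) * iexp (v \<bullet> x)) = of_real (exp (- (norm (v :: real ^ 'n::finite))\<^sup>2 / 2))"
proof -
  have "of_real (gauss x) * iexp (v \<bullet> x) =
      (\<Prod>b\<in>Basis. of_real (std_normal_density (x \<bullet> b)) * iexp ((v \<bullet> b) * (x \<bullet> b)))" for x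
  proof -
    have "\<i> * of_real (v \<bullet> x) = (\<Sum>b\<in>(Basis :: (real ^ 'n) set). \<i> * of_real ((v \<bullet> b) * (x \<bullet> b)))"
      by (subst euclidean_inner[of v x]) (simp add: sum_distrib_left)
    then have "iexp (v \<bullet> x) = (\<Prod>b\<in>(Basis :: (real ^ 'n) set). iexp ((v \<bullet> b) * (x \<bullet> b)))"
      by (simp add: exp_sum)
    then show ?thesis by (simp add: gauss_eq_prod prod.distrib)
  qed
  then have "(LINT x|lborel. of_real (gauss x) * iexp (v \<bullet> x)) =
      (\<Prod>b\<in>(Basis :: (real ^ 'n) set). of_real (exp (- (v \<bullet> b)\<^sup>2 / 2)))"
    by (simp only: integral_std_normal_iexp integral_lborel_prod[OF integrable_std_normal_iexp])
  also have "\<dots> = of_real (exp (- (norm v)\<^sup>2 / 2))"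
  proof -
    have "(\<Sum>b\<in>(Basis :: (real ^ 'n) set). - (v \<bullet> b)\<^sup>2 / 2) = - (norm v)\<^sup>2 / 2"
      unfolding power2_norm_eq_inner[of v] by (subst euclidean_inner[of v v])
        (simp add: sum_negf sum_divide_distrib[symmetric] power2_eq_square)
    then have "exp (- (norm v)\<^sup>2 / 2) = (\<Prod>b\<in>(Basis :: (real ^ 'n) set). exp (- (v \<bullet> b)\<^sup>2 / 2))"
      by (simp only: exp_sum[symmetric] finite_Basis)
    then show ?thesis by (simp only: of_real_prod)
  qed
  finally show ?thesis .
qed

lemma integral_gauss: "(LINT x|lborel. gauss (x :: real ^ 'n::finite)) = 1"
proof -
  have "(LINT x|lborel. of_real (gauss (x :: real ^ 'n)) :: complex) = 1"
    using integral_gauss_iexp[of "0 :: real ^ 'n"] by simp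
  then show ?thesis by simp
qed

text \<open>The total mass of the Gaussian \<open>exp (- 2 \<pi>\<^sup>2 |z|\<^sup>2)\<close> equals the value of the normal density at \<open>0\<close>. These two
constants occur on the two sides of the inversion formula and cancel.\<close>

lemma integral_exp_norm_square:
  "(LINT z|lborel. exp (- (norm ((2 * pi) *\<^sub>R (z :: real ^ 'n::finite)))\<^sup>2 / 2)) = gauss (0 :: real ^ 'n)"
proof -
  have "(LINT z|lborel. exp (- (norm ((2 * pi) *\<^sub>R (z :: real ^ 'n)))\<^sup>2 / 2)) =
      (LINT z|lborel. sqrt (2 * pi) ^ CARD('n) * gauss ((2 * pi) *\<^sub>R (z :: real ^ 'n)))"
    by (simp add: gauss_def)
  also have "\<dots> = sqrt (2 * pi) ^ CARD('n) * (LINT z|lborel. gauss ((2 * pi) *\<^sub>R (z :: real ^ 'n)))"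
    by (rule integral_mult_right_zero)
  also have "(LINT z|lborel. gauss ((2 * pi) *\<^sub>R (z :: real ^ 'n))) = 1 / (2 * pi) ^ CARD('n)"
    by (subst integral_lborel_scale) (auto simp: integral_gauss)
  also have "(2 * pi) ^ CARD('n) = sqrt (2 * pi) ^ CARD('n) * sqrt (2 * pi) ^ CARD('n)"
    unfolding power_mult_distrib[symmetric] by simp
  finally show ?thesis by (simp add: gauss_def)
qed

lemma (in pair_sigma_finite) integrable_pair_mult:
  fixes f :: "'a \<Rightarrow> complex" and g :: "'b \<Rightarrow> complex"
  assumes f: "integrable M1 f" and g: "integrable M2 g"
    and k: "k \<in> borel_measurable (M1 \<Otimes>\<^sub>M M2)" "\<And>x y. norm (k (x, y)) \<le> 1"
  shows "integrable (M1 \<Otimes>\<^sub>M M2) (\<lambda>(x, y). f x * g y * k (x, y))"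
proof -
  have [measurable]: "f \<in> borel_measurable M1" "g \<in> borel_measurable M2" using f g by auto
  have *: "integrable (M1 \<Otimes>\<^sub>M M2) (\<lambda>p. f (fst p) * g (snd p))"
  proof (rule Fubini_integrable)
    show "integrable M1 (\<lambda>x. LINT y|M2. norm (f (fst (x, y)) * g (snd (x, y))))"
      using f by (simp add: norm_mult integrable_norm)
    show "AE x in M1. integrable M2 (\<lambda>y. f (fst (x, y)) * g (snd (x, y)))"
      using g by simp
  qed measurable
  show ?thesis unfolding split_beta
  proof (rule Bochner_Integration.integrable_bound[OF *])
    show "(\<lambda>p. f (fst p) * g (snd p) * k (fst p, snd p)) \<in> borel_measurable (M1 \<Otimes>\<^sub>M M2)"
      using k(1) by simp
    have "norm (f x * g y * k (x, y)) \<le> norm (f x * g y)" for x y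
      using mult_left_mono[OF k(2)[of x y], of "norm (f x * g y)"] by (simp add: norm_mult)
    then have "norm (f (fst p) * g (snd p) * k (fst p, snd p)) \<le> norm (f (fst p) * g (snd p))" for p
      by blast
    then show "AE p in M1 \<Otimes>\<^sub>M M2. norm (f (fst p) * g (snd p) * k (fst p, snd p)) \<le> norm (f (fst p) * g (snd p))"
      by (intro AE_I2)
  qed
qed

lemma osc_translate_scale:
  fixes f :: "real ^ 'n::finite \<Rightarrow> complex"
  assumes [measurable]: "f \<in> borel_measurable borel" and t: "t > 0"
  shows "(LINT z|lborel. f (x + t *\<^sub>R z) * iexp (c * (z \<bullet> \<zeta>))) =
     (1 / t ^ CARD('n)) *\<^sub>R (osc c f ((1 / t) *\<^sub>R \<zeta>) * iexp (- c * (x \<bullet> ((1 / t) *\<^sub>R \<zeta>))))"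
proof -
  let ?v = "(1 / t) *\<^sub>R \<zeta>"
  define G where "G y = f (x + y) * iexp (c * (y \<bullet> ?v))" for y
  have [measurable]: "G \<in> borel_measurable borel" unfolding G_def by measurable
  have "(LINT z|lborel. f (x + t *\<^sub>R z) * iexp (c * (z \<bullet> \<zeta>))) = (LINT z|lborel. G (t *\<^sub>R z))"
    unfolding G_def using t by (intro Bochner_Integration.integral_cong refl) simp
  also have "\<dots> = (1 / t ^ CARD('n)) *\<^sub>R (LINT y|lborel. G y)"
    using t by (subst integral_lborel_scale) auto
  also have "(LINT y|lborel. G y) = (LINT y|lborel. G (- x + y))"
    by (rule integral_lborel_translate[symmetric]) measurable
  also have "\<dots> = (LINT y|lborel. f y * iexp (c * (y \<bullet> ?v)) * iexp (- c * (x \<bullet> ?v)))"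
    unfolding G_def
    by (intro Bochner_Integration.integral_cong refl)
       (simp add: exp_add[symmetric] inner_simps algebra_simps del: inner_scaleR_right)
  also have "\<dots> = osc c f ?v * iexp (- c * (x \<bullet> ?v))"
    unfolding osc_def by (rule integral_mult_left_zero)
  finally show ?thesis .
qed

text \<open>A Gaussian cut-off at scale \<open>1 / t\<close> in frequency is a Gaussian average at scale \<open>t\<close> in space: write the
Gaussian on the right as a Fourier integral, exchange the integrals, and rescale by \<open>t\<close>.\<close>

lemma osc_gauss_cutoff:
  fixes f :: "real ^ 'n::finite \<Rightarrow> complex"
  assumes f: "f \<in> schwartz" and c: "\<bar>c\<bar> = 2 * pi" and t: "t > 0"
  shows "(LINT \<xi>|lborel. of_real (gauss (t *\<^sub>R \<xi>)) * (osc c f \<xi> * iexp (- c * (x \<bullet> \<xi>)))) =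
     (LINT z|lborel. f (x + t *\<^sub>R z) * of_real (exp (- (norm ((2 * pi) *\<^sub>R z))\<^sup>2 / 2)))"
proof -
  have [measurable]: "f \<in> borel_measurable borel" "osc c f \<in> borel_measurable borel"
    using f c by (auto intro!: schwartz_measurable osc_schwartz)
  define H where "H \<xi> = of_real (gauss (t *\<^sub>R \<xi>)) * (osc c f \<xi> * iexp (- c * (x \<bullet> \<xi>)))" for \<xi>
  have [measurable]: "H \<in> borel_measurable borel" unfolding H_def by measurable
  have fint: "integrable lborel (\<lambda>z. f (x + t *\<^sub>R z))"
  proof -
    have "integrable lborel (\<lambda>z. f (x + z))" using f by (intro integrable_lborel_translate schwartz_integrable)
    then have "integrable lborel (\<lambda>z. t ^ CARD('n) *\<^sub>R f (x + t *\<^sub>R z))"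
      using t by (subst (asm) lborel_affine[of t 0]) (auto simp: integrable_density integrable_distr_eq)
    from integrable_scaleR_right[OF this, of "1 / t ^ CARD('n)"] show ?thesis using t by simp
  qed
  have gint: "integrable lborel (\<lambda>\<zeta> :: real ^ 'n. of_real (gauss \<zeta>) :: complex)"
    by (intro integrable_of_real integrable_gauss)
  have "(LINT z|lborel. f (x + t *\<^sub>R z) * of_real (exp (- (norm ((2 * pi) *\<^sub>R z))\<^sup>2 / 2))) =
      (LINT z|lborel. LINT \<zeta>|lborel. f (x + t *\<^sub>R z) * of_real (gauss \<zeta>) * iexp (c * (z \<bullet> \<zeta>)))"
  proof (intro Bochner_Integration.integral_cong refl)
    fix z :: "real ^ 'n"
    have "(norm ((2 * pi) *\<^sub>R z))\<^sup>2 = (norm (c *\<^sub>R z))\<^sup>2" using c by simp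
    then have "complex_of_real (exp (- (norm ((2 * pi) *\<^sub>R z))\<^sup>2 / 2)) =
        (LINT \<zeta>|lborel. of_real (gauss \<zeta>) * iexp (c * (z \<bullet> \<zeta>)))"
      using integral_gauss_iexp[of "c *\<^sub>R z"] by simp
    then show "f (x + t *\<^sub>R z) * of_real (exp (- (norm ((2 * pi) *\<^sub>R z))\<^sup>2 / 2)) =
        (LINT \<zeta>|lborel. f (x + t *\<^sub>R z) * of_real (gauss \<zeta>) * iexp (c * (z \<bullet> \<zeta>)))"
      by (simp only: mult.assoc integral_mult_right_zero)
  qed
  also have "\<dots> = (LINT \<zeta>|lborel. LINT z|lborel. f (x + t *\<^sub>R z) * of_real (gauss \<zeta>) * iexp (c * (z \<bullet> \<zeta>)))"
  proof (rule lborel_pair.Fubini_integral[symmetric])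
    show "integrable (lborel \<Otimes>\<^sub>M lborel) (\<lambda>(z, \<zeta>). f (x + t *\<^sub>R z) * of_real (gauss \<zeta>) * iexp (c * (z \<bullet> \<zeta>)))"
      using lborel_pair.integrable_pair_mult[OF fint gint, of "\<lambda>p. iexp (c * (fst p \<bullet> snd p))"]
      by simp
  qed
  also have "\<dots> = (LINT \<zeta>|lborel. (1 / t ^ CARD('n)) *\<^sub>R H ((1 / t) *\<^sub>R \<zeta>))"
  proof (intro Bochner_Integration.integral_cong refl)
    fix \<zeta> :: "real ^ 'n"
    have "(LINT z|lborel. f (x + t *\<^sub>R z) * of_real (gauss \<zeta>) * iexp (c * (z \<bullet> \<zeta>))) =
        of_real (gauss \<zeta>) * (LINT z|lborel. f (x + t *\<^sub>R z) * iexp (c * (z \<bullet> \<zeta>)))"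
      by (subst integral_mult_right_zero[symmetric]) (simp add: mult_ac)
    also have "\<dots> = (1 / t ^ CARD('n)) *\<^sub>R H ((1 / t) *\<^sub>R \<zeta>)"
      using t by (subst osc_translate_scale) (simp_all add: H_def)
    finally show "(LINT z|lborel. f (x + t *\<^sub>R z) * of_real (gauss \<zeta>) * iexp (c * (z \<bullet> \<zeta>))) =
        (1 / t ^ CARD('n)) *\<^sub>R H ((1 / t) *\<^sub>R \<zeta>)" .
  qed
  also have "\<dots> = (LINT \<xi>|lborel. H \<xi>)"
    using t by (simp add: integral_lborel_scale power_one_over)
  finally show ?thesis by (simp add: H_def)
qed

text \<open>Let \<open>t \<rightarrow> 0\<close> in the previous lemma. The frequency side tends to \<open>gauss 0\<close> times the double transform, the space
side to \<open>f x\<close> times the mass of the Gaussian, both by dominated convergence.\<close>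

theorem osc_inversion:
  fixes f :: "real ^ 'n::finite \<Rightarrow> complex"
  assumes f: "f \<in> schwartz" and c: "\<bar>c\<bar> = 2 * pi"
  shows "osc (- c) (osc c f) = f"
proof
  fix x
  have h: "osc c f \<in> schwartz" using f c by (intro osc_schwartz) auto
  have [measurable]: "f \<in> borel_measurable borel" "osc c f \<in> borel_measurable borel"
    using f h by (auto intro!: schwartz_measurable)
  \<comment> \<open>A sequence of scales tending to \<open>0\<close>, as dominated convergence is about sequences.\<close>
  define t where "t m = 1 / real (Suc m)" for m
  have t: "t m > 0" for m by (simp add: t_def)
  have t0: "t \<longlonglongrightarrow> 0" unfolding t_def by (rule LIMSEQ_Suc[OF lim_1_over_n])
  define L where "L m = (LINT \<xi>|lborel. of_real (gauss (t m *\<^sub>R \<xi>)) * (osc c f \<xi> * iexp (- c * (x \<bullet> \<xi>))))" for m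
  have gauss_cont: "(\<lambda>m. gauss (t m *\<^sub>R \<xi>)) \<longlonglongrightarrow> gauss (0 :: real ^ 'n)" for \<xi> :: "real ^ 'n"
  proof -
    have "(\<lambda>m. t m *\<^sub>R \<xi>) \<longlonglongrightarrow> 0" using tendsto_scaleR[OF t0 tendsto_const[of \<xi>]] by simp
    then show ?thesis
      by (rule continuous_on_tendsto_compose[OF continuous_gauss]) auto
  qed
  have gauss_le: "gauss v \<le> gauss (0 :: real ^ 'n)" for v :: "real ^ 'n"
    by (simp add: gauss_def divide_right_mono)
  have "L \<longlonglongrightarrow> (LINT \<xi>|lborel. of_real (gauss (0 :: real ^ 'n)) * (osc c f \<xi> * iexp (- c * (x \<bullet> \<xi>))))"
    unfolding L_def
  proof (rule integral_dominated_convergence)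
    show "integrable lborel (\<lambda>\<xi>. gauss (0 :: real ^ 'n) * norm (osc c f \<xi>))"
      using schwartz_integrable[OF h] by (intro integrable_mult_right integrable_norm)
    show "AE \<xi> in lborel. (\<lambda>m. of_real (gauss (t m *\<^sub>R \<xi>)) * (osc c f \<xi> * iexp (- c * (x \<bullet> \<xi>))))
        \<longlonglongrightarrow> of_real (gauss (0 :: real ^ 'n)) * (osc c f \<xi> * iexp (- c * (x \<bullet> \<xi>)))"
      by (intro AE_I2 tendsto_mult tendsto_of_real gauss_cont tendsto_const)
    show "AE \<xi> in lborel. norm (of_real (gauss (t m *\<^sub>R \<xi>)) * (osc c f \<xi> * iexp (- c * (x \<bullet> \<xi>))))
        \<le> gauss (0 :: real ^ 'n) * norm (osc c f \<xi>)" for m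
      by (intro AE_I2) (simp add: norm_mult gauss_nonneg mult_right_mono gauss_le del: of_real_mult)
  qed measurable
  also have "(LINT \<xi>|lborel. of_real (gauss (0 :: real ^ 'n)) * (osc c f \<xi> * iexp (- c * (x \<bullet> \<xi>)))) =
      of_real (gauss (0 :: real ^ 'n)) * osc (- c) (osc c f) x"
    by (simp only: integral_mult_right_zero osc_def[of "- c"] inner_commute[of x])
  finally have lim1: "L \<longlonglongrightarrow> of_real (gauss (0 :: real ^ 'n)) * osc (- c) (osc c f) x" .
  let ?e = "\<lambda>z :: real ^ 'n. exp (- (norm ((2 * pi) *\<^sub>R z))\<^sup>2 / 2)"
  obtain C where C: "C \<ge> 0" "\<And>x. norm (f x) \<le> C" using schwartz_bounded[OF f] by blast
  have e_int: "integrable lborel ?e"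
    using integral_exp_norm_square[where 'n = 'n] not_integrable_integral_eq[of lborel ?e]
    by (auto simp: gauss_def)
  have "(\<lambda>m. LINT z|lborel. f (x + t m *\<^sub>R z) * of_real (?e z)) \<longlonglongrightarrow> (LINT z|lborel. f x * of_real (?e z))"
  proof (rule integral_dominated_convergence)
    show "integrable lborel (\<lambda>z. C * ?e z)" using e_int by (rule integrable_mult_right)
    show "AE z in lborel. (\<lambda>m. f (x + t m *\<^sub>R z) * of_real (?e z)) \<longlonglongrightarrow> f x * of_real (?e z)"
    proof (intro AE_I2 tendsto_mult tendsto_const)
      fix z
      have "(\<lambda>m. x + t m *\<^sub>R z) \<longlonglongrightarrow> x"
        using tendsto_add[OF tendsto_const[of x] tendsto_scaleR[OF t0 tendsto_const[of z]]] by simp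
      then show "(\<lambda>m. f (x + t m *\<^sub>R z)) \<longlonglongrightarrow> f x"
        by (rule continuous_on_tendsto_compose[OF schwartz_continuous[OF f]]) auto
    qed
    show "AE z in lborel. norm (f (x + t m *\<^sub>R z) * of_real (?e z)) \<le> C * ?e z" for m
      using C by (intro AE_I2) (simp add: norm_mult mult_right_mono)
  qed measurable
  also have "(LINT z|lborel. f x * of_real (?e z)) = f x * of_real (gauss (0 :: real ^ 'n))"
    by (simp only: integral_mult_right_zero integral_complex_of_real integral_exp_norm_square)
  also have "(\<lambda>m. LINT z|lborel. f (x + t m *\<^sub>R z) * of_real (?e z)) = L"
    unfolding L_def using osc_gauss_cutoff[OF f c t] by simp
  finally have "L \<longlonglongrightarrow> f x * of_real (gauss (0 :: real ^ 'n))" .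
  with lim1 have "of_real (gauss (0 :: real ^ 'n)) * osc (- c) (osc c f) x = f x * of_real (gauss (0 :: real ^ 'n))"
    by (rule LIMSEQ_unique)
  then show "osc (- c) (osc c f) x = f x" by (simp add: gauss_def)
qed

lemma fourier_schwartz: "f \<in> schwartz \<Longrightarrow> fourier f \<in> schwartz"
  and inv_fourier_schwartz: "f \<in> schwartz \<Longrightarrow> inv_fourier f \<in> schwartz"
  and inv_fourier_fourier: "f \<in> schwartz \<Longrightarrow> inv_fourier (fourier f) = f"
  and fourier_inv_fourier: "f \<in> schwartz \<Longrightarrow> fourier (inv_fourier f) = f"
  using osc_inversion[of f "- (2 * pi)"] osc_inversion[of f "2 * pi"]
  by (simp_all add: fourier_eq_osc inv_fourier_eq_osc osc_schwartz)

section \<open>Lebesgue spaces as distributions\<close>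

lemma Lp_finite_exponent:
  assumes "1 \<le> p" "p \<noteq> (\<infinity> :: ennreal)" shows "enn2real p \<ge> 1"
  using enn2real_mono[of 1 p] assms by (simp add: top.not_eq_extremum)

lemma Lp_fun_finite:
  assumes "p \<noteq> \<infinity>" "f \<in> Lp_fun p"
  shows "(\<integral>\<^sup>+x. ennreal (norm (f x) powr enn2real p) \<partial>lborel) < \<infinity>"
  using assms by (auto simp: Lp_fun_def Lp_fun_norm_def Let_def less_top split: if_splits)

lemma Lp_fun_measurable: "f \<in> Lp_fun p \<Longrightarrow> f \<in> borel_measurable borel"
  by (simp add: Lp_fun_def)

lemma Lp_fun_norm_le:
  assumes p: "1 \<le> p" "p \<noteq> \<infinity>" and c: "c \<ge> 0" and f: "f \<in> Lp_fun p"
    and le: "(\<integral>\<^sup>+x. ennreal (norm (g x) powr enn2real p) \<partial>lborel) \<le>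
      ennreal (c powr enn2real p) * (\<integral>\<^sup>+x. ennreal (norm (f x) powr enn2real p) \<partial>lborel)"
  shows "Lp_fun_norm p g \<le> ennreal c * Lp_fun_norm p f"
proof -
  let ?q = "enn2real p"
  define I J where "I = (\<integral>\<^sup>+x. ennreal (norm (f x) powr ?q) \<partial>lborel)"
    and "J = (\<integral>\<^sup>+x. ennreal (norm (g x) powr ?q) \<partial>lborel)"
  have q: "?q \<ge> 1" using p by (rule Lp_finite_exponent)
  have I: "I < \<infinity>" unfolding I_def using p(2) f by (rule Lp_fun_finite)
  have le: "J \<le> ennreal (c powr ?q) * I" using le by (simp add: I_def J_def)
  also have "\<dots> < \<infinity>" using I by (simp add: ennreal_mult_less_top)
  finally have J: "J < \<infinity>" .
  have "enn2real J \<le> enn2real (ennreal (c powr ?q) * I)"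
    using le I by (intro enn2real_mono) (auto simp: ennreal_mult_less_top)
  also have "\<dots> = c powr ?q * enn2real I" by (simp add: enn2real_mult)
  finally have "enn2real J powr (1 / ?q) \<le> (c powr ?q * enn2real I) powr (1 / ?q)"
    using q by (intro powr_mono2) auto
  also have "\<dots> = c * enn2real I powr (1 / ?q)"
    using q c by (simp add: powr_mult powr_powr)
  finally have "ennreal (enn2real J powr (1 / ?q)) \<le> ennreal c * ennreal (enn2real I powr (1 / ?q))"
    using c by (simp add: ennreal_mult[symmetric] ennreal_leI)
  moreover have "I \<noteq> \<infinity>" "J \<noteq> \<infinity>" using I J by auto
  ultimately show ?thesis using p(2)
    by (simp add: Lp_fun_norm_def I_def[symmetric] J_def[symmetric] Let_def)
qed

text \<open>For finite \<open>p\<close> this is \<open>|f| \<le> 1 + |f|\<^sup>p\<close>, for \<open>p = \<infinity>\<close> the essential bound. All absolute convergence against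
Schwartz functions is derived from it, without distinguishing the exponents.\<close>

lemma Lp_fun_split:
  assumes p: "1 \<le> p" and f: "f \<in> Lp_fun p"
  obtains a F where "a \<ge> 0" "integrable lborel F" "\<And>x. F x \<ge> 0" "AE x in lborel. norm (f x) \<le> a + F x"
proof (cases "p = \<infinity>")
  case True
  have fin: "esssup lborel (\<lambda>x. ennreal (norm (f x))) < \<infinity>"
    using f True by (simp add: Lp_fun_def Lp_fun_norm_def)
  have "AE x in lborel. norm (f x) \<le> enn2real (esssup lborel (\<lambda>x. ennreal (norm (f x)))) + 0"
    using esssup_AE[where M = lborel and f = "\<lambda>x. ennreal (norm (f x))"]
  proof eventually_elim
    case (elim x)
    from enn2real_mono[OF elim fin[unfolded infinity_ennreal_def]] show ?case by simp
  qed
  then show thesis by (intro that[of _ "\<lambda>_. 0"]) auto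
next
  case False
  let ?q = "enn2real p"
  have q: "?q \<ge> 1" using p False by (rule Lp_finite_exponent)
  have [measurable]: "f \<in> borel_measurable borel" using f by (rule Lp_fun_measurable)
  have "integrable lborel (\<lambda>x. norm (f x) powr ?q)"
    using Lp_fun_finite[OF False f] by (intro integrableI_bounded) auto
  moreover have "norm (f x) \<le> 1 + norm (f x) powr ?q" for x
  proof (cases "norm (f x) \<le> 1")
    case False
    then have "norm (f x) powr 1 \<le> norm (f x) powr ?q" using q by (intro powr_mono) auto
    then show ?thesis using False by simp
  qed (simp add: add_increasing2)
  ultimately show thesis by (intro that[of 1 "\<lambda>x. norm (f x) powr ?q"]) auto
qed

lemma integrable_mult_bounded_integrable:
  fixes f \<phi> :: "real ^ 'n::finite \<Rightarrow> complex"
  assumes [measurable]: "f \<in> borel_measurable borel" and a: "a \<ge> 0"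
    and F: "integrable lborel F" "\<And>x. F x \<ge> 0" and AE: "AE x in lborel. norm (f x) \<le> a + F x"
    and \<phi>: "integrable lborel \<phi>" and C: "\<And>x. norm (\<phi> x) \<le> C"
  shows "integrable lborel (\<lambda>x. f x * \<phi> x)"
    and "(LINT x|lborel. norm (f x * \<phi> x)) \<le> a * (LINT x|lborel. norm (\<phi> x)) + C * (LINT x|lborel. F x)"
proof -
  have [measurable]: "\<phi> \<in> borel_measurable borel" using \<phi> by auto
  have int: "integrable lborel (\<lambda>x. a * norm (\<phi> x) + C * F x)"
    using F \<phi> by (intro Bochner_Integration.integrable_add integrable_mult_right integrable_norm)
  have le: "AE x in lborel. norm (f x * \<phi> x) \<le> a * norm (\<phi> x) + C * F x"
    using AE
  proof eventually_elim
    case (elim x)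
    have "norm (f x * \<phi> x) \<le> (a + F x) * norm (\<phi> x)"
      unfolding norm_mult using elim by (intro mult_right_mono) auto
    also have "\<dots> \<le> a * norm (\<phi> x) + C * F x"
      using mult_left_mono[OF C[of x] F(2)[of x]] by (simp add: algebra_simps)
    finally show ?case .
  qed
  show 1: "integrable lborel (\<lambda>x. f x * \<phi> x)"
  proof (rule Bochner_Integration.integrable_bound[OF int])
    show "AE x in lborel. norm (f x * \<phi> x) \<le> norm (a * norm (\<phi> x) + C * F x)"
      using le by eventually_elim simp
  qed measurable
  have "(LINT x|lborel. norm (f x * \<phi> x)) \<le> (LINT x|lborel. a * norm (\<phi> x) + C * F x)"
    using 1 int le by (intro integral_mono_AE integrable_norm)
  also have "\<dots> = a * (LINT x|lborel. norm (\<phi> x)) + C * (LINT x|lborel. F x)"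
    using F \<phi> by (simp add: integrable_norm)
  finally show "(LINT x|lborel. norm (f x * \<phi> x)) \<le> \<dots>" .
qed

lemma Lp_fun_integrable_mult:
  assumes "1 \<le> p" "f \<in> Lp_fun p" "integrable lborel \<phi>" "\<And>x. norm (\<phi> x) \<le> C"
  shows "integrable lborel (\<lambda>x. f x * \<phi> x)"
proof -
  obtain a F where "a \<ge> 0" "integrable lborel F" "\<And>x. F x \<ge> 0" "AE x in lborel. norm (f x) \<le> a + F x"
    using Lp_fun_split[OF assms(1,2)] by metis
  from integrable_mult_bounded_integrable(1)[OF Lp_fun_measurable[OF assms(2)] this assms(3,4)]
  show ?thesis .
qed

lemma schwartz_seminorm_bound:
  assumes "f \<in> schwartz"
  shows "norm x ^ k * norm (partials is f x) \<le> schwartz_seminorm k is f"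
  unfolding schwartz_seminorm_def
proof (rule cSUP_upper)
  show "bdd_above (range (\<lambda>x. norm x ^ k * norm (partials is f x)))"
    using assms unfolding schwartz_def by (auto intro: bounded_imp_bdd_above)
qed simp

lemma schwartz_seminorm_nonneg: "f \<in> schwartz \<Longrightarrow> 0 \<le> schwartz_seminorm k is f"
  using order_trans[OF _ schwartz_seminorm_bound[of f 0 k "is"]] by simp

text \<open>With \<open>|f| \<le> a + F\<close>, the pairing with \<open>\<phi>\<close> is at most \<open>a\<close> times the \<open>L\<^sup>1\<close> norm of \<open>\<phi>\<close> plus the integral of \<open>F\<close> times
the supremum of \<open>\<phi>\<close>. Both norms of \<open>\<phi>\<close> are controlled by the seminorms with \<open>k = 0\<close> and \<open>k = 2 n\<close>.\<close>

lemma Lp_fun_tempered: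
  fixes f :: "real ^ 'n::finite \<Rightarrow> complex"
  assumes p: "1 \<le> p" and f: "f \<in> Lp_fun p"
  shows "distr_of f \<in> tempered"
proof -
  obtain a F where aF: "a \<ge> 0" "integrable lborel F" "\<And>x. F x \<ge> 0" "AE x in lborel. norm (f x) \<le> a + F x"
    using Lp_fun_split[OF p f] by metis
  have int: "integrable lborel (\<lambda>x. f x * \<phi> x)" if \<phi>: "\<phi> \<in> schwartz" for \<phi>
    using schwartz_bounded[OF \<phi>] Lp_fun_integrable_mult[OF p f schwartz_integrable[OF \<phi>]] by metis
  let ?n = "2 * CARD('n)"
  define W where "W = (LINT x|lborel. decay (x :: real ^ 'n))"
  define K where "K = (LINT x|lborel. F x)"
  have W: "W \<ge> 0" unfolding W_def by (simp add: decay_nonneg)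
  have K: "K \<ge> 0" unfolding K_def by (simp add: aF)
  define S where "S \<phi> = (\<Sum>k\<le>?n. \<Sum>is | length is \<le> ?n. schwartz_seminorm k is \<phi>)"
    for \<phi> :: "real ^ 'n \<Rightarrow> complex"
  have fin: "finite {is :: 'n list. length is \<le> ?n}"
    using finite_lists_length_le[of "UNIV :: 'n set" ?n] by simp
  have S: "schwartz_seminorm k [] \<phi> \<le> S \<phi>" if "\<phi> \<in> schwartz" "k \<le> ?n" for \<phi> :: "real ^ 'n \<Rightarrow> complex" and k
  proof -
    have "schwartz_seminorm k [] \<phi> \<le> (\<Sum>is | length is \<le> ?n. schwartz_seminorm k is \<phi>)"
      using that fin by (intro member_le_sum) (auto intro: schwartz_seminorm_nonneg)
    also have "\<dots> \<le> S \<phi>"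
      unfolding S_def using that
      by (intro member_le_sum[where f = "\<lambda>k. \<Sum>is | length is \<le> ?n. schwartz_seminorm k is \<phi>"])
         (auto intro!: sum_nonneg schwartz_seminorm_nonneg)
    finally show ?thesis .
  qed
  have bound: "norm (LINT x|lborel. f x * \<phi> x) \<le> (a * (2 ^ ?n * 2 * W) + K) * S \<phi>"
    if \<phi>: "\<phi> \<in> schwartz" for \<phi> :: "real ^ 'n \<Rightarrow> complex"
  proof -
    have b: "norm (\<phi> x) \<le> S \<phi>" for x
      using schwartz_seminorm_bound[OF \<phi>, of x 0 "[]"] S[OF \<phi>, of 0] by simp
    have b2: "norm x ^ ?n * norm (\<phi> x) \<le> S \<phi>" for x
      using schwartz_seminorm_bound[OF \<phi>, of x ?n "[]"] S[OF \<phi>, of ?n] by simp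
    have b3: "norm (\<phi> x) \<le> (2 ^ ?n * 2 * S \<phi>) * decay x" for x
    proof -
      have "(1 + norm x) ^ ?n \<le> (2 * max 1 (norm x)) ^ ?n" by (intro power_mono) auto
      also have "\<dots> \<le> 2 ^ ?n * (1 + norm x ^ ?n)"
        by (auto simp: power_mult_distrib max_def)
      finally have "(1 + norm x) ^ ?n * norm (\<phi> x) \<le> 2 ^ ?n * (1 + norm x ^ ?n) * norm (\<phi> x)"
        by (intro mult_right_mono) auto
      also have "\<dots> = 2 ^ ?n * (norm (\<phi> x) + norm x ^ ?n * norm (\<phi> x))" by (simp add: algebra_simps)
      also have "\<dots> \<le> 2 ^ ?n * (S \<phi> + S \<phi>)" by (intro mult_left_mono add_mono b b2) auto
      finally have le: "(1 + norm x) ^ ?n * norm (\<phi> x) \<le> 2 ^ ?n * 2 * S \<phi>" by simp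
      have pos: "(1 + norm x) ^ ?n > 0" by (intro zero_less_power) (simp add: add_pos_nonneg)
      show ?thesis using le pos unfolding decay_def by (simp add: pos_le_divide_eq mult.commute)
    qed
    have "(LINT x|lborel. norm (\<phi> x)) \<le> (LINT x|lborel. (2 ^ ?n * 2 * S \<phi>) * decay (x :: real ^ 'n))"
      by (intro Bochner_Integration.integral_mono integrable_norm schwartz_integrable \<phi> integrable_mult_right integrable_decay b3)
    also have "\<dots> = (2 ^ ?n * 2 * S \<phi>) * W" unfolding W_def by (rule integral_mult_right_zero)
    finally have n1: "(LINT x|lborel. norm (\<phi> x)) \<le> (2 ^ ?n * 2 * S \<phi>) * W" .
    have "norm (LINT x|lborel. f x * \<phi> x) \<le> (LINT x|lborel. norm (f x * \<phi> x))"
      by (rule integral_norm_bound)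
    also have "\<dots> \<le> a * (LINT x|lborel. norm (\<phi> x)) + S \<phi> * K"
      unfolding K_def
      by (rule integrable_mult_bounded_integrable(2)[OF Lp_fun_measurable[OF f] aF schwartz_integrable[OF \<phi>] b])
    also have "\<dots> \<le> a * ((2 ^ ?n * 2 * S \<phi>) * W) + S \<phi> * K"
      using n1 aF(1) by (intro add_right_mono mult_left_mono)
    finally show ?thesis by (simp add: algebra_simps)
  qed
  show ?thesis unfolding tempered_def mem_Collect_eq
  proof (intro conjI ballI allI)
    show "distr_of f \<in> extensional schwartz" by (simp add: distr_of_def)
    fix \<phi> \<psi> :: "real ^ 'n \<Rightarrow> complex" and c d :: complex
    assume \<phi>: "\<phi> \<in> schwartz" and \<psi>: "\<psi> \<in> schwartz"
    have "(\<lambda>x. c * \<phi> x + d * \<psi> x) \<in> schwartz" using \<phi> \<psi> by (intro schwartz_add schwartz_cmult)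
    moreover have "(LINT x|lborel. f x * (c * \<phi> x + d * \<psi> x)) =
        (LINT x|lborel. c * (f x * \<phi> x) + d * (f x * \<psi> x))"
      by (simp add: algebra_simps)
    moreover have "\<dots> = c * (LINT x|lborel. f x * \<phi> x) + d * (LINT x|lborel. f x * \<psi> x)"
      using int[OF \<phi>] int[OF \<psi>] by simp
    ultimately show "distr_of f (\<lambda>x. c * \<phi> x + d * \<psi> x) = c * distr_of f \<phi> + d * distr_of f \<psi>"
      using \<phi> \<psi> by (simp add: distr_of_def)
  next
    show "\<exists>C N. \<forall>\<phi>\<in>schwartz. norm (distr_of f \<phi>) \<le>
        C * (\<Sum>k\<le>N. \<Sum>is | length is \<le> N. schwartz_seminorm k is \<phi>)"
      using bound unfolding S_def by (intro exI[of _ "a * (2 ^ ?n * 2 * W) + K"] exI[of _ ?n]) (auto simp: distr_of_def)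
  qed
qed

section \<open>Averages over translations\<close>

text \<open>The tangent of \<open>t \<mapsto> t\<^sup>q\<close> at \<open>a\<close> lies below the graph, read off from Young's inequality.\<close>

lemma powr_tangent:
  fixes a t q :: real
  assumes "q \<ge> 1" "a \<ge> 0" "t \<ge> 0"
  shows "q * a powr (q - 1) * t \<le> t powr q + (q - 1) * a powr q"
proof (cases "q = 1")
  case False
  then have q: "q > 1" using assms by simp
  have "t * (a powr (q - 1)) \<le> t powr q / q + (a powr (q - 1)) powr (q / (q - 1)) / (q / (q - 1))"
    using q assms by (intro Youngs_inequality) (auto simp: field_simps)
  also have "(a powr (q - 1)) powr (q / (q - 1)) = a powr q"
    using q by (simp add: powr_powr)
  finally show ?thesis using q by (simp add: field_simps)
qed (use assms in auto)

text \<open>Integrate the tangent inequality at the mean value of \<open>F\<close> with respect to \<open>w\<close>.\<close>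

lemma Jensen_powr:
  fixes w F :: "'a \<Rightarrow> real"
  assumes w: "integrable M w" "\<And>x. w x \<ge> 0" and F: "\<And>x. F x \<ge> 0"
    and q: "q \<ge> 1" and wF: "integrable M (\<lambda>x. w x * F x)" and wFq: "integrable M (\<lambda>x. w x * F x powr q)"
    and pos: "(LINT x|M. w x) > 0"
  shows "(LINT x|M. w x * F x) powr q \<le> (LINT x|M. w x) powr (q - 1) * (LINT x|M. w x * F x powr q)"
proof -
  define \<kappa> A where "\<kappa> = (LINT x|M. w x)" and "A = (LINT x|M. w x * F x)"
  define a where "a = A / \<kappa>"
  have \<kappa>: "\<kappa> > 0" using pos by (simp add: \<kappa>_def)
  have A: "A \<ge> 0" unfolding A_def using w F by (intro Bochner_Integration.integral_nonneg mult_nonneg_nonneg)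
  have a: "a \<ge> 0" using A \<kappa> by (simp add: a_def)
  have "(LINT x|M. q * a powr (q - 1) * (w x * F x)) \<le> (LINT x|M. w x * F x powr q + (q - 1) * a powr q * w x)"
  proof (rule Bochner_Integration.integral_mono)
    fix x
    show "q * a powr (q - 1) * (w x * F x) \<le> w x * F x powr q + (q - 1) * a powr q * w x"
      using mult_left_mono[OF powr_tangent[OF q a F[of x]] w(2)[of x]] by (simp add: algebra_simps)
  qed (use w wF wFq in auto)
  then have le: "q * a powr (q - 1) * A \<le> (LINT x|M. w x * F x powr q) + (q - 1) * a powr q * \<kappa>"
    using w wF wFq by (simp add: A_def \<kappa>_def)
  have "a powr q = a powr (q - 1) * a" using a by (cases "a = 0") (auto simp: powr_diff)
  then have "a powr (q - 1) * A = a powr q * \<kappa>" using \<kappa> by (simp add: a_def)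
  then have "q * (a powr q * \<kappa>) \<le> (LINT x|M. w x * F x powr q) + (q - 1) * a powr q * \<kappa>"
    using le by (metis mult.assoc)
  then have le2: "a powr q * \<kappa> \<le> (LINT x|M. w x * F x powr q)" by (simp add: algebra_simps)
  have "A powr q = (\<kappa> * a) powr q" using \<kappa> by (simp add: a_def)
  also have "\<dots> = \<kappa> powr (q - 1) * (a powr q * \<kappa>)" using \<kappa> a by (simp add: powr_mult powr_diff)
  also have "\<dots> \<le> \<kappa> powr (q - 1) * (LINT x|M. w x * F x powr q)" by (intro mult_left_mono le2) auto
  finally show ?thesis by (simp add: A_def \<kappa>_def)
qed

text \<open>A finite signed measure on \<open>\<real>\<^sup>n\<close>, presented as the image under \<open>Y\<close> of a density \<open>k\<close> on some measure space. The
parameter space is left arbitrary so that mixtures over several parameters can be used directly.\<close>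

locale translation_average = sigma_finite_measure M for M :: "'o measure" +
  fixes k :: "'o \<Rightarrow> real" and Y :: "'o \<Rightarrow> real ^ 'n::finite"
  assumes k: "integrable M k" and Y [measurable]: "Y \<in> borel_measurable M"
begin

sublocale pair: pair_sigma_finite M "lborel :: (real ^ 'n) measure" ..
sublocale pair': pair_sigma_finite "lborel :: (real ^ 'n) measure" M ..

lemma measurable_k [measurable]: "k \<in> borel_measurable M"
  using k by auto

definition avg :: "(real ^ 'n \<Rightarrow> complex) \<Rightarrow> real ^ 'n \<Rightarrow> complex" where
  "avg f z = (LINT \<omega>|M. of_real (k \<omega>) * f (z + Y \<omega>))"

definition mass :: real where "mass = (LINT \<omega>|M. \<bar>k \<omega>\<bar>)"

lemma mass_nonneg: "mass \<ge> 0"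
  by (simp add: mass_def)

lemma measurable_avg [measurable]:
  assumes [measurable]: "f \<in> borel_measurable borel"
  shows "avg f \<in> borel_measurable borel"
  unfolding avg_def[abs_def] by (rule borel_measurable_lebesgue_integral) measurable

lemma norm_avg_le: "norm (avg f z) \<le> (LINT \<omega>|M. \<bar>k \<omega>\<bar> * norm (f (z + Y \<omega>)))"
  using integral_norm_bound[of M "\<lambda>\<omega>. of_real (k \<omega>) * f (z + Y \<omega>)"] by (simp add: avg_def norm_mult)

text \<open>The case of infinite right-hand side has to be separated, and so has the case of mass zero, where a product
\<open>0 \<sqdot> \<infinity>\<close> could occur on the right but the average itself vanishes.\<close>

lemma norm_avg_powr_le:
  assumes q: "q \<ge> 1" and [measurable]: "f \<in> borel_measurable borel"
  shows "ennreal (norm (avg f z) powr q) \<le>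
    ennreal (mass powr (q - 1)) * (\<integral>\<^sup>+\<omega>. ennreal (\<bar>k \<omega>\<bar> * norm (f (z + Y \<omega>)) powr q) \<partial>M)"
proof (cases "mass = 0")
  case True
  then have "AE \<omega> in M. k \<omega> = 0"
    unfolding mass_def using k by (subst (asm) integral_nonneg_eq_0_iff_AE) auto
  then have "avg f z = (LINT \<omega>|M. 0)" unfolding avg_def by (intro integral_cong_AE) auto
  then show ?thesis using q by simp
next
  case False
  then have pos: "mass > 0" using mass_nonneg by simp
  let ?I = "\<integral>\<^sup>+\<omega>. ennreal (\<bar>k \<omega>\<bar> * norm (f (z + Y \<omega>)) powr q) \<partial>M"
  show ?thesis
  proof (cases "?I = \<infinity>")
    case True
    then show ?thesis using pos by (simp add: ennreal_mult_top)
  next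
    case False
    then have wFq: "integrable M (\<lambda>\<omega>. \<bar>k \<omega>\<bar> * norm (f (z + Y \<omega>)) powr q)"
      by (intro integrableI_bounded) (auto simp: top.not_eq_extremum)
    have wF: "integrable M (\<lambda>\<omega>. \<bar>k \<omega>\<bar> * norm (f (z + Y \<omega>)))"
    proof (rule Bochner_Integration.integrable_bound)
      show "integrable M (\<lambda>\<omega>. \<bar>k \<omega>\<bar> + \<bar>k \<omega>\<bar> * norm (f (z + Y \<omega>)) powr q)"
        using wFq k by simp
      have "t \<le> 1 + t powr q" if "t \<ge> 0" for t :: real
      proof (cases "t \<le> 1")
        case False
        then have "t powr 1 \<le> t powr q" using q by (intro powr_mono) auto
        then show ?thesis using False by simp
      qed (simp add: add_increasing2)
      then have "\<bar>k \<omega>\<bar> * norm (f (z + Y \<omega>)) \<le> \<bar>k \<omega>\<bar> * (1 + norm (f (z + Y \<omega>)) powr q)" for \<omega>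
        by (intro mult_left_mono) auto
      then show "AE \<omega> in M. norm (\<bar>k \<omega>\<bar> * norm (f (z + Y \<omega>)))
          \<le> norm (\<bar>k \<omega>\<bar> + \<bar>k \<omega>\<bar> * norm (f (z + Y \<omega>)) powr q)"
        by (simp add: distrib_left)
    qed measurable
    have "norm (avg f z) powr q \<le> (LINT \<omega>|M. \<bar>k \<omega>\<bar> * norm (f (z + Y \<omega>))) powr q"
      using q by (intro powr_mono2 norm_avg_le) auto
    also have "\<dots> \<le> mass powr (q - 1) * (LINT \<omega>|M. \<bar>k \<omega>\<bar> * norm (f (z + Y \<omega>)) powr q)"
      using pos k wF wFq q unfolding mass_def by (intro Jensen_powr) auto
    finally have "ennreal (norm (avg f z) powr q) \<le>
        ennreal (mass powr (q - 1)) * ennreal (LINT \<omega>|M. \<bar>k \<omega>\<bar> * norm (f (z + Y \<omega>)) powr q)"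
      by (simp add: ennreal_mult[symmetric] ennreal_leI)
    also have "ennreal (LINT \<omega>|M. \<bar>k \<omega>\<bar> * norm (f (z + Y \<omega>)) powr q) = ?I"
      using wFq by (intro nn_integral_eq_integral[symmetric]) auto
    finally show ?thesis .
  qed
qed

text \<open>Young's inequality for convolution with a finite measure. For finite \<open>p\<close> it is Jensen's inequality followed by
Tonelli's theorem and translation invariance; for \<open>p = \<infinity>\<close> almost every point avoids the exceptional null set
along almost all translations.\<close>

lemma Lp_fun_norm_avg:
  assumes p: "1 \<le> p" and f: "f \<in> Lp_fun p"
  shows "Lp_fun_norm p (avg f) \<le> ennreal mass * Lp_fun_norm p f"
proof (cases "p = \<infinity>")
  case False
  let ?q = "enn2real p"
  have q: "?q \<ge> 1" using p False by (rule Lp_finite_exponent)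
  have [measurable]: "f \<in> borel_measurable borel" using f by (rule Lp_fun_measurable)
  let ?I = "\<integral>\<^sup>+x. ennreal (norm (f x) powr ?q) \<partial>lborel"
  have "(\<integral>\<^sup>+z. ennreal (norm (avg f z) powr ?q) \<partial>lborel) \<le>
      (\<integral>\<^sup>+z. ennreal (mass powr (?q - 1)) * (\<integral>\<^sup>+\<omega>. ennreal (\<bar>k \<omega>\<bar> * norm (f (z + Y \<omega>)) powr ?q) \<partial>M) \<partial>lborel)"
    by (intro nn_integral_mono norm_avg_powr_le q) measurable
  also have "\<dots> = ennreal (mass powr (?q - 1)) *
      (\<integral>\<^sup>+z. (\<integral>\<^sup>+\<omega>. ennreal (\<bar>k \<omega>\<bar> * norm (f (z + Y \<omega>)) powr ?q) \<partial>M) \<partial>lborel)"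
    by (rule nn_integral_cmult) measurable
  also have "(\<integral>\<^sup>+z. (\<integral>\<^sup>+\<omega>. ennreal (\<bar>k \<omega>\<bar> * norm (f (z + Y \<omega>)) powr ?q) \<partial>M) \<partial>lborel) =
      (\<integral>\<^sup>+\<omega>. (\<integral>\<^sup>+z. ennreal (\<bar>k \<omega>\<bar> * norm (f (z + Y \<omega>)) powr ?q) \<partial>lborel) \<partial>M)"
    by (rule pair.Fubini') measurable
  also have "\<dots> = (\<integral>\<^sup>+\<omega>. ennreal \<bar>k \<omega>\<bar> * ?I \<partial>M)"
  proof (rule nn_integral_cong)
    fix \<omega>
    have "(\<integral>\<^sup>+z. ennreal (\<bar>k \<omega>\<bar> * norm (f (z + Y \<omega>)) powr ?q) \<partial>lborel) =
        ennreal \<bar>k \<omega>\<bar> * (\<integral>\<^sup>+z. ennreal (norm (f (Y \<omega> + z)) powr ?q) \<partial>lborel)"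
      by (simp add: ennreal_mult add.commute nn_integral_cmult)
    also have "\<dots> = ennreal \<bar>k \<omega>\<bar> * ?I"
      by (subst nn_integral_lborel_translate) auto
    finally show "(\<integral>\<^sup>+z. ennreal (\<bar>k \<omega>\<bar> * norm (f (z + Y \<omega>)) powr ?q) \<partial>lborel) = ennreal \<bar>k \<omega>\<bar> * ?I" .
  qed
  also have "\<dots> = ennreal mass * ?I"
    unfolding mass_def using k by (subst nn_integral_multc) (auto simp: nn_integral_eq_integral)
  also have "ennreal (mass powr (?q - 1)) * (ennreal mass * ?I) = ennreal (mass powr ?q) * ?I"
  proof -
    have "mass powr (?q - 1) * mass = mass powr ?q"
      using mass_nonneg by (cases "mass = 0") (auto simp: powr_diff)
    then show ?thesis using mass_nonneg by (simp add: mult.assoc[symmetric] ennreal_mult[symmetric])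
  qed
  finally show ?thesis using p False f mass_nonneg by (intro Lp_fun_norm_le)
next
  case True
  have [measurable]: "f \<in> borel_measurable borel" using f by (rule Lp_fun_measurable)
  define a where "a = enn2real (esssup lborel (\<lambda>x. ennreal (norm (f x))))"
  have fin: "esssup lborel (\<lambda>x. ennreal (norm (f x))) < \<infinity>"
    using f True by (simp add: Lp_fun_def Lp_fun_norm_def)
  have a: "esssup lborel (\<lambda>x. ennreal (norm (f x))) = ennreal a"
    using fin by (simp add: a_def ennreal_enn2real_if)
  have a0: "a \<ge> 0" by (simp add: a_def)
  have bound: "AE x in lborel. norm (f x) \<le> a"
    using esssup_AE[where M = lborel and f = "\<lambda>x. ennreal (norm (f x))"] unfolding a by eventually_elim (simp add: a0)
  have "AE \<omega> in M. AE z in lborel. norm (f (z + Y \<omega>)) \<le> a"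
  proof (rule AE_I2)
    fix \<omega>
    have "AE x in distr lborel borel ((+) (Y \<omega>)). norm (f x) \<le> a"
      unfolding lborel_distr_plus by (rule bound)
    then show "AE z in lborel. norm (f (z + Y \<omega>)) \<le> a"
      by (subst (asm) AE_distr_iff) (auto simp: add.commute)
  qed
  then have AE: "AE z in lborel. AE \<omega> in M. norm (f (z + Y \<omega>)) \<le> a"
    by (rule pair.AE_commute[THEN iffD1, rotated]) measurable
  have "AE z in lborel. ennreal (norm (avg f z)) \<le> ennreal (mass * a)"
    using AE
  proof eventually_elim
    case (elim z)
    have "norm (avg f z) \<le> (LINT \<omega>|M. \<bar>k \<omega>\<bar> * norm (f (z + Y \<omega>)))" by (rule norm_avg_le)
    also have "\<dots> \<le> (LINT \<omega>|M. \<bar>k \<omega>\<bar> * a)"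
    proof (rule integral_mono_AE')
      show "integrable M (\<lambda>\<omega>. \<bar>k \<omega>\<bar> * a)" using k by simp
      show "AE \<omega> in M. \<bar>k \<omega>\<bar> * norm (f (z + Y \<omega>)) \<le> \<bar>k \<omega>\<bar> * a"
        using elim by eventually_elim (simp add: mult_left_mono)
    qed (use a0 in simp)
    also have "\<dots> = mass * a" unfolding mass_def by (rule integral_mult_left_zero)
    finally show ?case by (rule ennreal_leI)
  qed
  then have "esssup lborel (\<lambda>z. ennreal (norm (avg f z))) \<le> ennreal (mass * a)"
    by (intro esssup_I) measurable
  also have "\<dots> = ennreal mass * ennreal a" using mass_nonneg a0 by (simp add: ennreal_mult)
  finally show ?thesis using True by (simp add: Lp_fun_norm_def a)
qed

lemma Lp_fun_avg:
  assumes p: "1 \<le> p" and f: "f \<in> Lp_fun p"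
  shows "avg f \<in> Lp_fun p"
proof -
  have [measurable]: "f \<in> borel_measurable borel" using f by (rule Lp_fun_measurable)
  have "Lp_fun_norm p (avg f) \<le> ennreal mass * Lp_fun_norm p f" using p f by (rule Lp_fun_norm_avg)
  also have "\<dots> < \<infinity>" using f by (simp add: Lp_fun_def ennreal_mult_less_top)
  finally show ?thesis by (simp add: Lp_fun_def)
qed

lemma integrable_pair_dominated:
  fixes H :: "'o \<times> (real ^ 'n) \<Rightarrow> complex"
  assumes [measurable]: "H \<in> borel_measurable (M \<Otimes>\<^sub>M lborel)"
    and int: "\<And>\<omega>. integrable lborel (\<lambda>x. H (\<omega>, x))"
    and B: "\<And>\<omega>. (LINT x|lborel. norm (H (\<omega>, x))) \<le> \<bar>k \<omega>\<bar> * B"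
  shows "integrable (M \<Otimes>\<^sub>M lborel) H"
proof (rule pair.Fubini_integrable)
  show "integrable M (\<lambda>\<omega>. LINT x|lborel. norm (H (\<omega>, x)))"
  proof (rule Bochner_Integration.integrable_bound)
    show "integrable M (\<lambda>\<omega>. \<bar>k \<omega>\<bar> * B)" using k by simp
    show "AE \<omega> in M. norm (LINT x|lborel. norm (H (\<omega>, x))) \<le> norm (\<bar>k \<omega>\<bar> * B)"
      by (intro AE_I2) (simp add: order_trans[OF B abs_ge_self])
  qed measurable
qed (use int in auto)

text \<open>The average is moved from the test function to \<open>f\<close>. Both double integrals converge absolutely because
\<open>\<integral> |f x| |\<phi> (x - y)| dx\<close> is bounded uniformly in \<open>y\<close>.\<close>

lemma integral_avg:
  fixes f \<phi> :: "real ^ 'n \<Rightarrow> complex"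
  assumes p: "1 \<le> p" and f: "f \<in> Lp_fun p" and \<phi>: "\<phi> \<in> schwartz"
  shows "(LINT x|lborel. f x * (LINT \<omega>|M. of_real (k \<omega>) * \<phi> (x - Y \<omega>))) = (LINT z|lborel. avg f z * \<phi> z)"
proof -
  have [measurable]: "f \<in> borel_measurable borel" "\<phi> \<in> borel_measurable borel"
    using f \<phi> by (auto intro: Lp_fun_measurable schwartz_measurable)
  obtain a F where aF: "a \<ge> 0" "integrable lborel F" "\<And>x. F x \<ge> 0" "AE x in lborel. norm (f x) \<le> a + F x"
    using Lp_fun_split[OF p f] by metis
  obtain C where C: "\<And>x. norm (\<phi> x) \<le> C" using schwartz_bounded[OF \<phi>] by metis
  define B where "B = a * (LINT x|lborel. norm (\<phi> x)) + C * (LINT x|lborel. F x)"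
  have \<phi>int: "integrable lborel (\<lambda>x. \<phi> (x - y))" for y
    using integrable_lborel_translate[OF schwartz_integrable[OF \<phi>], of "- y"] by simp
  have \<phi>norm: "(LINT x|lborel. norm (\<phi> (x - y))) = (LINT x|lborel. norm (\<phi> x))" for y
    using integral_lborel_translate[of "\<lambda>x. norm (\<phi> x)" "- y"] by simp
  note * = integrable_mult_bounded_integrable[OF Lp_fun_measurable[OF f] aF \<phi>int C]
  have int1: "integrable lborel (\<lambda>x. f x * \<phi> (x - y))" for y by (rule *)
  have B1: "(LINT x|lborel. norm (f x * \<phi> (x - y))) \<le> B" for y
    using *(2)[of y] by (simp add: B_def \<phi>norm)
  have shift: "(\<lambda>z. f (z + y) * \<phi> z) = (\<lambda>z. (\<lambda>x. f x * \<phi> (x - y)) (y + z))" for y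
    by (simp add: add.commute)
  have int2: "integrable lborel (\<lambda>z. f (z + y) * \<phi> z)" for y
    unfolding shift by (rule integrable_lborel_translate[OF int1])
  have shift_eq: "(LINT z|lborel. f (z + y) * \<phi> z) = (LINT x|lborel. f x * \<phi> (x - y))" for y
    unfolding shift by (rule integral_lborel_translate) measurable
  have B2: "(LINT z|lborel. norm (f (z + y) * \<phi> z)) \<le> B" for y
    using integral_lborel_translate[of "\<lambda>x. norm (f x * \<phi> (x - y))" y] B1[of y] by (simp add: add.commute)
  have I1: "integrable (M \<Otimes>\<^sub>M lborel) (\<lambda>(\<omega>, x). of_real (k \<omega>) * (f x * \<phi> (x - Y \<omega>)))"
    by (rule integrable_pair_dominated[where B = B])
       (auto simp: norm_mult[of "of_real _"] B1 int1 intro!: mult_left_mono)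
  have I2: "integrable (M \<Otimes>\<^sub>M lborel) (\<lambda>(\<omega>, z). of_real (k \<omega>) * (f (z + Y \<omega>) * \<phi> z))"
    by (rule integrable_pair_dominated[where B = B])
       (auto simp: norm_mult[of "of_real _"] B2 int2 intro!: mult_left_mono)
  have "(LINT x|lborel. f x * (LINT \<omega>|M. of_real (k \<omega>) * \<phi> (x - Y \<omega>))) =
      (LINT x|lborel. LINT \<omega>|M. of_real (k \<omega>) * (f x * \<phi> (x - Y \<omega>)))"
    by (subst integral_mult_right_zero[symmetric]) (simp add: mult_ac)
  also have "\<dots> = (LINT \<omega>|M. LINT x|lborel. of_real (k \<omega>) * (f x * \<phi> (x - Y \<omega>)))"
    by (rule pair.Fubini_integral[OF I1])
  also have "\<dots> = (LINT \<omega>|M. LINT z|lborel. of_real (k \<omega>) * (f (z + Y \<omega>) * \<phi> z))"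
    by (simp only: integral_mult_right_zero shift_eq)
  also have "\<dots> = (LINT z|lborel. LINT \<omega>|M. of_real (k \<omega>) * (f (z + Y \<omega>) * \<phi> z))"
    by (rule pair.Fubini_integral[OF I2, symmetric])
  also have "\<dots> = (LINT z|lborel. avg f z * \<phi> z)"
    unfolding avg_def by (subst integral_mult_left_zero[symmetric]) (simp add: mult_ac)
  finally show ?thesis .
qed

text \<open>Multiplying by a character in frequency is a translation in space; Fubini's theorem extends this to mixtures of
characters.\<close>

lemma fourier_symbol_mult:
  assumes \<phi>: "\<phi> \<in> schwartz"
    and m: "\<And>\<xi>. m \<xi> = (LINT \<omega>|M. of_real (k \<omega>) * iexp (2 * pi * (Y \<omega> \<bullet> \<xi>)))"
  shows "fourier (\<lambda>\<xi>. m \<xi> * inv_fourier \<phi> \<xi>) x = (LINT \<omega>|M. of_real (k \<omega>) * \<phi> (x - Y \<omega>))"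
proof -
  define h where "h = inv_fourier \<phi>"
  have h: "h \<in> schwartz" unfolding h_def using \<phi> by (rule inv_fourier_schwartz)
  have \<phi>_eq: "\<phi> = osc (- (2 * pi)) h"
    using fourier_inv_fourier[OF \<phi>] by (simp add: h_def fourier_eq_osc)
  have kint: "integrable M (\<lambda>\<omega>. complex_of_real (k \<omega>))" using k by simp
  let ?G = "\<lambda>\<omega> \<xi>. of_real (k \<omega>) * h \<xi> * iexp (- (2 * pi) * (\<xi> \<bullet> (x - Y \<omega>)))"
  have int: "integrable (M \<Otimes>\<^sub>M lborel) (\<lambda>(\<omega>, \<xi>). ?G \<omega> \<xi>)"
    using pair.integrable_pair_mult[OF kint schwartz_integrable[OF h],
        of "\<lambda>p. iexp (- (2 * pi) * (snd p \<bullet> (x - Y (fst p))))"] by simp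
  have "fourier (\<lambda>\<xi>. m \<xi> * h \<xi>) x = (LINT \<xi>|lborel. LINT \<omega>|M. ?G \<omega> \<xi>)"
    unfolding fourier_eq_osc osc_def
  proof (intro Bochner_Integration.integral_cong refl)
    fix \<xi>
    have "m \<xi> * h \<xi> * iexp (- (2 * pi) * (\<xi> \<bullet> x)) =
        (LINT \<omega>|M. of_real (k \<omega>) * iexp (2 * pi * (Y \<omega> \<bullet> \<xi>))) * (h \<xi> * iexp (- (2 * pi) * (\<xi> \<bullet> x)))"
      by (simp only: m mult.assoc)
    also have "\<dots> = (LINT \<omega>|M. of_real (k \<omega>) * iexp (2 * pi * (Y \<omega> \<bullet> \<xi>)) * (h \<xi> * iexp (- (2 * pi) * (\<xi> \<bullet> x))))"
      by (rule integral_mult_left_zero[symmetric])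
    also have "\<dots> = (LINT \<omega>|M. ?G \<omega> \<xi>)"
    proof (intro Bochner_Integration.integral_cong refl)
      fix \<omega>
      have "iexp (- (2 * pi) * (\<xi> \<bullet> (x - Y \<omega>))) = iexp (2 * pi * (Y \<omega> \<bullet> \<xi>)) * iexp (- (2 * pi) * (\<xi> \<bullet> x))"
        by (simp add: exp_add[symmetric] inner_diff_right inner_commute algebra_simps)
      then show "of_real (k \<omega>) * iexp (2 * pi * (Y \<omega> \<bullet> \<xi>)) * (h \<xi> * iexp (- (2 * pi) * (\<xi> \<bullet> x))) = ?G \<omega> \<xi>"
        by (simp only: mult_ac)
    qed
    finally show "m \<xi> * h \<xi> * iexp (- (2 * pi) * (\<xi> \<bullet> x)) = (LINT \<omega>|M. ?G \<omega> \<xi>)" .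
  qed
  also have "\<dots> = (LINT \<omega>|M. LINT \<xi>|lborel. ?G \<omega> \<xi>)"
    by (rule pair.Fubini_integral[OF int])
  also have "\<dots> = (LINT \<omega>|M. of_real (k \<omega>) * \<phi> (x - Y \<omega>))"
    by (simp only: \<phi>_eq osc_def mult.assoc integral_mult_right_zero)
  finally show ?thesis by (simp add: h_def)
qed

end

section \<open>Fourier multipliers on Lebesgue spaces\<close>

text \<open>The operator is described through its transpose, acting on test functions. In this form it makes sense for
\<open>p = \<infinity>\<close>, where the Schwartz space is not dense, and composes well.\<close>

definition Lp_multiplier :: "ennreal \<Rightarrow> (real ^ 'n::finite \<Rightarrow> complex) \<Rightarrow> bool" where
  "Lp_multiplier p m \<longleftrightarrow> m \<in> slowly_increasing \<and>
     (\<exists>C::real. C \<ge> 0 \<and> (\<forall>f\<in>Lp_fun p. \<exists>g\<in>Lp_fun p. Lp_fun_norm p g \<le> ennreal C * Lp_fun_norm p f \<and>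
        (\<forall>\<phi>\<in>schwartz. (LINT x|lborel. f x * fourier (\<lambda>\<xi>. m \<xi> * inv_fourier \<phi> \<xi>) x) =
                      (LINT x|lborel. g x * \<phi> x))))"

lemma (in translation_average) Lp_multiplier_symbol:
  assumes p: "1 \<le> p" and m: "m \<in> slowly_increasing"
    and eq: "\<And>\<xi>. m \<xi> = (LINT \<omega>|M. of_real (k \<omega>) * iexp (2 * pi * (Y \<omega> \<bullet> \<xi>)))"
  shows "Lp_multiplier p m"
  unfolding Lp_multiplier_def
proof (intro conjI exI[of _ mass] ballI)
  fix f :: "real ^ 'n \<Rightarrow> complex" assume f: "f \<in> Lp_fun p"
  show "\<exists>g\<in>Lp_fun p. Lp_fun_norm p g \<le> ennreal mass * Lp_fun_norm p f \<and>
        (\<forall>\<phi>\<in>schwartz. (LINT x|lborel. f x * fourier (\<lambda>\<xi>. m \<xi> * inv_fourier \<phi> \<xi>) x) =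
                      (LINT x|lborel. g x * \<phi> x))"
    using Lp_fun_avg[OF p f] Lp_fun_norm_avg[OF p f]
    by (intro bexI[of _ "avg f"] conjI ballI) (simp_all add: fourier_symbol_mult[OF _ eq] integral_avg[OF p f])
qed (use m mass_nonneg in auto)

text \<open>By Fourier inversion the operator of the product is the composition of the two operators.\<close>

lemma Lp_multiplier_mult:
  fixes m1 m2 :: "real ^ 'n::finite \<Rightarrow> complex"
  assumes 1: "Lp_multiplier p m1" and 2: "Lp_multiplier p m2"
  shows "Lp_multiplier p (\<lambda>\<xi>. m1 \<xi> * m2 \<xi>)"
proof -
  note d = Lp_multiplier_def
  obtain C1 where C1: "C1 \<ge> 0" "\<And>f. f \<in> Lp_fun p \<Longrightarrow> \<exists>g\<in>Lp_fun p. Lp_fun_norm p g \<le> ennreal C1 * Lp_fun_norm p f \<and>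
        (\<forall>\<phi>\<in>schwartz. (LINT x|lborel. f x * fourier (\<lambda>\<xi>. m1 \<xi> * inv_fourier \<phi> \<xi>) x) =
                      (LINT x|lborel. g x * \<phi> x))" using 1 unfolding d by blast
  obtain C2 where C2: "C2 \<ge> 0" "\<And>f. f \<in> Lp_fun p \<Longrightarrow> \<exists>g\<in>Lp_fun p. Lp_fun_norm p g \<le> ennreal C2 * Lp_fun_norm p f \<and>
        (\<forall>\<phi>\<in>schwartz. (LINT x|lborel. f x * fourier (\<lambda>\<xi>. m2 \<xi> * inv_fourier \<phi> \<xi>) x) =
                      (LINT x|lborel. g x * \<phi> x))" using 2 unfolding d by blast
  have m: "m1 \<in> slowly_increasing" "m2 \<in> slowly_increasing" using 1 2 by (auto simp: d)
  show ?thesis unfolding d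
  proof (intro conjI exI[of _ "C1 * C2"] ballI)
    show "(\<lambda>\<xi>. m1 \<xi> * m2 \<xi>) \<in> slowly_increasing" using m by (rule slowly_increasing_mult)
    show "0 \<le> C1 * C2" using C1 C2 by simp
    fix f :: "real ^ 'n \<Rightarrow> complex" assume "f \<in> Lp_fun p"
    from C1(2)[OF this] obtain g where g: "g \<in> Lp_fun p" "Lp_fun_norm p g \<le> ennreal C1 * Lp_fun_norm p f"
      "\<And>\<phi>. \<phi> \<in> schwartz \<Longrightarrow> (LINT x|lborel. f x * fourier (\<lambda>\<xi>. m1 \<xi> * inv_fourier \<phi> \<xi>) x) =
                      (LINT x|lborel. g x * \<phi> x)" by blast
    from C2(2)[OF g(1)] obtain h where h: "h \<in> Lp_fun p" "Lp_fun_norm p h \<le> ennreal C2 * Lp_fun_norm p g"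
      "\<And>\<phi>. \<phi> \<in> schwartz \<Longrightarrow> (LINT x|lborel. g x * fourier (\<lambda>\<xi>. m2 \<xi> * inv_fourier \<phi> \<xi>) x) =
                      (LINT x|lborel. h x * \<phi> x)" by blast
    show "\<exists>h\<in>Lp_fun p. Lp_fun_norm p h \<le> ennreal (C1 * C2) * Lp_fun_norm p f \<and>
        (\<forall>\<phi>\<in>schwartz. (LINT x|lborel. f x * fourier (\<lambda>\<xi>. m1 \<xi> * m2 \<xi> * inv_fourier \<phi> \<xi>) x) =
                      (LINT x|lborel. h x * \<phi> x))"
    proof (intro bexI[of _ h] conjI ballI h(1))
      have "Lp_fun_norm p h \<le> ennreal C2 * (ennreal C1 * Lp_fun_norm p f)"
        using h(2) g(2) by (meson mult_left_mono order_trans zero_le)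
      then show "Lp_fun_norm p h \<le> ennreal (C1 * C2) * Lp_fun_norm p f"
        using C1 C2 by (simp add: ennreal_mult mult_ac)
      fix \<phi> :: "real ^ 'n \<Rightarrow> complex" assume \<phi>: "\<phi> \<in> schwartz"
      let ?\<psi> = "fourier (\<lambda>\<xi>. m2 \<xi> * inv_fourier \<phi> \<xi>)"
      have s: "(\<lambda>\<xi>. m2 \<xi> * inv_fourier \<phi> \<xi>) \<in> schwartz"
        using m(2) \<phi> by (intro slowly_increasing_mult_schwartz inv_fourier_schwartz)
      then have "(LINT x|lborel. f x * fourier (\<lambda>\<xi>. m1 \<xi> * inv_fourier ?\<psi> \<xi>) x) =
          (LINT x|lborel. h x * \<phi> x)"
        using g(3)[OF fourier_schwartz[OF s]] h(3)[OF \<phi>] by simp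
      then show "(LINT x|lborel. f x * fourier (\<lambda>\<xi>. m1 \<xi> * m2 \<xi> * inv_fourier \<phi> \<xi>) x) =
          (LINT x|lborel. h x * \<phi> x)"
        by (simp add: inv_fourier_fourier[OF s] mult.assoc)
    qed
  qed
qed

lemma fourier_multiplier_apply:
  assumes "m \<in> slowly_increasing" "\<phi> \<in> schwartz"
  shows "fourier_multiplier m u \<phi> = u (fourier (\<lambda>\<xi>. m \<xi> * inv_fourier \<phi> \<xi>))"
  using assms slowly_increasing_mult_schwartz[OF assms(1) inv_fourier_schwartz[OF assms(2)]]
  by (simp add: fourier_multiplier_def inv_fourier_distr_def mult_distr_def fourier_distr_def inv_fourier_schwartz)

lemma fourier_multiplier_extensional: "fourier_multiplier m u \<in> extensional schwartz"
  by (simp add: fourier_multiplier_def inv_fourier_distr_def)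

lemma fourier_multiplier_one:
  assumes "u \<in> extensional schwartz"
  shows "fourier_multiplier (\<lambda>_. 1) u = u"
proof (rule extensionalityI[OF fourier_multiplier_extensional assms])
  fix \<phi> :: "real ^ 'a \<Rightarrow> complex" assume \<phi>: "\<phi> \<in> schwartz"
  then show "fourier_multiplier (\<lambda>_. 1) u \<phi> = u \<phi>"
    by (simp add: fourier_multiplier_apply[OF slowly_increasing_const] fourier_inv_fourier)
qed

text \<open>Let \<open>\<psi> = \<F> (m \<F>\<^sup>-\<^sup>1 \<phi>)\<close>. Fourier inversion gives \<open>m\<^sub>1 \<F>\<^sup>-\<^sup>1 \<psi> = m\<^sub>2 \<F>\<^sup>-\<^sup>1 \<phi>\<close>, so the second operator tested
on \<open>\<phi>\<close> is the first one tested on \<open>\<psi>\<close>. A constant \<open>C \<ge> 1\<close> makes the norm estimate true also where the right-hand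
norm is infinite.\<close>

lemma Lp_multiplier_compare:
  fixes m m1 m2 :: "real ^ 'n::finite \<Rightarrow> complex"
  assumes p: "1 \<le> p" and m: "Lp_multiplier p m"
    and m1: "m1 \<in> slowly_increasing" and m2: "m2 \<in> slowly_increasing"
    and eq: "\<And>\<xi>. m2 \<xi> = m1 \<xi> * m \<xi>"
  obtains C :: real where "C \<ge> 1"
    "\<And>u. Lp_norm p (fourier_multiplier m2 u) \<le> ennreal C * Lp_norm p (fourier_multiplier m1 u)"
    "\<And>u. fourier_multiplier m1 u \<in> Lp_space p \<Longrightarrow> fourier_multiplier m2 u \<in> Lp_space p"
proof -
  obtain C0 where C0: "C0 \<ge> 0" "\<And>f. f \<in> Lp_fun p \<Longrightarrow> \<exists>g\<in>Lp_fun p. Lp_fun_norm p g \<le> ennreal C0 * Lp_fun_norm p f \<and>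
        (\<forall>\<phi>\<in>schwartz. (LINT x|lborel. f x * fourier (\<lambda>\<xi>. m \<xi> * inv_fourier \<phi> \<xi>) x) =
                      (LINT x|lborel. g x * \<phi> x))"
    using m unfolding Lp_multiplier_def by blast
  define C where "C = max 1 C0"
  have C1: "C \<ge> 1" and "ennreal C0 \<le> ennreal C" by (auto simp: C_def intro!: ennreal_leI)
  then have C: "\<exists>g\<in>Lp_fun p. Lp_fun_norm p g \<le> ennreal C * Lp_fun_norm p f \<and>
        (\<forall>\<phi>\<in>schwartz. (LINT x|lborel. f x * fourier (\<lambda>\<xi>. m \<xi> * inv_fourier \<phi> \<xi>) x) =
                      (LINT x|lborel. g x * \<phi> x))" if "f \<in> Lp_fun p" for f
    using C0(2)[OF that] by (meson mult_right_mono order_trans zero_le)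
  have ms: "m \<in> slowly_increasing" using m by (simp add: Lp_multiplier_def)
  have key: "\<exists>g\<in>Lp_fun p. Lp_fun_norm p g \<le> ennreal C * Lp_fun_norm p f \<and> fourier_multiplier m2 u = distr_of g"
    if f: "f \<in> Lp_fun p" and u: "fourier_multiplier m1 u = distr_of f" for f u
  proof -
    obtain g where g: "g \<in> Lp_fun p" "Lp_fun_norm p g \<le> ennreal C * Lp_fun_norm p f"
      "\<And>\<phi>. \<phi> \<in> schwartz \<Longrightarrow> (LINT x|lborel. f x * fourier (\<lambda>\<xi>. m \<xi> * inv_fourier \<phi> \<xi>) x) =
                      (LINT x|lborel. g x * \<phi> x)" using C[OF f] by blast
    have "fourier_multiplier m2 u = distr_of g"
    proof (rule extensionalityI[OF fourier_multiplier_extensional])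
      show "distr_of g \<in> extensional schwartz" by (simp add: distr_of_def)
      fix \<phi> :: "real ^ 'n \<Rightarrow> complex" assume \<phi>: "\<phi> \<in> schwartz"
      let ?\<psi> = "fourier (\<lambda>\<xi>. m \<xi> * inv_fourier \<phi> \<xi>)"
      have s: "(\<lambda>\<xi>. m \<xi> * inv_fourier \<phi> \<xi>) \<in> schwartz"
        using ms \<phi> by (intro slowly_increasing_mult_schwartz inv_fourier_schwartz)
      have "fourier_multiplier m2 u \<phi> = fourier_multiplier m1 u ?\<psi>"
        by (simp add: fourier_multiplier_apply m1 m2 \<phi> s fourier_schwartz inv_fourier_fourier eq mult.assoc)
      also have "\<dots> = (LINT x|lborel. f x * ?\<psi> x)"
        using fourier_schwartz[OF s] by (simp add: u distr_of_def)
      also have "\<dots> = distr_of g \<phi>" using g(3)[OF \<phi>] \<phi> by (simp add: distr_of_def)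
      finally show "fourier_multiplier m2 u \<phi> = distr_of g \<phi>" .
    qed
    then show ?thesis using g by blast
  qed
  show thesis
  proof (rule that[OF C1])
    fix u :: "'n distr"
    show "fourier_multiplier m2 u \<in> Lp_space p" if u: "fourier_multiplier m1 u \<in> Lp_space p"
    proof -
      obtain f where "f \<in> Lp_fun p" "fourier_multiplier m1 u = distr_of f" using u by (auto simp: Lp_space_def)
      from key[OF this] obtain g where g: "g \<in> Lp_fun p" "fourier_multiplier m2 u = distr_of g" by blast
      with Lp_fun_tempered[OF p g(1)] show ?thesis by (auto simp: Lp_space_def)
    qed
    show "Lp_norm p (fourier_multiplier m2 u) \<le> ennreal C * Lp_norm p (fourier_multiplier m1 u)"
    proof (cases "\<exists>f\<in>Lp_fun p. fourier_multiplier m1 u = distr_of f")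
      case True
      have "Lp_norm p (fourier_multiplier m2 u) \<le> ennreal C * Lp_fun_norm p f"
        if f: "f \<in> Lp_fun p" "fourier_multiplier m1 u = distr_of f" for f
      proof -
        obtain g where g: "g \<in> Lp_fun p" "Lp_fun_norm p g \<le> ennreal C * Lp_fun_norm p f"
          "fourier_multiplier m2 u = distr_of g" using key[OF f] by blast
        then have "Lp_norm p (fourier_multiplier m2 u) \<le> Lp_fun_norm p g"
          unfolding Lp_norm_def by (intro INF_lower) auto
        also note g(2)
        finally show ?thesis .
      qed
      then have le: "ennreal (1 / C) * Lp_norm p (fourier_multiplier m2 u) \<le> Lp_norm p (fourier_multiplier m1 u)"
        unfolding Lp_norm_def[of p "fourier_multiplier m1 u"]
      proof (intro INF_greatest)
        fix f assume "f \<in> {f \<in> Lp_fun p. fourier_multiplier m1 u = distr_of f}"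
        and le: "\<And>f. f \<in> Lp_fun p \<Longrightarrow> fourier_multiplier m1 u = distr_of f \<Longrightarrow>
          Lp_norm p (fourier_multiplier m2 u) \<le> ennreal C * Lp_fun_norm p f"
        then have "ennreal (1 / C) * Lp_norm p (fourier_multiplier m2 u) \<le> ennreal (1 / C) * (ennreal C * Lp_fun_norm p f)"
          by (intro mult_left_mono) auto
        then show "ennreal (1 / C) * Lp_norm p (fourier_multiplier m2 u) \<le> Lp_fun_norm p f"
          using C1 by (simp add: mult.assoc[symmetric] ennreal_mult[symmetric])
      qed
      have "Lp_norm p (fourier_multiplier m2 u) = ennreal C * (ennreal (1 / C) * Lp_norm p (fourier_multiplier m2 u))"
        using C1 by (simp add: mult.assoc[symmetric] ennreal_mult[symmetric])
      also have "\<dots> \<le> ennreal C * Lp_norm p (fourier_multiplier m1 u)"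
        by (intro mult_left_mono le) simp
      finally show ?thesis .
    next
      case False
      then have "{f \<in> Lp_fun p. fourier_multiplier m1 u = distr_of f} = {}" by auto
      then have "Lp_norm p (fourier_multiplier m1 u) = \<top>" by (simp only: Lp_norm_def image_empty Inf_empty)
      then show ?thesis using C1 by (simp add: ennreal_mult_top)
    qed
  qed
qed

section \<open>Mixtures of heat semigroups\<close>

text \<open>\<open>exp (- T 4 \<pi>\<^sup>2 |\<xi>|\<^sup>2)\<close> is the characteristic function of \<open>\<surd>(2 T) y\<close> with \<open>y\<close> standard normal, taken at
\<open>2 \<pi> \<xi>\<close>. Adjoining \<open>y\<close> to the parameter space presents the mixture as an average over translations. Scaling
\<open>y\<close> instead of the density admits \<open>T = 0\<close>, the identity.\<close>

lemma gaussian_mixture_Lp_multiplier: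
  fixes m :: "real ^ 'n::finite \<Rightarrow> complex" and M :: "'o measure"
  assumes p: "1 \<le> p" and m: "m \<in> slowly_increasing"
    and M: "sigma_finite_measure M" and T [measurable]: "T \<in> borel_measurable M" and T0: "\<And>\<omega>. T \<omega> \<ge> 0"
    and k: "integrable M k"
    and eq: "\<And>\<xi>. m \<xi> = of_real (LINT \<omega>|M. k \<omega> * exp (- (T \<omega> * (4 * pi\<^sup>2 * (norm \<xi>)\<^sup>2))))"
  shows "Lp_multiplier p m"
proof -
  interpret sigma_finite_measure M by (rule M)
  interpret P: pair_sigma_finite M "lborel :: (real ^ 'n) measure" ..
  have [measurable]: "k \<in> borel_measurable M" using k by auto
  let ?k = "\<lambda>q :: 'o \<times> (real ^ 'n). k (fst q) * gauss (snd q)"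
  let ?Y = "\<lambda>q :: 'o \<times> (real ^ 'n). sqrt (2 * T (fst q)) *\<^sub>R snd q"
  have int: "integrable (M \<Otimes>\<^sub>M lborel) ?k"
  proof (rule P.Fubini_integrable)
    show "integrable M (\<lambda>\<omega>. LINT y|lborel. norm (k (fst (\<omega>, y)) * gauss (snd (\<omega>, y))))"
      using k by (simp add: abs_mult gauss_nonneg integral_gauss)
    show "AE \<omega> in M. integrable lborel (\<lambda>y. k (fst (\<omega>, y)) * gauss (snd (\<omega>, y)))"
      unfolding fst_conv snd_conv by (intro AE_I2 integrable_mult_right integrable_gauss)
  qed measurable
  interpret translation_average "M \<Otimes>\<^sub>M lborel" ?k ?Y
    by (intro translation_average.intro translation_average_axioms.intro int
        P.P.sigma_finite_measure_axioms) measurable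
  show ?thesis
  proof (rule Lp_multiplier_symbol[OF p m])
    fix \<xi> :: "real ^ 'n"
    let ?f = "\<lambda>q. of_real (?k q) * iexp (2 * pi * (?Y q \<bullet> \<xi>))"
    have int_f: "integrable (M \<Otimes>\<^sub>M lborel) ?f"
      using int by (intro integrable_mult_iexp integrable_of_real) measurable
    have inner: "(LINT y|lborel. ?f (\<omega>, y)) = of_real (k \<omega> * exp (- (T \<omega> * (4 * pi\<^sup>2 * (norm \<xi>)\<^sup>2))))" for \<omega>
    proof -
      let ?v = "(2 * pi * sqrt (2 * T \<omega>)) *\<^sub>R \<xi>"
      have "(norm ?v)\<^sup>2 / 2 = T \<omega> * (4 * pi\<^sup>2 * (norm \<xi>)\<^sup>2)"
        using T0[of \<omega>] by (simp add: power_mult_distrib)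
      then have g: "(LINT y|lborel. of_real (gauss y) * iexp (?v \<bullet> y)) =
          of_real (exp (- (T \<omega> * (4 * pi\<^sup>2 * (norm \<xi>)\<^sup>2))))"
        unfolding integral_gauss_iexp by simp
      have "(LINT y|lborel. ?f (\<omega>, y)) = (LINT y|lborel. of_real (k \<omega>) * (of_real (gauss y) * iexp (?v \<bullet> y)))"
        by (intro Bochner_Integration.integral_cong refl) (simp add: inner_commute mult_ac)
      also have "\<dots> = of_real (k \<omega>) * of_real (exp (- (T \<omega> * (4 * pi\<^sup>2 * (norm \<xi>)\<^sup>2))))"
        unfolding integral_mult_right_zero g ..
      finally show ?thesis by simp
    qed
    have "(LINT q|(M \<Otimes>\<^sub>M lborel). ?f q) = (LINT \<omega>|M. LINT y|lborel. ?f (\<omega>, y))"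
      by (rule P.integral_fst'[OF int_f, symmetric])
    also have "\<dots> = m \<xi>" unfolding inner eq by (rule integral_complex_of_real)
    finally show "m \<xi> = (LINT q|(M \<Otimes>\<^sub>M lborel). ?f q)" ..
  qed
qed

text \<open>The factor \<open>exp (- T b)\<close> of \<open>exp (- T (b + 4 \<pi>\<^sup>2 |\<xi>|\<^sup>2))\<close> is absorbed into the density.\<close>

lemma laplace_mixture_Lp_multiplier:
  fixes m :: "real ^ 'n::finite \<Rightarrow> complex" and M :: "'o measure"
  assumes p: "1 \<le> p" and m: "m \<in> slowly_increasing"
    and M: "sigma_finite_measure M" and T: "T \<in> borel_measurable M" "\<And>\<omega>. T \<omega> \<ge> 0"
    and k: "integrable M (\<lambda>\<omega>. k \<omega> * exp (- (T \<omega> * b)))"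
    and eq: "\<And>\<xi>. m \<xi> = of_real (LINT \<omega>|M. k \<omega> * exp (- (T \<omega> * symbol b \<xi>)))"
  shows "Lp_multiplier p m"
  by (rule gaussian_mixture_Lp_multiplier[OF p m M T k])
     (simp add: eq mult.assoc exp_add[symmetric] algebra_simps)

section \<open>The four multipliers\<close>

text \<open>The density \<open>\<tau>\<^bsup>a - 1\<^esup> / \<Gamma>(a)\<close> on the positive half line, whose Laplace transform at \<open>b\<close> is \<open>b\<^bsup>-a\<^esup>\<close>. The
reciprocal Gamma function is entire, which makes the density measurable jointly in \<open>a\<close> and \<open>\<tau>\<close>.\<close>

definition gamma_weight :: "real \<Rightarrow> real \<Rightarrow> real" where
  "gamma_weight a \<tau> = indicator {0<..} \<tau> * (rGamma a * \<tau> powr (a - 1))"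

lemma measurable_rGamma [measurable (raw)]:
  fixes f :: "'a \<Rightarrow> real"
  shows "f \<in> borel_measurable M \<Longrightarrow> (\<lambda>x. rGamma (f x)) \<in> borel_measurable M"
  by (erule measurable_compose) (intro borel_measurable_continuous_onI continuous_on_rGamma)

lemma measurable_gamma_weight [measurable (raw)]:
  assumes [measurable]: "f \<in> borel_measurable M" "g \<in> borel_measurable M"
  shows "(\<lambda>x. gamma_weight (f x) (g x)) \<in> borel_measurable M"
  unfolding gamma_weight_def by measurable

lemma rGamma_pos: "(a :: real) > 0 \<Longrightarrow> rGamma a > 0"
  by (simp add: rGamma_inverse_Gamma)

lemma gamma_weight_nonneg: "a > 0 \<Longrightarrow> gamma_weight a \<tau> \<ge> 0"
  using rGamma_pos[of a] by (simp add: gamma_weight_def)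

lemma gamma_weight_scale: "b > 0 \<Longrightarrow> a > 0 \<Longrightarrow> gamma_weight a (\<tau> / b) = b powr (1 - a) * gamma_weight a \<tau>"
  by (cases "\<tau> > 0") (auto simp: gamma_weight_def powr_divide powr_diff zero_less_divide_iff powr_minus field_simps)

lemma
  assumes a: "a > 0" and b: "b > 0"
  shows integrable_gamma_weight: "integrable lborel (\<lambda>\<tau>. gamma_weight a \<tau> * exp (- (\<tau> * b)))"
    and integral_gamma_weight: "(LINT \<tau>|lborel. gamma_weight a \<tau> * exp (- (\<tau> * b))) = b powr (- a)"
proof -
  have one: "has_bochner_integral lborel (\<lambda>\<tau>. gamma_weight a \<tau> * exp (- \<tau>)) 1"
  proof (rule has_bochner_integral_nn_integral)
    have "(\<integral>\<^sup>+\<tau>. ennreal (gamma_weight a \<tau> * exp (- \<tau>)) \<partial>lborel) =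
        (\<integral>\<^sup>+\<tau>. ennreal (rGamma a) * ennreal (indicator {0..} \<tau> * \<tau> powr (a - 1) / exp \<tau>) \<partial>lborel)"
    proof (rule nn_integral_cong_AE)
      have "AE \<tau> in lborel. \<tau> \<noteq> (0::real)" by (rule AE_lborel_singleton)
      then show "AE \<tau> in lborel. ennreal (gamma_weight a \<tau> * exp (- \<tau>)) =
          ennreal (rGamma a) * ennreal (indicator {0..} \<tau> * \<tau> powr (a - 1) / exp \<tau>)"
      proof eventually_elim
        case (elim \<tau>)
        then show ?case using rGamma_pos[OF a]
          by (auto simp: gamma_weight_def indicator_def ennreal_mult[symmetric] exp_minus field_simps)
      qed
    qed
    also have "\<dots> = ennreal (rGamma a) * ennreal (Gamma a)"
      by (subst nn_integral_cmult) (simp_all add: Gamma_conv_nn_integral_real[OF a])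
    also have "\<dots> = ennreal 1"
    proof -
      have "rGamma a * Gamma a = 1"
        using less_imp_neq[OF Gamma_real_pos[OF a]] by (simp add: rGamma_inverse_Gamma)
      then show ?thesis using rGamma_pos[OF a] a by (simp add: ennreal_mult[symmetric])
    qed
    finally show "(\<integral>\<^sup>+\<tau>. ennreal (gamma_weight a \<tau> * exp (- \<tau>)) \<partial>lborel) = ennreal 1" .
  qed (use gamma_weight_nonneg[OF a] in auto)
  let ?f = "\<lambda>\<tau>. gamma_weight a \<tau> * exp (- (\<tau> * b))"
  have "?f (0 + (1 / b) * \<tau>) = b powr (1 - a) * (gamma_weight a \<tau> * exp (- \<tau>))" for \<tau>
    using gamma_weight_scale[OF b a, of \<tau>] b by simp
  then have "has_bochner_integral lborel ?f (b powr (- a)) \<longleftrightarrow>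
      has_bochner_integral lborel (\<lambda>\<tau>. b powr (1 - a) * (gamma_weight a \<tau> * exp (- \<tau>))) (b powr (- a) /\<^sub>R \<bar>1 / b\<bar>)"
    using b by (subst lborel_has_bochner_integral_real_affine_iff[of "1 / b" _ _ 0]) (simp_all add: mult.assoc)
  also have "b powr (- a) /\<^sub>R \<bar>1 / b\<bar> = b powr (1 - a) * 1"
    using b by (simp add: powr_diff powr_minus field_simps)
  finally have "has_bochner_integral lborel ?f (b powr (- a))"
    using has_bochner_integral_mult_right[OF one, of "b powr (1 - a)"] by (simp add: mult.assoc)
  then show "integrable lborel ?f" "(LINT \<tau>|lborel. ?f \<tau>) = b powr (- a)"
    by (auto simp: has_bochner_integral_iff)
qed

text \<open>Mixtures need exponents \<open>T \<ge> 0\<close> everywhere, so \<open>max 0 \<tau>\<close> replaces \<open>\<tau>\<close>; they differ only where the density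
vanishes.\<close>

lemma gamma_weight_max: "gamma_weight a \<tau> * exp (- (max 0 \<tau> * b)) = gamma_weight a \<tau> * exp (- (\<tau> * b))"
  by (cases "\<tau> > 0") (auto simp: gamma_weight_def)

lemma Lp_multiplier_powr:
  assumes p: "1 \<le> p" and l: "l > 0" and a: "a > 0"
  shows "Lp_multiplier p (\<lambda>\<xi> :: real ^ 'n::finite. of_real (symbol l \<xi> powr (- a)))"
proof (rule laplace_mixture_Lp_multiplier[where M = lborel and T = "max 0" and k = "gamma_weight a" and b = l])
  show "(\<lambda>\<xi> :: real ^ 'n. of_real (symbol l \<xi> powr (- a))) \<in> slowly_increasing"
    using l by (rule slowly_increasing_powr)
  show "of_real (symbol l \<xi> powr (- a)) =
      of_real (LINT \<tau>|lborel. gamma_weight a \<tau> * exp (- (max 0 \<tau> * symbol l \<xi>)))" for \<xi> :: "real ^ 'n"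
    unfolding gamma_weight_max integral_gamma_weight[OF a symbol_pos[OF l]] ..
qed (use p l integrable_gamma_weight[OF a l] in \<open>auto simp: gamma_weight_max intro: sigma_finite_lborel\<close>)

text \<open>
Substituting \<open>\<tau> / b\<close> for \<open>\<tau>\<close> turns \<open>ln \<tau>\<close> into \<open>ln \<tau> - ln b\<close>. Near \<open>0\<close> and \<open>\<infinity>\<close> the logarithm is absorbed by changing
the exponent \<open>a\<close> slightly: \<open>\<eta> |ln \<tau>| \<le> \<tau>\<^bsup>\<eta>\<^esup> + \<tau>\<^bsup>-\<eta>\<^esup>\<close>.
\<close>

lemma
  assumes a: "a > 0" and b: "b > 0"
  shows integrable_gamma_weight_ln: "integrable lborel (\<lambda>\<tau>. gamma_weight a \<tau> * ln \<tau> * exp (- (\<tau> * b)))"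
    and integral_gamma_weight_ln: "(LINT \<tau>|lborel. gamma_weight a \<tau> * ln \<tau> * exp (- (\<tau> * b))) =
      b powr (- a) * ((LINT \<tau>|lborel. gamma_weight a \<tau> * ln \<tau> * exp (- \<tau>)) - ln b)"
proof -
  have int: "integrable lborel (\<lambda>\<tau>. gamma_weight a \<tau> * ln \<tau> * exp (- (\<tau> * c)))" if c: "c > 0" for c
  proof -
    \<comment> \<open>Any exponent strictly between \<open>0\<close> and \<open>a\<close> works: both \<open>a + \<eta>\<close> and \<open>a - \<eta>\<close> must stay positive.\<close>
    define \<eta> where "\<eta> = a / 2"
    have \<eta>: "\<eta> > 0" "\<eta> < a" using a by (auto simp: \<eta>_def)
    let ?K = "\<lambda>s. rGamma a / rGamma s / \<eta>"
    have le: "\<bar>gamma_weight a \<tau> * ln \<tau> * exp (- (\<tau> * c))\<bar> \<le>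
        ?K (a + \<eta>) * (gamma_weight (a + \<eta>) \<tau> * exp (- (\<tau> * c))) + ?K (a - \<eta>) * (gamma_weight (a - \<eta>) \<tau> * exp (- (\<tau> * c)))" for \<tau>
    proof (cases "\<tau> > 0")
      case True
      have "\<eta> * ln \<tau> \<le> \<tau> powr \<eta>" "- (\<eta> * ln \<tau>) \<le> \<tau> powr (- \<eta>)"
        using ln_le_minus_one[of "\<tau> powr \<eta>"] ln_le_minus_one[of "\<tau> powr (- \<eta>)"] True by (auto simp: ln_powr)
      moreover have "\<tau> powr \<eta> > 0" "\<tau> powr (- \<eta>) > 0" using True by auto
      ultimately have "\<bar>\<eta> * ln \<tau>\<bar> \<le> \<tau> powr \<eta> + \<tau> powr (- \<eta>)" by linarith
      then have ln: "\<bar>ln \<tau>\<bar> \<le> (\<tau> powr \<eta> + \<tau> powr (- \<eta>)) / \<eta>"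
        using \<eta>(1) by (simp add: abs_mult pos_le_divide_eq mult.commute)
      have "\<bar>gamma_weight a \<tau> * ln \<tau> * exp (- (\<tau> * c))\<bar> = rGamma a * \<tau> powr (a - 1) * exp (- (\<tau> * c)) * \<bar>ln \<tau>\<bar>"
        using True rGamma_pos[OF a] by (simp add: gamma_weight_def abs_mult)
      also have "\<dots> \<le> rGamma a * \<tau> powr (a - 1) * exp (- (\<tau> * c)) * ((\<tau> powr \<eta> + \<tau> powr (- \<eta>)) / \<eta>)"
        using rGamma_pos[OF a] by (intro mult_left_mono ln) auto
      also have "\<dots> = rGamma a / \<eta> * \<tau> powr (a + \<eta> - 1) * exp (- (\<tau> * c))
          + rGamma a / \<eta> * \<tau> powr (a - \<eta> - 1) * exp (- (\<tau> * c))"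
      proof -
        have "\<tau> powr (a + \<eta> - 1) = \<tau> powr (a - 1) * \<tau> powr \<eta>" "\<tau> powr (a - \<eta> - 1) = \<tau> powr (a - 1) * \<tau> powr (- \<eta>)"
          by (simp_all add: powr_add[symmetric] algebra_simps)
        then show ?thesis using \<eta>(1) by (simp add: field_simps)
      qed
      also have "\<dots> = ?K (a + \<eta>) * (gamma_weight (a + \<eta>) \<tau> * exp (- (\<tau> * c))) + ?K (a - \<eta>) * (gamma_weight (a - \<eta>) \<tau> * exp (- (\<tau> * c)))"
        using True rGamma_pos[of "a + \<eta>"] rGamma_pos[of "a - \<eta>"] a \<eta> by (simp add: gamma_weight_def)
      finally show ?thesis .
    qed (simp add: gamma_weight_def)
    have "integrable lborel (\<lambda>\<tau>. ?K (a + \<eta>) * (gamma_weight (a + \<eta>) \<tau> * exp (- (\<tau> * c)))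
        + ?K (a - \<eta>) * (gamma_weight (a - \<eta>) \<tau> * exp (- (\<tau> * c))))"
      using \<eta> a c by (intro Bochner_Integration.integrable_add integrable_mult_right integrable_gamma_weight) auto
    then show ?thesis
    proof (rule Bochner_Integration.integrable_bound)
      show "AE \<tau> in lborel. norm (gamma_weight a \<tau> * ln \<tau> * exp (- (\<tau> * c))) \<le>
          norm (?K (a + \<eta>) * (gamma_weight (a + \<eta>) \<tau> * exp (- (\<tau> * c))) + ?K (a - \<eta>) * (gamma_weight (a - \<eta>) \<tau> * exp (- (\<tau> * c))))"
        unfolding real_norm_def by (intro AE_I2 order_trans[OF le abs_ge_self])
    qed measurable
  qed
  show "integrable lborel (\<lambda>\<tau>. gamma_weight a \<tau> * ln \<tau> * exp (- (\<tau> * b)))" using b by (rule int)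
  let ?f = "\<lambda>\<tau>. gamma_weight a \<tau> * ln \<tau> * exp (- (\<tau> * b))"
  have sc: "?f (0 + (1 / b) * \<tau>) =
      b powr (1 - a) * (gamma_weight a \<tau> * ln \<tau> * exp (- \<tau>) - ln b * (gamma_weight a \<tau> * exp (- \<tau>)))" for \<tau>
  proof (cases "\<tau> > 0")
    case True
    have "?f (0 + (1 / b) * \<tau>) = gamma_weight a (\<tau> / b) * ln (\<tau> / b) * exp (- \<tau>)" using b by simp
    also have "\<dots> = b powr (1 - a) * gamma_weight a \<tau> * (ln \<tau> - ln b) * exp (- \<tau>)"
      using True b by (simp add: gamma_weight_scale[OF b a] ln_div)
    finally show ?thesis by (simp add: algebra_simps)
  qed (use b in \<open>simp add: gamma_weight_def zero_less_divide_iff\<close>)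
  have "(LINT \<tau>|lborel. ?f \<tau>) = (1 / b) * (LINT \<tau>|lborel. ?f (0 + (1 / b) * \<tau>))"
    using b by (subst lborel_integral_real_affine[of "1 / b" _ 0]) auto
  also have "\<dots> = (1 / b) * (b powr (1 - a) *
      ((LINT \<tau>|lborel. gamma_weight a \<tau> * ln \<tau> * exp (- \<tau>)) - ln b * (LINT \<tau>|lborel. gamma_weight a \<tau> * exp (- \<tau>))))"
    unfolding sc using int[of 1] integrable_gamma_weight[OF a, of 1] by simp
  also have "(LINT \<tau>|lborel. gamma_weight a \<tau> * exp (- \<tau>)) = 1" using integral_gamma_weight[OF a, of 1] by simp
  also have "(1 / b) * (b powr (1 - a) * ((LINT \<tau>|lborel. gamma_weight a \<tau> * ln \<tau> * exp (- \<tau>)) - ln b * 1)) =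
      b powr (- a) * ((LINT \<tau>|lborel. gamma_weight a \<tau> * ln \<tau> * exp (- \<tau>)) - ln b)"
    using b by (simp add: powr_diff powr_minus field_simps)
  finally show "(LINT \<tau>|lborel. ?f \<tau>) = \<dots>" .
qed

text \<open>Solving the formula for \<open>\<integral> \<tau>\<^bsup>a - 1\<^esup> ln \<tau> e\<^bsup>- \<tau> b\<^esup> d\<tau>\<close> for \<open>b\<^bsup>-a\<^esup> ln b\<close> gives the density
\<open>(c - ln \<tau>) \<tau>\<^bsup>a - 1\<^esup> / \<Gamma>(a)\<close>, where \<open>\<Gamma>(a) c\<close> is the value of that integral at \<open>b = 1\<close>.\<close>

lemma Lp_multiplier_powr_ln:
  assumes p: "1 \<le> p" and l: "l > 1" and a: "a > 0"
  shows "Lp_multiplier p (\<lambda>\<xi> :: real ^ 'n::finite. of_real (symbol l \<xi> powr (- a) * ln (symbol l \<xi>)))"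
proof -
  define c where "c = (LINT \<tau>|lborel. gamma_weight a \<tau> * ln \<tau> * exp (- \<tau>))"
  have l0: "l > 0" using l by simp
  have split: "gamma_weight a \<tau> * (c - ln \<tau>) * exp (- (max 0 \<tau> * b)) =
      c * (gamma_weight a \<tau> * exp (- (\<tau> * b))) - gamma_weight a \<tau> * ln \<tau> * exp (- (\<tau> * b))" for \<tau> b
    by (cases "\<tau> > 0") (auto simp: gamma_weight_def algebra_simps)
  show ?thesis
  proof (rule laplace_mixture_Lp_multiplier[where M = lborel and T = "max 0" and
        k = "\<lambda>\<tau>. gamma_weight a \<tau> * (c - ln \<tau>)" and b = l])
    show "(\<lambda>\<xi> :: real ^ 'n. of_real (symbol l \<xi> powr (- a) * ln (symbol l \<xi>))) \<in> slowly_increasing"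
      using slowly_increasing_mult[OF slowly_increasing_powr[OF l0, of "- a"] slowly_increasing_ln[OF l]] by simp
    show "integrable lborel (\<lambda>\<tau>. gamma_weight a \<tau> * (c - ln \<tau>) * exp (- (max 0 \<tau> * l)))"
      unfolding split using integrable_gamma_weight[OF a l0] integrable_gamma_weight_ln[OF a l0] by simp
    fix \<xi> :: "real ^ 'n"
    have b: "symbol l \<xi> > 0" using l0 by (rule symbol_pos)
    have "(LINT \<tau>|lborel. gamma_weight a \<tau> * (c - ln \<tau>) * exp (- (max 0 \<tau> * symbol l \<xi>))) =
        c * symbol l \<xi> powr (- a) - symbol l \<xi> powr (- a) * (c - ln (symbol l \<xi>))"
      unfolding split using integrable_gamma_weight[OF a b] integrable_gamma_weight_ln[OF a b]
      by (simp add: integral_gamma_weight[OF a b] integral_gamma_weight_ln[OF a b] c_def)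
    then show "of_real (symbol l \<xi> powr (- a) * ln (symbol l \<xi>)) =
        of_real (LINT \<tau>|lborel. gamma_weight a \<tau> * (c - ln \<tau>) * exp (- (max 0 \<tau> * symbol l \<xi>)))"
      by (simp add: algebra_simps)
  qed (use p in \<open>auto intro: sigma_finite_lborel\<close>)
qed

text \<open>
\<open>1 / ln b\<close> is the integral of \<open>b\<^bsup>-t\<^esup>\<close> over \<open>t > 0\<close>, and each \<open>b\<^bsup>-t\<^esup>\<close> is a Laplace transform: a mixture with
the two parameters \<open>t\<close> and \<open>\<tau>\<close>.
\<close>

lemma
  assumes b: "b > 1"
  shows integrable_inverse_ln: "integrable (lborel \<Otimes>\<^sub>M lborel)
      (\<lambda>q. indicator {0<..} (fst q) * gamma_weight (fst q) (snd q) * exp (- (max 0 (snd q) * b)))" (is "integrable _ ?f")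
    and integral_inverse_ln: "(LINT q|(lborel \<Otimes>\<^sub>M lborel).
      indicator {0<..} (fst q) * gamma_weight (fst q) (snd q) * exp (- (max 0 (snd q) * b))) = 1 / ln b"
proof -
  have b0: "b > 0" and lnb: "ln b > 0" using b by auto
  have gd1: "gamma_weight 1 t = indicator {0<..} t" for t by (simp add: gamma_weight_def rGamma_inverse_Gamma indicator_def)
  have exp_eq: "indicator {0<..} t * b powr (- t) = gamma_weight 1 t * exp (- (t * ln b))" for t
    using b0 by (simp add: gd1 powr_def)
  have inner: "(LINT \<tau>|lborel. ?f (t, \<tau>)) = indicator {0<..} t * b powr (- t)" for t
  proof (cases "t > 0")
    case True
    then show ?thesis by (simp add: gamma_weight_max integral_gamma_weight[OF True b0])
  qed simp
  have nonneg: "?f q \<ge> 0" for q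
    using gamma_weight_nonneg[of "fst q" "snd q"] by (cases "fst q > 0") auto
  have meas [measurable]: "?f \<in> borel_measurable (lborel \<Otimes>\<^sub>M lborel)"
    by measurable
  show int: "integrable (lborel \<Otimes>\<^sub>M lborel) ?f"
  proof (rule lborel_pair.Fubini_integrable[OF meas])
    have "(\<lambda>t. LINT \<tau>|lborel. norm (?f (t, \<tau>))) = (\<lambda>t. gamma_weight 1 t * exp (- (t * ln b)))"
      using nonneg by (simp only: real_norm_def abs_of_nonneg inner exp_eq)
    then show "integrable lborel (\<lambda>t. LINT \<tau>|lborel. norm (?f (t, \<tau>)))"
      using integrable_gamma_weight[of 1 "ln b"] lnb by simp
    show "AE t in lborel. integrable lborel (\<lambda>\<tau>. ?f (t, \<tau>))"
    proof (rule AE_I2)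
      fix t :: real
      show "integrable lborel (\<lambda>\<tau>. ?f (t, \<tau>))"
        using integrable_gamma_weight[of t b] b0 by (cases "t > 0") (auto simp: gamma_weight_max)
    qed
  qed
  have "(LINT q|(lborel \<Otimes>\<^sub>M lborel). ?f q) = (LINT t|lborel. LINT \<tau>|lborel. ?f (t, \<tau>))"
    by (rule lborel_pair.integral_fst'[OF int, symmetric])
  also have "\<dots> = 1 / ln b"
    unfolding inner exp_eq using integral_gamma_weight[of 1 "ln b"] lnb by (simp add: powr_minus divide_inverse)
  finally show "(LINT q|(lborel \<Otimes>\<^sub>M lborel). ?f q) = 1 / ln b" .
qed

lemma Lp_multiplier_inverse_ln:
  assumes p: "1 \<le> p" and l: "l > 1"
  shows "Lp_multiplier p (\<lambda>\<xi> :: real ^ 'n::finite. of_real (1 / ln (symbol l \<xi>)))"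
proof (rule laplace_mixture_Lp_multiplier[where M = "lborel \<Otimes>\<^sub>M lborel" and T = "\<lambda>q. max 0 (snd q)" and
      k = "\<lambda>q. indicator {0<..} (fst q) * gamma_weight (fst q) (snd q)" and b = l])
  show "(\<lambda>\<xi> :: real ^ 'n. of_real (1 / ln (symbol l \<xi>))) \<in> slowly_increasing"
    using l by (rule slowly_increasing_inverse_ln)
  fix \<xi> :: "real ^ 'n"
  have "symbol l \<xi> > 1" using symbol_ge[of l \<xi>] l by linarith
  then show "of_real (1 / ln (symbol l \<xi>)) = of_real (LINT q|(lborel \<Otimes>\<^sub>M lborel).
      indicator {0<..} (fst q) * gamma_weight (fst q) (snd q) * exp (- (max 0 (snd q) * symbol l \<xi>)))"
    by (simp only: integral_inverse_ln)
qed (use p integrable_inverse_ln[OF l] in \<open>auto intro: lborel_pair.sigma_finite_measure_axioms\<close>)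

text \<open>The binomial series of \<open>(1 + (1 - l) / B)\<^bsup>a\<^esup>\<close> is a mixture over the pairs \<open>(j, \<tau>)\<close>. Its total variation is the
series of absolute values at \<open>B = l\<close>, which converges since \<open>(l - 1) / l < 1\<close>. For the constant term \<open>j = 0\<close>,
\<open>T = 0\<close> and a density of mass \<open>1\<close> on the unit interval play the part of a point mass at \<open>\<tau> = 0\<close>.\<close>

lemma Lp_multiplier_ratio_powr:
  assumes p: "1 \<le> p" and l: "l > 1"
  shows "Lp_multiplier p (\<lambda>\<xi> :: real ^ 'n::finite. of_real ((symbol 1 \<xi> / symbol l \<xi>) powr a))"
proof -
  define h where "h j = (if j = 0 then indicator {0..1} else gamma_weight (real j))" for j :: nat
  define T where "T q = (if fst q = 0 then 0 else max 0 (snd q))" for q :: "nat \<times> real"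
  define co where "co j = (a gchoose j) * (1 - l) ^ j" for j
  let ?k = "\<lambda>q. co (fst q) * h (fst q) (snd q)"
  let ?N = "count_space (UNIV :: nat set)"
  interpret N: sigma_finite_measure ?N by (rule sigma_finite_measure_count_space)
  interpret P: pair_sigma_finite ?N "lborel :: real measure" ..
  have mh [measurable]: "h j \<in> borel_measurable borel" for j by (simp add: h_def)
  have h0: "h j \<tau> \<ge> 0" for j \<tau> by (simp add: h_def gamma_weight_nonneg)
  have T_right [measurable]: "(\<lambda>\<tau>. T (j, \<tau>)) \<in> borel_measurable borel" for j
    unfolding T_def fst_conv snd_conv by (cases "j = 0") simp_all
  have T_meas: "T \<in> borel_measurable (?N \<Otimes>\<^sub>M lborel)"
    by (rule measurable_pair_measure_countable1) simp_all
  have h_int: "integrable lborel (\<lambda>\<tau>. h j \<tau> * exp (- (T (j, \<tau>) * b)))"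
    and h_eq: "(LINT \<tau>|lborel. h j \<tau> * exp (- (T (j, \<tau>) * b))) = (1 / b) ^ j" if b: "b > 0" for b j
    using b integrable_gamma_weight[of "real j" b] integral_gamma_weight[of "real j" b]
    by (auto simp: h_def T_def gamma_weight_max powr_minus powr_realpow divide_inverse power_inverse)
  have int: "integrable (?N \<Otimes>\<^sub>M lborel) (\<lambda>q. ?k q * exp (- (T q * b)))" (is "integrable _ (?F b)")
    and eq: "(LINT q|(?N \<Otimes>\<^sub>M lborel). ?k q * exp (- (T q * b))) = ((b - l + 1) / b) powr a"
    if b: "b \<ge> l" for b
  proof -
    have b0: "b > 0" using b l by simp
    have z: "\<bar>(1 - l) / b\<bar> < 1" using b l by simp
    \<comment> \<open>Convergence at the larger radius \<open>r\<close> gives absolute convergence at \<open>(1 - l) / b\<close>.\<close>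
    obtain r where r: "\<bar>(1 - l) / b\<bar> < r" "r < 1" using dense[OF z] by blast
    have "summable (\<lambda>j. (a gchoose j) * r ^ j)"
      using gen_binomial_real[of r a] r by (auto simp: sums_iff)
    from powser_insidea[OF this, of "(1 - l) / b"] r
    have summ: "summable (\<lambda>j. \<bar>(a gchoose j) * ((1 - l) / b) ^ j\<bar>)" by simp
    have co_eq: "co j * (1 / b) ^ j = (a gchoose j) * ((1 - l) / b) ^ j" for j
      by (simp add: co_def power_divide)
    have inner: "(LINT \<tau>|lborel. ?F b (j, \<tau>)) = (a gchoose j) * ((1 - l) / b) ^ j" for j
      using h_eq[OF b0, of j] co_eq[of j] by (simp add: mult.assoc)
    have inner_abs: "(LINT \<tau>|lborel. norm (?F b (j, \<tau>))) = \<bar>(a gchoose j) * ((1 - l) / b) ^ j\<bar>" for j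
    proof -
      have "(LINT \<tau>|lborel. norm (?F b (j, \<tau>))) = \<bar>co j\<bar> * (LINT \<tau>|lborel. h j \<tau> * exp (- (T (j, \<tau>) * b)))"
        using h0 by (simp add: abs_mult mult.assoc)
      also have "\<dots> = \<bar>co j * (1 / b) ^ j\<bar>" unfolding h_eq[OF b0] using b0 by (simp add: abs_mult)
      finally show ?thesis unfolding co_eq .
    qed
    have meas: "?F b \<in> borel_measurable (?N \<Otimes>\<^sub>M lborel)"
      by (rule measurable_pair_measure_countable1) simp_all
    show int: "integrable (?N \<Otimes>\<^sub>M lborel) (?F b)"
    proof (rule P.Fubini_integrable[OF meas])
      show "integrable ?N (\<lambda>j. LINT \<tau>|lborel. norm (?F b (j, \<tau>)))"
        unfolding inner_abs integrable_count_space_nat_iff using summ by simp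
      show "AE j in ?N. integrable lborel (\<lambda>\<tau>. ?F b (j, \<tau>))"
        using h_int[OF b0] by (intro AE_I2) (simp add: mult.assoc)
    qed
    have "(LINT q|(?N \<Otimes>\<^sub>M lborel). ?F b q) = (LINT j|?N. LINT \<tau>|lborel. ?F b (j, \<tau>))"
      by (rule P.integral_fst'[OF int, symmetric])
    also have "\<dots> = (\<Sum>j. (a gchoose j) * ((1 - l) / b) ^ j)"
      unfolding inner using summ by (intro integral_count_space_nat) (simp add: integrable_count_space_nat_iff)
    also have "\<dots> = (1 + (1 - l) / b) powr a"
      using gen_binomial_real[OF z, of a] by (simp add: sums_iff)
    also have "1 + (1 - l) / b = (b - l + 1) / b" using b0 by (simp add: field_simps)
    finally show "(LINT q|(?N \<Otimes>\<^sub>M lborel). ?F b q) = ((b - l + 1) / b) powr a" .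
  qed
  have slow: "(\<lambda>\<xi> :: real ^ 'n. of_real ((symbol 1 \<xi> / symbol l \<xi>) powr a)) \<in> slowly_increasing"
  proof -
    have "(symbol 1 \<xi> / symbol l \<xi>) powr a = symbol 1 \<xi> powr a * symbol l \<xi> powr (- a)" for \<xi> :: "real ^ 'n"
      using less_imp_le[OF symbol_pos[of 1 \<xi>]] less_imp_le[OF symbol_pos[of l \<xi>]] l
      by (simp add: powr_divide powr_minus_divide)
    moreover have "(\<lambda>\<xi> :: real ^ 'n. of_real (symbol 1 \<xi> powr a) * of_real (symbol l \<xi> powr (- a))) \<in> slowly_increasing"
      using l by (intro slowly_increasing_mult slowly_increasing_powr) auto
    ultimately show ?thesis by simp
  qed
  show ?thesis
  proof (rule laplace_mixture_Lp_multiplier[where M = "?N \<Otimes>\<^sub>M lborel" and T = T and k = ?k and b = l])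
    fix \<xi> :: "real ^ 'n"
    have "symbol l \<xi> - l + 1 = symbol 1 \<xi>" by simp
    with eq[OF symbol_ge, of \<xi>] show "of_real ((symbol 1 \<xi> / symbol l \<xi>) powr a) =
        of_real (LINT q|(?N \<Otimes>\<^sub>M lborel). ?k q * exp (- (T q * symbol l \<xi>)))"
      by (simp only:)
  qed (use p slow int[of l] in \<open>auto simp: T_def[abs_def] intro: P.P.sigma_finite_measure_axioms T_meas[unfolded T_def[abs_def]]\<close>)
qed

section \<open>The embeddings\<close>

theorem proposition1p12:
  fixes p :: ennreal and s l \<epsilon> :: real
  assumes "s > 0" and "l > 1" and "1 \<le> p" and "\<epsilon> > 0"
  shows "continuously_embedded
           (bessel_space p (2 * s + \<epsilon>) :: ('n::finite) distr set) (bessel_norm p (2 * s + \<epsilon>))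
           (log_bessel_space p s l) (log_bessel_norm p s l)
       \<and> continuously_embedded
           (log_bessel_space p s l :: 'n distr set) (log_bessel_norm p s l)
           (bessel_space p (2 * s)) (bessel_norm p (2 * s))
       \<and> continuously_embedded
           (bessel_space p (2 * s) :: 'n distr set) (bessel_norm p (2 * s))
           (Lp_space p) (Lp_norm p)
       \<and> (\<exists>C::real. C \<ge> 1 \<and> (\<forall>u \<in> (schwartz :: (real ^ 'n \<Rightarrow> complex) set).
              bessel_norm p (2 * s) (distr_of u) \<le> ennreal C * log_bessel_norm p s l (distr_of u)
            \<and> log_bessel_norm p s l (distr_of u) \<le> ennreal C * bessel_norm p (2 * s + \<epsilon>) (distr_of u)))"
proof -
  have l0: "l > 0" using assms by simp
  note [simp] = symbol_pos[OF l0] symbol_pos[OF zero_less_one]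
  define mB :: "real \<Rightarrow> real ^ 'n \<Rightarrow> complex" where "mB \<sigma> \<xi> = of_real (symbol 1 \<xi> powr (\<sigma> / 2))" for \<sigma> \<xi>
  define mL :: "real ^ 'n \<Rightarrow> complex" where "mL \<xi> = of_real (symbol l \<xi> powr s * ln (symbol l \<xi>))" for \<xi>
  have op: "bessel_op \<sigma> = fourier_multiplier (mB \<sigma>)" "log_bessel_op s l = fourier_multiplier mL" for \<sigma>
    by (simp_all add: bessel_op_def log_bessel_op_def mB_def[abs_def] mL_def[abs_def])
  have mB: "mB \<sigma> \<in> slowly_increasing" for \<sigma>
    unfolding mB_def[abs_def] by (rule slowly_increasing_powr) simp
  have mL: "mL \<in> slowly_increasing"
    using slowly_increasing_mult[OF slowly_increasing_powr[OF l0, of s] slowly_increasing_ln[OF assms(2)]]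
    by (simp add: mL_def[abs_def])
  have ln_pos: "ln (symbol l \<xi>) > 0" for \<xi> :: "real ^ 'n"
    using symbol_ge[of l \<xi>] assms(2) by (intro ln_gt_zero) linarith

  obtain C1 where C1: "C1 \<ge> 1"
    "\<And>u :: 'n distr. Lp_norm p (log_bessel_op s l u) \<le> ennreal C1 * Lp_norm p (bessel_op (2 * s + \<epsilon>) u)"
    "\<And>u :: 'n distr. bessel_op (2 * s + \<epsilon>) u \<in> Lp_space p \<Longrightarrow> log_bessel_op s l u \<in> Lp_space p"
  proof (rule Lp_multiplier_compare[OF assms(3) Lp_multiplier_mult mB[of "2 * s + \<epsilon>"] mL])
    show "Lp_multiplier p (\<lambda>\<xi> :: real ^ 'n. of_real ((symbol 1 \<xi> / symbol l \<xi>) powr (- (s + \<epsilon> / 2))))"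
      using assms by (intro Lp_multiplier_ratio_powr)
    show "Lp_multiplier p (\<lambda>\<xi> :: real ^ 'n. of_real (symbol l \<xi> powr (- (\<epsilon> / 2)) * ln (symbol l \<xi>)))"
      using assms by (intro Lp_multiplier_powr_ln) auto
    fix \<xi> :: "real ^ 'n"
    have "symbol l \<xi> powr s = symbol l \<xi> powr (s + \<epsilon> / 2) * symbol l \<xi> powr (- (\<epsilon> / 2))"
      by (simp flip: powr_add)
    also have "symbol l \<xi> powr (s + \<epsilon> / 2) =
        symbol 1 \<xi> powr (s + \<epsilon> / 2) * (symbol 1 \<xi> / symbol l \<xi>) powr (- (s + \<epsilon> / 2))"
    proof -
      have ratio: "(symbol 1 \<xi> / symbol l \<xi>) powr (- x) = symbol l \<xi> powr x / symbol 1 \<xi> powr x" for x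
        using less_imp_le[OF symbol_pos[OF zero_less_one, of \<xi>]] less_imp_le[OF symbol_pos[OF l0, of \<xi>]]
        by (simp add: powr_minus_divide powr_divide)
      show ?thesis unfolding ratio using less_imp_neq[OF symbol_pos[OF zero_less_one, of \<xi>]] by simp
    qed
    finally have "symbol l \<xi> powr s = symbol 1 \<xi> powr (s + \<epsilon> / 2) *
        ((symbol 1 \<xi> / symbol l \<xi>) powr (- (s + \<epsilon> / 2)) * symbol l \<xi> powr (- (\<epsilon> / 2)))"
      by (simp only: mult.assoc)
    then show "mL \<xi> = mB (2 * s + \<epsilon>) \<xi> * (of_real ((symbol 1 \<xi> / symbol l \<xi>) powr (- (s + \<epsilon> / 2)))
        * of_real (symbol l \<xi> powr (- (\<epsilon> / 2)) * ln (symbol l \<xi>)))"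
      by (simp only: mL_def mB_def add_divide_distrib mult.assoc of_real_mult[symmetric]) simp
  qed (simp add: op)

  obtain C2 where C2: "C2 \<ge> 1"
    "\<And>u :: 'n distr. Lp_norm p (bessel_op (2 * s) u) \<le> ennreal C2 * Lp_norm p (log_bessel_op s l u)"
    "\<And>u :: 'n distr. log_bessel_op s l u \<in> Lp_space p \<Longrightarrow> bessel_op (2 * s) u \<in> Lp_space p"
  proof (rule Lp_multiplier_compare[OF assms(3) Lp_multiplier_mult mL mB[of "2 * s"]])
    show "Lp_multiplier p (\<lambda>\<xi> :: real ^ 'n. of_real ((symbol 1 \<xi> / symbol l \<xi>) powr s))"
      using assms by (intro Lp_multiplier_ratio_powr)
    show "Lp_multiplier p (\<lambda>\<xi> :: real ^ 'n. of_real (1 / ln (symbol l \<xi>)))"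
      using assms by (intro Lp_multiplier_inverse_ln)
    fix \<xi> :: "real ^ 'n"
    have "symbol 1 \<xi> powr s = symbol l \<xi> powr s * ln (symbol l \<xi>) * ((symbol 1 \<xi> / symbol l \<xi>) powr s * (1 / ln (symbol l \<xi>)))"
      using ln_pos[of \<xi>] by (simp add: powr_divide)
    then show "mB (2 * s) \<xi> = mL \<xi> * (of_real ((symbol 1 \<xi> / symbol l \<xi>) powr s) * of_real (1 / ln (symbol l \<xi>)))"
      by (simp only: mL_def mB_def of_real_mult[symmetric]) simp
  qed (simp add: op)

  obtain C3 where C3: "C3 \<ge> 1"
    "\<And>u :: 'n distr. Lp_norm p (fourier_multiplier (\<lambda>_. 1) u) \<le> ennreal C3 * Lp_norm p (bessel_op (2 * s) u)"
    "\<And>u :: 'n distr. bessel_op (2 * s) u \<in> Lp_space p \<Longrightarrow> fourier_multiplier (\<lambda>_. 1) u \<in> Lp_space p"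
  proof (rule Lp_multiplier_compare[OF assms(3) _ mB[of "2 * s"] slowly_increasing_const[of 1]])
    show "Lp_multiplier p (\<lambda>\<xi> :: real ^ 'n. of_real (symbol 1 \<xi> powr (- s)))"
      using assms by (intro Lp_multiplier_powr) auto
    fix \<xi> :: "real ^ 'n"
    have "1 = symbol 1 \<xi> powr s * symbol 1 \<xi> powr (- s)"
      using less_imp_neq[OF symbol_pos[OF zero_less_one, of \<xi>]] by (simp flip: powr_add)
    then show "1 = mB (2 * s) \<xi> * of_real (symbol 1 \<xi> powr (- s))"
      by (simp only: mB_def of_real_mult[symmetric]) simp
  qed (simp add: op)

  show ?thesis
  proof (intro conjI)
    show "continuously_embedded
           (bessel_space p (2 * s + \<epsilon>) :: 'n distr set) (bessel_norm p (2 * s + \<epsilon>))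
           (log_bessel_space p s l) (log_bessel_norm p s l)"
      using C1 by (auto simp: continuously_embedded_def bessel_space_def log_bessel_space_def
          bessel_norm_def log_bessel_norm_def intro!: exI[of _ C1])
    show "continuously_embedded
           (log_bessel_space p s l :: 'n distr set) (log_bessel_norm p s l)
           (bessel_space p (2 * s)) (bessel_norm p (2 * s))"
      using C2 by (auto simp: continuously_embedded_def bessel_space_def log_bessel_space_def
          bessel_norm_def log_bessel_norm_def intro!: exI[of _ C2])
    have one: "fourier_multiplier (\<lambda>_. 1) u = u" if "u \<in> bessel_space p (2 * s)" for u :: "'n distr"
      using that by (intro fourier_multiplier_one) (simp add: bessel_space_def tempered_def)
    have "u \<in> Lp_space p" "Lp_norm p u \<le> ennreal C3 * bessel_norm p (2 * s) u"
      if "u \<in> bessel_space p (2 * s)" for u :: "'n distr"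
      using C3(2,3)[of u] one[OF that] that by (auto simp: bessel_space_def bessel_norm_def)
    then show "continuously_embedded
           (bessel_space p (2 * s) :: 'n distr set) (bessel_norm p (2 * s))
           (Lp_space p) (Lp_norm p)"
      using C3(1) by (auto simp: continuously_embedded_def intro!: exI[of _ C3])
    define C where "C = max C1 C2"
    have "ennreal C1 * x \<le> ennreal C * x" "ennreal C2 * x \<le> ennreal C * x" for x
      by (auto simp: C_def intro!: mult_right_mono ennreal_leI)
    then have "bessel_norm p (2 * s) u \<le> ennreal C * log_bessel_norm p s l u"
      "log_bessel_norm p s l u \<le> ennreal C * bessel_norm p (2 * s + \<epsilon>) u" for u :: "'n distr"
      using C1(2)[of u] C2(2)[of u] unfolding bessel_norm_def log_bessel_norm_def by (meson order_trans)+
    moreover have "C \<ge> 1" using C1(1) by (simp add: C_def)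
    ultimately show "\<exists>C::real. C \<ge> 1 \<and> (\<forall>u \<in> (schwartz :: (real ^ 'n \<Rightarrow> complex) set).
              bessel_norm p (2 * s) (distr_of u) \<le> ennreal C * log_bessel_norm p s l (distr_of u)
            \<and> log_bessel_norm p s l (distr_of u) \<le> ennreal C * bessel_norm p (2 * s + \<epsilon>) (distr_of u))"
      by blast
  qed
qed

end
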